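(* Let $G$ be a finite group. There is a functor $$K_G\colon \mathrm{Fun}_{\mathbf{PC}}(G\mathcal{E}^{\mathrm{op}},\mathrm{Perm})\to \mathrm{Fun}_{\mathcal{S}pec}(G\mathcal{B}^{\mathrm{op}},\mathcal{S}pec)$$ from the category of $\mathbf{PC}$-functors $G\mathcal{E}^{\mathrm{op}}\to\mathrm{Perm}$ and $\mathbf{PC}$-natural transformations to the category of spectrally enriched functors $G\mathcal{B}^{\mathrm{op}}\to\mathcal{S}pec$ and spectrally enriched natural transformations, with the following property: for every $\mathbf{PC}$-functor $X\colon G\mathcal{E}^{\mathrm{op}}\to\mathrm{Perm}$ and every finite $G$-set $A$, the spectral functor $K_G(X)$ takes $A\in G\mathcal{B}$ to the spectrum $\mathbb{K}(X(A))$.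
   Context: **Permutative categories and multilinear functors.** A permutative category is a symmetric monoidal category whose associativity and unit constraints are identities; product $\oplus$, unit $0$, symmetry $\gamma$. Permutative categories, functors and natural transformations are assumed topologically enriched. A strictly unital lax symmetric monoidal functor $(f,\delta)\colon\mathcal{A}\to\mathcal{B}$ is a functor $f$ with a natural transformation $\delta\colon f(a)\oplus f(a')\to f(a\oplus a')$ (the structure morphism) such that $f(0)=0$; $\delta=\mathrm{id}$ if $a$ or $a'$ is $0$; $\delta\circ(\mathrm{id}\oplus\delta)=\delta\circ(\delta\oplus\mathrm{id})$ as maps $f(a)\oplus f(a')\oplus f(a'')\to f(a\oplus a'\oplus a'')$; and $f(\gamma)\circ\delta=\delta\circ\gamma$. A multilinear functor $(f;\delta_1,\dots,\delta_k)\colon(\mathcal{A}_1,\dots,\mathcal{A}_k)\to\mathcal{B}$ is a functor $f\colon\mathcal{A}_1\times\cdots\times\mathcal{A}_k\to\mathcal{B}$ with natural transformations (linearity constraints) $\delta_i\colon f(\dots,a_i,\dots)\oplus f(\dots,a_i',\dots)\to f(\dots,a_i\oplus a_i',\dots)$ such that: $f(a_1,\dots,a_k)=0$ if some $a_j=0$ (and likewise $f$ of morphisms is $\mathrm{id}_0$ if one of them is $\mathrm{id}_0$); $\delta_i$ is the identity if $a_i$, $a_i'$ or some other $a_j$ is $0$; each $\delta_i$ satisfies the associativity and symmetry conditions above in the $i$-th variable; and for $i\ne j$ the two maps $f(a_i,a_j)\oplus f(a_i',a_j)\oplus f(a_i,a_j')\oplus f(a_i',a_j')\to f(a_i\oplus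 a_i',a_j\oplus a_j')$ given by $\delta_j\circ(\delta_i\oplus\delta_i)$ and $\delta_i\circ(\delta_j\oplus\delta_j)\circ(\mathrm{id}\oplus\gamma\oplus\mathrm{id})$ agree. The (symmetric) multicategory $\underline{\mathrm{Perm}}$ has small permutative categories as objects and multilinear functors as $k$-morphisms; a $0$-morphism $()\to\mathcal{A}$ is an object of $\mathcal{A}$. The underlying functor of a composite is the evident one, and its constraint in the $i$-th variable of $f_j$ is $g(\delta_i^{f_j})\circ\delta_j^g$. **$\mathbf{PC}$-categories.** A $\mathbf{PC}$-category (resp. $\mathbf{PC}$-functor, $\mathbf{PC}$-natural transformation) is a category (resp. functor, natural transformation) enriched in $\underline{\mathrm{Perm}}$: hom objects are permutative categories, composition is a bilinear functor $(C(Y,Z),C(X,Y))\to C(X,Z)$, identities are objects $\mathrm{id}_X\in C(X,X)$, strictly associative and unital. A $\mathbf{PC}$-functor consists of an object assignment and strictly unital lax symmetric monoidal functors $C(X,Y)\to D(FX,FY)$ compatible (in $\underline{\mathrm{Perm}}$) with composition and identities. A $\mathbf{PC}$-natural transformation $\alpha\colon F\to F'$ consists of objects $\alpha_X\in D(FX,F'X)$ with $(\alpha_X)^*\circ F'=(\alpha_Y)_*\circ F$ as strictly unital lax symmetric monoidal functors $C(X,Y)\to D(FX,F'Y)$. Opposites are formed using the symmetry of $\underline{\mathrm{Perm}}$. **The $\mathbf{PC}$-category $\mathrm{Perm}$.** Objects: small permutative categories. $\mathrm{Perm}(\mathcal{A},\mathcal{B})$: strictly unital lax symmetric monoidal functors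 and monoidal natural transformations, with pointwise sum $(f\oplus g)(a)=f(a)\oplus g(a)$ and structure morphism $(\delta^f\oplus\delta^g)\circ(1\oplus\gamma\oplus1)$. Composition is the usual one, with $\delta_1=\mathrm{id}$ and $\delta_2\colon(g\circ f)\oplus(g\circ f')\to g\circ(f\oplus f')$ the structure morphism of $g$. **$K$-theory.** $\mathcal{S}pec$ is a closed symmetric monoidal category of spectra (smash product $\wedge$, unit $S$, function spectra $F(-,-)$), viewed as a multicategory with $k$-morphisms the maps $E_1\wedge\cdots\wedge E_k\to E'$ and $0$-morphisms the maps $S\to E'$, and as a category enriched in itself. $\mathbb{K}\colon\underline{\mathrm{Perm}}\to\mathcal{S}pec$ is a fixed $K$-theory machine that is a multifunctor. For a $\mathbf{PC}$-category $C$, $\mathbb{K}_\bullet C$ is the spectrally enriched category with the same objects and morphism spectra $\mathbb{K}(C(X,Y))$; $\mathbb{K}_\bullet$ is a 2-functor from $\mathbf{PC}$-categories to spectrally enriched categories. **The Burnside categories.** A finite $G$-set is a pair $(\mathbf{n},\alpha)$ with $\mathbf{n}=\{1,\dots,n\}$ and $\alpha\colon G\to\Sigma_n$ a homomorphism; disjoint union is $(\mathbf{n+m},\alpha+\beta)$ (block sum). The $\mathbf{PC}$-category $G\mathcal{E}$ has finite $G$-sets as objects; $G\mathcal{E}(A,B)$ is the category of spans $A\leftarrow C\to B$ of finite $G$-sets and isomorphisms of spans, permutative under disjoint union of the apex $C$. Composition is by pullback: for $A\xrightarrow{f}B\xleftarrow{f'}C$ the chosen pullback is $C$ if $f$ is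 the identity, $A$ if $f'$ is the identity, and otherwise the subset of $A\times C$ (lexicographically ordered) cut out by the pullback condition. Standing assumption: composition in $G\mathcal{E}$ is strictly associative and unital, so that $G\mathcal{E}$ is a $\mathbf{PC}$-category. Put $G\mathcal{B}=\mathbb{K}_\bullet G\mathcal{E}$. (By a theorem of Guillou and May, the category of spectrally enriched functors $G\mathcal{B}^{\mathrm{op}}\to\mathcal{S}pec$ is Quillen equivalent to the category of genuine $G$-spectra, so such a functor represents a genuine $G$-spectrum.) *)

theory Defs
  imports "HOL-Analysis.Product_Topology" "HOL-Algebra.Sym_Groups"
begin

section \<open>Categories and functors\<close>

record ('o, 'a) cat =
  Obj :: "'o set"
  Arr :: "'a set"
  Dom :: "'a \<Rightarrow> 'o"
  Cod :: "'a \<Rightarrow> 'o"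
  Ide :: "'o \<Rightarrow> 'a"
  Cmp :: "'a \<Rightarrow> 'a \<Rightarrow> 'a"  (infixl \<open>\<cdot>\<index>\<close> 65)

definition homset :: "('o, 'a, 'z) cat_scheme \<Rightarrow> 'o \<Rightarrow> 'o \<Rightarrow> 'a set" where
  "homset C x y = {u \<in> Arr C. Dom C u = x \<and> Cod C u = y}"

definition category :: "('o, 'a, 'z) cat_scheme \<Rightarrow> bool" where
  "category C \<longleftrightarrow>
     (\<forall>u\<in>Arr C. Dom C u \<in> Obj C \<and> Cod C u \<in> Obj C) \<and>
     (\<forall>x\<in>Obj C. Ide C x \<in> homset C x x) \<and>
     (\<forall>u\<in>Arr C. \<forall>v\<in>Arr C. Cod C u = Dom C v \<longrightarrow> v \<cdot>\<^bsub>C\<^esub> u \<in> homset C (Dom C u) (Cod C v)) \<and>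
     (\<forall>u\<in>Arr C. u \<cdot>\<^bsub>C\<^esub> Ide C (Dom C u) = u \<and> Ide C (Cod C u) \<cdot>\<^bsub>C\<^esub> u = u) \<and>
     (\<forall>u\<in>Arr C. \<forall>v\<in>Arr C. \<forall>w\<in>Arr C. Cod C u = Dom C v \<and> Cod C v = Dom C w \<longrightarrow>
        w \<cdot>\<^bsub>C\<^esub> (v \<cdot>\<^bsub>C\<^esub> u) = (w \<cdot>\<^bsub>C\<^esub> v) \<cdot>\<^bsub>C\<^esub> u)"

definition is_functor ::
  "('o, 'a, 'z) cat_scheme \<Rightarrow> ('p, 'b, 'y) cat_scheme \<Rightarrow> ('o \<Rightarrow> 'p) \<Rightarrow> ('a \<Rightarrow> 'b) \<Rightarrow> bool" where
  "is_functor C D fo fa \<longleftrightarrow>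
     (\<forall>x\<in>Obj C. fo x \<in> Obj D) \<and>
     (\<forall>u\<in>Arr C. fa u \<in> homset D (fo (Dom C u)) (fo (Cod C u))) \<and>
     (\<forall>x\<in>Obj C. fa (Ide C x) = Ide D (fo x)) \<and>
     (\<forall>u\<in>Arr C. \<forall>v\<in>Arr C. Cod C u = Dom C v \<longrightarrow> fa (v \<cdot>\<^bsub>C\<^esub> u) = fa v \<cdot>\<^bsub>D\<^esub> fa u)"


section \<open>Permutative categories\<close>

text \<open>
  \<^term>\<open>HTop P x y\<close> is the topology on the set of morphisms from \<open>x\<close> to \<open>y\<close>.  Topologically
  enriched means enriched in the category of all topological spaces with its cartesian product.
\<close>

record ('o, 'a) permcat = "('o, 'a) cat" +
  HTop :: "'o \<Rightarrow> 'o \<Rightarrow> 'a topology"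
  Zro  :: "'o"  (\<open>\<zero>p\<index>\<close>)
  Add  :: "'o \<Rightarrow> 'o \<Rightarrow> 'o"  (infixl \<open>\<boxplus>\<index>\<close> 70)
  AddA :: "'a \<Rightarrow> 'a \<Rightarrow> 'a"  (infixl \<open>\<uplus>\<index>\<close> 70)
  Swp  :: "'o \<Rightarrow> 'o \<Rightarrow> 'a"

definition permutative_category :: "('o, 'a) permcat \<Rightarrow> bool" where
  "permutative_category P \<longleftrightarrow>
     category P \<and>
     (\<forall>x\<in>Obj P. \<forall>y\<in>Obj P. topspace (HTop P x y) = homset P x y) \<and>
     (\<forall>x\<in>Obj P. \<forall>y\<in>Obj P. \<forall>z\<in>Obj P.
        continuous_map (prod_topology (HTop P y z) (HTop P x y)) (HTop P x z) (\<lambda>(v, u). v \<cdot>\<^bsub>P\<^esub> u)) \<and>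
     \<zero>p\<^bsub>P\<^esub> \<in> Obj P \<and>
     (\<forall>x\<in>Obj P. \<forall>y\<in>Obj P. x \<boxplus>\<^bsub>P\<^esub> y \<in> Obj P) \<and>
     (\<forall>u\<in>Arr P. \<forall>v\<in>Arr P.
        u \<uplus>\<^bsub>P\<^esub> v \<in> homset P (Dom P u \<boxplus>\<^bsub>P\<^esub> Dom P v) (Cod P u \<boxplus>\<^bsub>P\<^esub> Cod P v)) \<and>
     (\<forall>x\<in>Obj P. \<forall>y\<in>Obj P. Ide P x \<uplus>\<^bsub>P\<^esub> Ide P y = Ide P (x \<boxplus>\<^bsub>P\<^esub> y)) \<and>
     (\<forall>u\<in>Arr P. \<forall>u'\<in>Arr P. \<forall>v\<in>Arr P. \<forall>v'\<in>Arr P. Cod P u = Dom P u' \<and> Cod P v = Dom P v' \<longrightarrow>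
        (u' \<cdot>\<^bsub>P\<^esub> u) \<uplus>\<^bsub>P\<^esub> (v' \<cdot>\<^bsub>P\<^esub> v) = (u' \<uplus>\<^bsub>P\<^esub> v') \<cdot>\<^bsub>P\<^esub> (u \<uplus>\<^bsub>P\<^esub> v)) \<and>
     (\<forall>x\<in>Obj P. \<forall>x'\<in>Obj P. \<forall>y\<in>Obj P. \<forall>y'\<in>Obj P.
        continuous_map (prod_topology (HTop P x y) (HTop P x' y')) (HTop P (x \<boxplus>\<^bsub>P\<^esub> x') (y \<boxplus>\<^bsub>P\<^esub> y'))
          (\<lambda>(u, v). u \<uplus>\<^bsub>P\<^esub> v)) \<and>
     (\<forall>x\<in>Obj P. \<forall>y\<in>Obj P. \<forall>z\<in>Obj P. (x \<boxplus>\<^bsub>P\<^esub> y) \<boxplus>\<^bsub>P\<^esub> z = x \<boxplus>\<^bsub>P\<^esub> (y \<boxplus>\<^bsub>P\<^esub> z)) \<and>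
     (\<forall>u\<in>Arr P. \<forall>v\<in>Arr P. \<forall>w\<in>Arr P. (u \<uplus>\<^bsub>P\<^esub> v) \<uplus>\<^bsub>P\<^esub> w = u \<uplus>\<^bsub>P\<^esub> (v \<uplus>\<^bsub>P\<^esub> w)) \<and>
     (\<forall>x\<in>Obj P. \<zero>p\<^bsub>P\<^esub> \<boxplus>\<^bsub>P\<^esub> x = x \<and> x \<boxplus>\<^bsub>P\<^esub> \<zero>p\<^bsub>P\<^esub> = x) \<and>
     (\<forall>u\<in>Arr P. Ide P \<zero>p\<^bsub>P\<^esub> \<uplus>\<^bsub>P\<^esub> u = u \<and> u \<uplus>\<^bsub>P\<^esub> Ide P \<zero>p\<^bsub>P\<^esub> = u) \<and>
     (\<forall>x\<in>Obj P. \<forall>y\<in>Obj P. Swp P x y \<in> homset P (x \<boxplus>\<^bsub>P\<^esub> y) (y \<boxplus>\<^bsub>P\<^esub> x)) \<and>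
     (\<forall>u\<in>Arr P. \<forall>v\<in>Arr P.
        Swp P (Cod P u) (Cod P v) \<cdot>\<^bsub>P\<^esub> (u \<uplus>\<^bsub>P\<^esub> v) = (v \<uplus>\<^bsub>P\<^esub> u) \<cdot>\<^bsub>P\<^esub> Swp P (Dom P u) (Dom P v)) \<and>
     (\<forall>x\<in>Obj P. \<forall>y\<in>Obj P. Swp P y x \<cdot>\<^bsub>P\<^esub> Swp P x y = Ide P (x \<boxplus>\<^bsub>P\<^esub> y)) \<and>
     (\<forall>x\<in>Obj P. Swp P x \<zero>p\<^bsub>P\<^esub> = Ide P x) \<and>
     (\<forall>x\<in>Obj P. \<forall>y\<in>Obj P. \<forall>z\<in>Obj P.
        Swp P (x \<boxplus>\<^bsub>P\<^esub> y) z = (Swp P x z \<uplus>\<^bsub>P\<^esub> Ide P y) \<cdot>\<^bsub>P\<^esub> (Ide P x \<uplus>\<^bsub>P\<^esub> Swp P y z))"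


section \<open>Strictly unital lax symmetric monoidal functors\<close>

text \<open>
  Structure maps are kept equal to \<^const>\<open>undefined\<close> outside their mathematical domain (here and
  for multilinear functors below), so that equality in HOL is equality of functors.
\<close>

record ('o, 'a, 'p, 'b) laxfun =
  LO :: "'o \<Rightarrow> 'p"
  LA :: "'a \<Rightarrow> 'b"
  LS :: "'o \<Rightarrow> 'o \<Rightarrow> 'b"

definition mk_lax ::
  "('o, 'a) permcat \<Rightarrow> ('o \<Rightarrow> 'p) \<Rightarrow> ('a \<Rightarrow> 'b) \<Rightarrow> ('o \<Rightarrow> 'o \<Rightarrow> 'b) \<Rightarrow> ('o, 'a, 'p, 'b) laxfun" where
  "mk_lax A fo fa d =
     \<lparr>LO = restrict fo (Obj A), LA = restrict fa (Arr A),
      LS = (\<lambda>x y. if x \<in> Obj A \<and> y \<in> Obj A then d x y else undefined)\<rparr>"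

definition lax_functor ::
  "('o, 'a) permcat \<Rightarrow> ('p, 'b) permcat \<Rightarrow> ('o, 'a, 'p, 'b) laxfun \<Rightarrow> bool" where
  "lax_functor A B f \<longleftrightarrow>
     f = mk_lax A (LO f) (LA f) (LS f) \<and>
     is_functor A B (LO f) (LA f) \<and>
     (\<forall>x\<in>Obj A. \<forall>y\<in>Obj A. continuous_map (HTop A x y) (HTop B (LO f x) (LO f y)) (LA f)) \<and>
     LO f \<zero>p\<^bsub>A\<^esub> = \<zero>p\<^bsub>B\<^esub> \<and>
     (\<forall>x\<in>Obj A. \<forall>y\<in>Obj A. LS f x y \<in> homset B (LO f x \<boxplus>\<^bsub>B\<^esub> LO f y) (LO f (x \<boxplus>\<^bsub>A\<^esub> y))) \<and>
     (\<forall>u\<in>Arr A. \<forall>v\<in>Arr A.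
        LS f (Cod A u) (Cod A v) \<cdot>\<^bsub>B\<^esub> (LA f u \<uplus>\<^bsub>B\<^esub> LA f v)
          = LA f (u \<uplus>\<^bsub>A\<^esub> v) \<cdot>\<^bsub>B\<^esub> LS f (Dom A u) (Dom A v)) \<and>
     (\<forall>x\<in>Obj A. LS f x \<zero>p\<^bsub>A\<^esub> = Ide B (LO f x) \<and> LS f \<zero>p\<^bsub>A\<^esub> x = Ide B (LO f x)) \<and>
     (\<forall>x\<in>Obj A. \<forall>y\<in>Obj A. \<forall>z\<in>Obj A.
        LS f x (y \<boxplus>\<^bsub>A\<^esub> z) \<cdot>\<^bsub>B\<^esub> (Ide B (LO f x) \<uplus>\<^bsub>B\<^esub> LS f y z)
          = LS f (x \<boxplus>\<^bsub>A\<^esub> y) z \<cdot>\<^bsub>B\<^esub> (LS f x y \<uplus>\<^bsub>B\<^esub> Ide B (LO f z))) \<and>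
     (\<forall>x\<in>Obj A. \<forall>y\<in>Obj A.
        LA f (Swp A x y) \<cdot>\<^bsub>B\<^esub> LS f x y = LS f y x \<cdot>\<^bsub>B\<^esub> Swp B (LO f x) (LO f y))"

definition lax_id :: "('o, 'a) permcat \<Rightarrow> ('o, 'a, 'o, 'a) laxfun" where
  "lax_id A = mk_lax A (\<lambda>x. x) (\<lambda>u. u) (\<lambda>x y. Ide A (x \<boxplus>\<^bsub>A\<^esub> y))"

definition lax_comp ::
  "('o, 'a) permcat \<Rightarrow> ('q, 'c) permcat \<Rightarrow> ('p, 'b, 'q, 'c) laxfun \<Rightarrow> ('o, 'a, 'p, 'b) laxfun
     \<Rightarrow> ('o, 'a, 'q, 'c) laxfun" where
  "lax_comp A C g f =
     mk_lax A (\<lambda>x. LO g (LO f x)) (\<lambda>u. LA g (LA f u))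
       (\<lambda>x y. LA g (LS f x y) \<cdot>\<^bsub>C\<^esub> LS g (LO f x) (LO f y))"

definition monoidal_nat ::
  "('o, 'a) permcat \<Rightarrow> ('p, 'b) permcat \<Rightarrow> ('o, 'a, 'p, 'b) laxfun \<Rightarrow> ('o, 'a, 'p, 'b) laxfun
     \<Rightarrow> ('o \<Rightarrow> 'b) \<Rightarrow> bool" where
  "monoidal_nat A B f g \<eta> \<longleftrightarrow>
     \<eta> \<in> extensional (Obj A) \<and>
     (\<forall>x\<in>Obj A. \<eta> x \<in> homset B (LO f x) (LO g x)) \<and>
     (\<forall>u\<in>Arr A. \<eta> (Cod A u) \<cdot>\<^bsub>B\<^esub> LA f u = LA g u \<cdot>\<^bsub>B\<^esub> \<eta> (Dom A u)) \<and>
     \<eta> \<zero>p\<^bsub>A\<^esub> = Ide B \<zero>p\<^bsub>B\<^esub> \<and>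
     (\<forall>x\<in>Obj A. \<forall>y\<in>Obj A. \<eta> (x \<boxplus>\<^bsub>A\<^esub> y) \<cdot>\<^bsub>B\<^esub> LS f x y = LS g x y \<cdot>\<^bsub>B\<^esub> (\<eta> x \<uplus>\<^bsub>B\<^esub> \<eta> y))"


section \<open>Multilinear functors\<close>

text \<open>
  The \<open>k\<close> variables are given by lists of length \<open>k\<close> and are numbered from \<open>0\<close>.
  \<^term>\<open>MD f i xs y\<close> is the constraint
  \<open>f(\<dots>, xs!i, \<dots>) \<oplus> f(\<dots>, y, \<dots>) \<rightarrow> f(\<dots>, xs!i \<oplus> y, \<dots>)\<close> in the \<open>i\<close>-th variable, the other variables
  being those of \<open>xs\<close>.
\<close>

record ('o, 'a, 'p, 'b) mfun =
  MO :: "'o list \<Rightarrow> 'p"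
  MA :: "'a list \<Rightarrow> 'b"
  MD :: "nat \<Rightarrow> 'o list \<Rightarrow> 'o \<Rightarrow> 'b"

definition obj_tuples :: "('o, 'a) permcat list \<Rightarrow> 'o list set" where
  "obj_tuples As = {xs. list_all2 (\<lambda>x A. x \<in> Obj A) xs As}"

definition arr_tuples :: "('o, 'a) permcat list \<Rightarrow> 'a list set" where
  "arr_tuples As = {us. list_all2 (\<lambda>u A. u \<in> Arr A) us As}"

abbreviation doms :: "('o, 'a) permcat list \<Rightarrow> 'a list \<Rightarrow> 'o list" where
  "doms As us \<equiv> map2 Dom As us"

abbreviation cods :: "('o, 'a) permcat list \<Rightarrow> 'a list \<Rightarrow> 'o list" where
  "cods As us \<equiv> map2 Cod As us"

abbreviation ides :: "('o, 'a) permcat list \<Rightarrow> 'o list \<Rightarrow> 'a list" where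
  "ides As xs \<equiv> map2 Ide As xs"

definition mk_mfun ::
  "('o, 'a) permcat list \<Rightarrow> ('o list \<Rightarrow> 'p) \<Rightarrow> ('a list \<Rightarrow> 'b) \<Rightarrow> (nat \<Rightarrow> 'o list \<Rightarrow> 'o \<Rightarrow> 'b)
     \<Rightarrow> ('o, 'a, 'p, 'b) mfun" where
  "mk_mfun As fo fa d =
     \<lparr>MO = restrict fo (obj_tuples As), MA = restrict fa (arr_tuples As),
      MD = (\<lambda>i xs y. if i < length As \<and> xs \<in> obj_tuples As \<and> y \<in> Obj (As ! i)
                     then d i xs y else undefined)\<rparr>"

definition multilinear ::
  "('o, 'a) permcat list \<Rightarrow> ('p, 'b) permcat \<Rightarrow> ('o, 'a, 'p, 'b) mfun \<Rightarrow> bool" where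
  "multilinear As B f \<longleftrightarrow>
     f = mk_mfun As (MO f) (MA f) (MD f) \<and>
     (\<forall>xs\<in>obj_tuples As. MO f xs \<in> Obj B) \<and>
     (\<forall>us\<in>arr_tuples As. MA f us \<in> homset B (MO f (doms As us)) (MO f (cods As us))) \<and>
     (\<forall>xs\<in>obj_tuples As. MA f (ides As xs) = Ide B (MO f xs)) \<and>
     (\<forall>us\<in>arr_tuples As. \<forall>vs\<in>arr_tuples As. cods As us = doms As vs \<longrightarrow>
        MA f (map2 (\<lambda>A (v, u). v \<cdot>\<^bsub>A\<^esub> u) As (zip vs us)) = MA f vs \<cdot>\<^bsub>B\<^esub> MA f us) \<and>
     (\<forall>xs\<in>obj_tuples As. \<forall>ys\<in>obj_tuples As.
        continuous_map (product_topology (\<lambda>i. HTop (As ! i) (xs ! i) (ys ! i)) {..<length As})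
          (HTop B (MO f xs) (MO f ys)) (\<lambda>\<phi>. MA f (map \<phi> [0..<length As]))) \<and>
     (\<forall>xs\<in>obj_tuples As. \<forall>i<length As. xs ! i = \<zero>p\<^bsub>As ! i\<^esub> \<longrightarrow> MO f xs = \<zero>p\<^bsub>B\<^esub>) \<and>
     (\<forall>us\<in>arr_tuples As. \<forall>i<length As. us ! i = Ide (As ! i) \<zero>p\<^bsub>As ! i\<^esub> \<longrightarrow>
        MA f us = Ide B \<zero>p\<^bsub>B\<^esub>) \<and>
     (\<forall>i<length As. \<forall>xs\<in>obj_tuples As. \<forall>y\<in>Obj (As ! i).
        MD f i xs y \<in> homset B (MO f xs \<boxplus>\<^bsub>B\<^esub> MO f (xs[i := y])) (MO f (xs[i := xs ! i \<boxplus>\<^bsub>As ! i\<^esub> y]))) \<and>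
     (\<forall>i<length As. \<forall>us\<in>arr_tuples As. \<forall>v\<in>Arr (As ! i).
        MD f i (cods As us) (Cod (As ! i) v) \<cdot>\<^bsub>B\<^esub> (MA f us \<uplus>\<^bsub>B\<^esub> MA f (us[i := v]))
          = MA f (us[i := us ! i \<uplus>\<^bsub>As ! i\<^esub> v]) \<cdot>\<^bsub>B\<^esub> MD f i (doms As us) (Dom (As ! i) v)) \<and>
     (\<forall>i<length As. \<forall>xs\<in>obj_tuples As. \<forall>y\<in>Obj (As ! i).
        y = \<zero>p\<^bsub>As ! i\<^esub> \<or> (\<exists>j<length As. xs ! j = \<zero>p\<^bsub>As ! j\<^esub>) \<longrightarrow>
        MD f i xs y = Ide B (MO f (xs[i := xs ! i \<boxplus>\<^bsub>As ! i\<^esub> y]))) \<and>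
     (\<forall>i<length As. \<forall>xs\<in>obj_tuples As. \<forall>y\<in>Obj (As ! i). \<forall>z\<in>Obj (As ! i).
        MD f i xs (y \<boxplus>\<^bsub>As ! i\<^esub> z) \<cdot>\<^bsub>B\<^esub> (Ide B (MO f xs) \<uplus>\<^bsub>B\<^esub> MD f i (xs[i := y]) z)
          = MD f i (xs[i := xs ! i \<boxplus>\<^bsub>As ! i\<^esub> y]) z \<cdot>\<^bsub>B\<^esub> (MD f i xs y \<uplus>\<^bsub>B\<^esub> Ide B (MO f (xs[i := z])))) \<and>
     (\<forall>i<length As. \<forall>xs\<in>obj_tuples As. \<forall>y\<in>Obj (As ! i).
        MA f ((ides As xs)[i := Swp (As ! i) (xs ! i) y]) \<cdot>\<^bsub>B\<^esub> MD f i xs y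
          = MD f i (xs[i := y]) (xs ! i) \<cdot>\<^bsub>B\<^esub> Swp B (MO f xs) (MO f (xs[i := y]))) \<and>
     (\<forall>i<length As. \<forall>j<length As. \<forall>xs\<in>obj_tuples As. \<forall>y\<in>Obj (As ! i). \<forall>z\<in>Obj (As ! j). i \<noteq> j \<longrightarrow>
        MD f j (xs[i := xs ! i \<boxplus>\<^bsub>As ! i\<^esub> y]) z
            \<cdot>\<^bsub>B\<^esub> (MD f i xs y \<uplus>\<^bsub>B\<^esub> MD f i (xs[j := z]) y)
          = MD f i (xs[j := xs ! j \<boxplus>\<^bsub>As ! j\<^esub> z]) y
              \<cdot>\<^bsub>B\<^esub> (MD f j xs z \<uplus>\<^bsub>B\<^esub> MD f j (xs[i := y]) z)
              \<cdot>\<^bsub>B\<^esub> (Ide B (MO f xs) \<uplus>\<^bsub>B\<^esub> Swp B (MO f (xs[i := y])) (MO f (xs[j := z]))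
                    \<uplus>\<^bsub>B\<^esub> Ide B (MO f (xs[i := y, j := z]))))"

definition unary :: "('o, 'a) permcat \<Rightarrow> ('o, 'a, 'p, 'b) laxfun \<Rightarrow> ('o, 'a, 'p, 'b) mfun" where
  "unary A f = mk_mfun [A] (\<lambda>xs. LO f (hd xs)) (\<lambda>us. LA f (hd us)) (\<lambda>i xs y. LS f (hd xs) y)"

definition point :: "('p, 'b) permcat \<Rightarrow> 'p \<Rightarrow> ('o, 'a, 'p, 'b) mfun" where
  "point B x = mk_mfun [] (\<lambda>xs. x) (\<lambda>us. Ide B x) (\<lambda>i xs y. undefined)"

text \<open>
  \<^term>\<open>chop ns xs\<close> cuts \<open>xs\<close> into blocks of lengths \<open>ns\<close>; \<^term>\<open>locate ns i\<close> is the block containing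
  position \<open>i\<close>, together with the position inside that block.
\<close>

fun chop :: "nat list \<Rightarrow> 'x list \<Rightarrow> 'x list list" where
  "chop [] xs = []"
| "chop (n # ns) xs = take n xs # chop ns (drop n xs)"

fun locate :: "nat list \<Rightarrow> nat \<Rightarrow> nat \<times> nat" where
  "locate [] i = (0, i)"
| "locate (n # ns) i = (if i < n then (0, i) else (let (j, l) = locate ns (i - n) in (Suc j, l)))"

text \<open>
  In the composite of \<open>g : Bs \<rightarrow> C\<close> with \<open>fs ! j : Ass ! j \<rightarrow> Bs ! j\<close>, the constraint in the \<open>l\<close>-th variable
  of \<open>f = fs ! j\<close> is \<open>g(\<delta>\<^sub>l\<^sup>f) \<circ> \<delta>\<^sub>j\<^sup>g\<close>.
\<close>

definition mcomp ::
  "('o, 'a) permcat list list \<Rightarrow> ('p, 'b) permcat list \<Rightarrow> ('q, 'c) permcat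
     \<Rightarrow> ('p, 'b, 'q, 'c) mfun \<Rightarrow> ('o, 'a, 'p, 'b) mfun list \<Rightarrow> ('o, 'a, 'q, 'c) mfun" where
  "mcomp Ass Bs C g fs =
     (let ns = map length Ass in
      mk_mfun (concat Ass)
        (\<lambda>xs. MO g (map2 MO fs (chop ns xs)))
        (\<lambda>us. MA g (map2 MA fs (chop ns us)))
        (\<lambda>i xs y. let xss = chop ns xs; (j, l) = locate ns i; zs = map2 MO fs xss in
           MA g ((ides Bs zs)[j := MD (fs ! j) l (xss ! j) y])
             \<cdot>\<^bsub>C\<^esub> MD g j zs (MO (fs ! j) ((xss ! j)[l := y]))))"

definition swap_list :: "nat \<Rightarrow> 'x list \<Rightarrow> 'x list" where
  "swap_list i xs = xs[i := xs ! Suc i, Suc i := xs ! i]"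

definition mswap ::
  "('o, 'a) permcat list \<Rightarrow> nat \<Rightarrow> ('o, 'a, 'p, 'b) mfun \<Rightarrow> ('o, 'a, 'p, 'b) mfun" where
  "mswap As i f =
     mk_mfun (swap_list i As)
       (\<lambda>xs. MO f (swap_list i xs)) (\<lambda>us. MA f (swap_list i us))
       (\<lambda>j xs y. MD f (transpose i (Suc i) j) (swap_list i xs) y)"


section \<open>Multicategories and multifunctors\<close>

text \<open>
  \<open>MComp M Ass Bs C g fs\<close> is the composite of \<open>g : Bs \<rightarrow> C\<close> with \<open>fs ! j : Ass ! j \<rightarrow> Bs ! j\<close>, and
  \<open>MSwap M As B i f : swap_list i As \<rightarrow> B\<close> is the action of the transposition of the variables \<open>i\<close>
  and \<open>Suc i\<close> on \<open>f : As \<rightarrow> B\<close>.  As these transpositions generate the symmetric groups, a multifunctor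
  compatible with them is compatible with the actions of all permutations.
\<close>

record ('o, 'm) multicat =
  MObj  :: "'o set"
  MMor  :: "'o list \<Rightarrow> 'o \<Rightarrow> 'm set"
  MIde  :: "'o \<Rightarrow> 'm"
  MComp :: "'o list list \<Rightarrow> 'o list \<Rightarrow> 'o \<Rightarrow> 'm \<Rightarrow> 'm list \<Rightarrow> 'm"
  MSwap :: "'o list \<Rightarrow> 'o \<Rightarrow> nat \<Rightarrow> 'm \<Rightarrow> 'm"

definition multifunctor ::
  "('o, 'm) multicat \<Rightarrow> ('p, 'n) multicat \<Rightarrow> ('o \<Rightarrow> 'p) \<Rightarrow> ('o list \<Rightarrow> 'o \<Rightarrow> 'm \<Rightarrow> 'n) \<Rightarrow> bool" where
  "multifunctor M N Ko Km \<longleftrightarrow>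
     (\<forall>A\<in>MObj M. Ko A \<in> MObj N) \<and>
     (\<forall>As B f. set As \<subseteq> MObj M \<and> B \<in> MObj M \<and> f \<in> MMor M As B \<longrightarrow>
        Km As B f \<in> MMor N (map Ko As) (Ko B)) \<and>
     (\<forall>A\<in>MObj M. Km [A] A (MIde M A) = MIde N (Ko A)) \<and>
     (\<forall>Ass Bs C g fs.
        length Ass = length Bs \<and> length fs = length Bs \<and>
        set (concat Ass) \<subseteq> MObj M \<and> set Bs \<subseteq> MObj M \<and> C \<in> MObj M \<and>
        g \<in> MMor M Bs C \<and> (\<forall>j<length Bs. fs ! j \<in> MMor M (Ass ! j) (Bs ! j)) \<longrightarrow>
        Km (concat Ass) C (MComp M Ass Bs C g fs)
          = MComp N (map (map Ko) Ass) (map Ko Bs) (Ko C) (Km Bs C g)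
              (map (\<lambda>j. Km (Ass ! j) (Bs ! j) (fs ! j)) [0..<length Bs])) \<and>
     (\<forall>As B i f. set As \<subseteq> MObj M \<and> B \<in> MObj M \<and> f \<in> MMor M As B \<and> Suc i < length As \<longrightarrow>
        Km (swap_list i As) B (MSwap M As B i f)
          = MSwap N (map Ko As) (Ko B) i (Km As B f))"

text \<open>
  Small permutative categories are those whose objects and morphisms are elements of the universe
  types \<open>'o\<close> and \<open>'a\<close>.
\<close>

definition perm_multicat :: "(('o, 'a) permcat, ('o, 'a, 'o, 'a) mfun) multicat" where
  "perm_multicat =
     \<lparr>MObj = {A. permutative_category A},
      MMor = (\<lambda>As B. {f. multilinear As B f}),
      MIde = (\<lambda>A. unary A (lax_id A)),
      MComp = mcomp,
      MSwap = (\<lambda>As B i f. mswap As i f)\<rparr>"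


section \<open>Categories enriched in permutative categories\<close>

text \<open>
  The hom permutative categories may be carried by arbitrary types, so that the permutative
  categories of functors that make up \<open>Perm\<close> below are admitted.
\<close>

record ('x, 'o, 'a) pccat =
  PcObj  :: "'x set"
  PcHom  :: "'x \<Rightarrow> 'x \<Rightarrow> ('o, 'a) permcat"
  PcComp :: "'x \<Rightarrow> 'x \<Rightarrow> 'x \<Rightarrow> ('o, 'a, 'o, 'a) mfun"  \<comment> \<open>\<open>PcComp C X Y Z : (C(Y,Z), C(X,Y)) \<rightarrow> C(X,Z)\<close>\<close>
  PcIde  :: "'x \<Rightarrow> 'o"

definition pc_category :: "('x, 'o, 'a) pccat \<Rightarrow> bool" where
  "pc_category C \<longleftrightarrow>
     (\<forall>X\<in>PcObj C. \<forall>Y\<in>PcObj C. permutative_category (PcHom C X Y)) \<and>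
     (\<forall>X\<in>PcObj C. \<forall>Y\<in>PcObj C. \<forall>Z\<in>PcObj C.
        multilinear [PcHom C Y Z, PcHom C X Y] (PcHom C X Z) (PcComp C X Y Z)) \<and>
     (\<forall>X\<in>PcObj C. PcIde C X \<in> Obj (PcHom C X X)) \<and>
     (\<forall>W\<in>PcObj C. \<forall>X\<in>PcObj C. \<forall>Y\<in>PcObj C. \<forall>Z\<in>PcObj C.
        mcomp [[PcHom C Y Z, PcHom C X Y], [PcHom C W X]] [PcHom C X Z, PcHom C W X] (PcHom C W Z)
          (PcComp C W X Z) [PcComp C X Y Z, unary (PcHom C W X) (lax_id (PcHom C W X))]
        = mcomp [[PcHom C Y Z], [PcHom C X Y, PcHom C W X]] [PcHom C Y Z, PcHom C W Y] (PcHom C W Z)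
            (PcComp C W Y Z) [unary (PcHom C Y Z) (lax_id (PcHom C Y Z)), PcComp C W X Y]) \<and>
     (\<forall>X\<in>PcObj C. \<forall>Y\<in>PcObj C.
        mcomp [[], [PcHom C X Y]] [PcHom C Y Y, PcHom C X Y] (PcHom C X Y) (PcComp C X Y Y)
            [point (PcHom C Y Y) (PcIde C Y), unary (PcHom C X Y) (lax_id (PcHom C X Y))]
          = unary (PcHom C X Y) (lax_id (PcHom C X Y)) \<and>
        mcomp [[PcHom C X Y], []] [PcHom C X Y, PcHom C X X] (PcHom C X Y) (PcComp C X X Y)
            [unary (PcHom C X Y) (lax_id (PcHom C X Y)), point (PcHom C X X) (PcIde C X)]
          = unary (PcHom C X Y) (lax_id (PcHom C X Y)))"

definition pc_op :: "('x, 'o, 'a) pccat \<Rightarrow> ('x, 'o, 'a) pccat" where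
  "pc_op C =
     \<lparr>PcObj = PcObj C,
      PcHom = (\<lambda>X Y. PcHom C Y X),
      PcComp = (\<lambda>X Y Z. mswap [PcHom C Y X, PcHom C Z Y] 0 (PcComp C Z Y X)),
      PcIde = PcIde C\<rparr>"

record ('x, 'o, 'a, 'y, 'p, 'b) pcfun =
  PO :: "'x \<Rightarrow> 'y"
  PM :: "'x \<Rightarrow> 'x \<Rightarrow> ('o, 'a, 'p, 'b) laxfun"

definition pc_functor ::
  "('x, 'o, 'a) pccat \<Rightarrow> ('y, 'p, 'b) pccat \<Rightarrow> ('x, 'o, 'a, 'y, 'p, 'b) pcfun \<Rightarrow> bool" where
  "pc_functor C D F \<longleftrightarrow>
     PO F \<in> PcObj C \<rightarrow>\<^sub>E PcObj D \<and>
     (\<forall>X Y. X \<notin> PcObj C \<or> Y \<notin> PcObj C \<longrightarrow> PM F X Y = undefined) \<and>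
     (\<forall>X\<in>PcObj C. \<forall>Y\<in>PcObj C. lax_functor (PcHom C X Y) (PcHom D (PO F X) (PO F Y)) (PM F X Y)) \<and>
     (\<forall>X\<in>PcObj C. \<forall>Y\<in>PcObj C. \<forall>Z\<in>PcObj C.
        mcomp [[PcHom C Y Z, PcHom C X Y]] [PcHom C X Z] (PcHom D (PO F X) (PO F Z))
          (unary (PcHom C X Z) (PM F X Z)) [PcComp C X Y Z]
        = mcomp [[PcHom C Y Z], [PcHom C X Y]]
            [PcHom D (PO F Y) (PO F Z), PcHom D (PO F X) (PO F Y)] (PcHom D (PO F X) (PO F Z))
            (PcComp D (PO F X) (PO F Y) (PO F Z))
            [unary (PcHom C Y Z) (PM F Y Z), unary (PcHom C X Y) (PM F X Y)]) \<and>
     (\<forall>X\<in>PcObj C. LO (PM F X X) (PcIde C X) = PcIde D (PO F X))"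

text \<open>
  Naturality is the equation \<open>(\<alpha>\<^sub>X)\<^sup>* \<circ> F' = (\<alpha>\<^sub>Y)\<^sub>* \<circ> F\<close>; pre- and postcomposition with an object are
  composition in \<open>D\<close> with that object inserted as a \<open>0\<close>-morphism.
\<close>

definition pc_nat ::
  "('x, 'o, 'a) pccat \<Rightarrow> ('y, 'p, 'b) pccat \<Rightarrow> ('x, 'o, 'a, 'y, 'p, 'b) pcfun
     \<Rightarrow> ('x, 'o, 'a, 'y, 'p, 'b) pcfun \<Rightarrow> ('x \<Rightarrow> 'p) \<Rightarrow> bool" where
  "pc_nat C D F F' \<alpha> \<longleftrightarrow>
     \<alpha> \<in> extensional (PcObj C) \<and>
     (\<forall>X\<in>PcObj C. \<alpha> X \<in> Obj (PcHom D (PO F X) (PO F' X))) \<and>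
     (\<forall>X\<in>PcObj C. \<forall>Y\<in>PcObj C.
        mcomp [[PcHom C X Y], []]
          [PcHom D (PO F' X) (PO F' Y), PcHom D (PO F X) (PO F' X)] (PcHom D (PO F X) (PO F' Y))
          (PcComp D (PO F X) (PO F' X) (PO F' Y))
          [unary (PcHom C X Y) (PM F' X Y), point (PcHom D (PO F X) (PO F' X)) (\<alpha> X)]
        = mcomp [[], [PcHom C X Y]]
            [PcHom D (PO F Y) (PO F' Y), PcHom D (PO F X) (PO F Y)] (PcHom D (PO F X) (PO F' Y))
            (PcComp D (PO F X) (PO F Y) (PO F' Y))
            [point (PcHom D (PO F Y) (PO F' Y)) (\<alpha> Y), unary (PcHom C X Y) (PM F X Y)])"

type_synonym ('x, 'o, 'a, 'y, 'p, 'b) pcnt =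
  "('x, 'o, 'a, 'y, 'p, 'b) pcfun \<times> ('x \<Rightarrow> 'p) \<times> ('x, 'o, 'a, 'y, 'p, 'b) pcfun"

definition Fun_PC ::
  "('x, 'o, 'a) pccat \<Rightarrow> ('y, 'p, 'b) pccat
     \<Rightarrow> (('x, 'o, 'a, 'y, 'p, 'b) pcfun, ('x, 'o, 'a, 'y, 'p, 'b) pcnt) cat" where
  "Fun_PC C D =
     \<lparr>Obj = {F. pc_functor C D F},
      Arr = {(F, \<alpha>, F'). pc_functor C D F \<and> pc_functor C D F' \<and> pc_nat C D F F' \<alpha>},
      Dom = (\<lambda>(F, \<alpha>, F'). F),
      Cod = (\<lambda>(F, \<alpha>, F'). F'),
      Ide = (\<lambda>F. (F, (\<lambda>X\<in>PcObj C. PcIde D (PO F X)), F)),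
      Cmp = (\<lambda>(F', \<beta>, F'') (F, \<alpha>, _).
               (F, (\<lambda>X\<in>PcObj C. MO (PcComp D (PO F X) (PO F' X) (PO F'' X)) [\<beta> X, \<alpha> X]), F''))\<rparr>"


section \<open>The category \<open>Perm\<close>, enriched in permutative categories\<close>

type_synonym ('o, 'a) lax = "('o, 'a, 'o, 'a) laxfun"
type_synonym ('o, 'a) laxnt = "('o, 'a) lax \<times> ('o \<Rightarrow> 'a) \<times> ('o, 'a) lax"

definition lax_zero :: "('o, 'a) permcat \<Rightarrow> ('o, 'a) permcat \<Rightarrow> ('o, 'a) lax" where
  "lax_zero A B = mk_lax A (\<lambda>x. \<zero>p\<^bsub>B\<^esub>) (\<lambda>u. Ide B \<zero>p\<^bsub>B\<^esub>) (\<lambda>x y. Ide B \<zero>p\<^bsub>B\<^esub>)"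

definition lax_add ::
  "('o, 'a) permcat \<Rightarrow> ('o, 'a) permcat \<Rightarrow> ('o, 'a) lax \<Rightarrow> ('o, 'a) lax \<Rightarrow> ('o, 'a) lax" where
  "lax_add A B f g =
     mk_lax A (\<lambda>x. LO f x \<boxplus>\<^bsub>B\<^esub> LO g x) (\<lambda>u. LA f u \<uplus>\<^bsub>B\<^esub> LA g u)
       (\<lambda>x y. (LS f x y \<uplus>\<^bsub>B\<^esub> LS g x y)
                \<cdot>\<^bsub>B\<^esub> (Ide B (LO f x) \<uplus>\<^bsub>B\<^esub> Swp B (LO g x) (LO f y) \<uplus>\<^bsub>B\<^esub> Ide B (LO g y)))"

text \<open>
  Monoidal transformations \<open>f \<rightarrow> g\<close> are topologized as a subspace of the product over \<open>x\<close> of the spaces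
  \<open>B(f(x), g(x))\<close>.
\<close>

definition perm_hom ::
  "('o, 'a) permcat \<Rightarrow> ('o, 'a) permcat \<Rightarrow> (('o, 'a) lax, ('o, 'a) laxnt) permcat" where
  "perm_hom A B =
     \<lparr>Obj = {f. lax_functor A B f},
      Arr = {(f, \<eta>, g). lax_functor A B f \<and> lax_functor A B g \<and> monoidal_nat A B f g \<eta>},
      Dom = (\<lambda>(f, \<eta>, g). f),
      Cod = (\<lambda>(f, \<eta>, g). g),
      Ide = (\<lambda>f. (f, (\<lambda>x\<in>Obj A. Ide B (LO f x)), f)),
      Cmp = (\<lambda>(_, \<theta>, h) (f, \<eta>, _). (f, (\<lambda>x\<in>Obj A. \<theta> x \<cdot>\<^bsub>B\<^esub> \<eta> x), h)),
      HTop = (\<lambda>f g. pullback_topology {(f, \<eta>, g) | \<eta>. monoidal_nat A B f g \<eta>} (\<lambda>(_, \<eta>, _). \<eta>)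
                (product_topology (\<lambda>x. HTop B (LO f x) (LO g x)) (Obj A))),
      Zro = lax_zero A B,
      Add = lax_add A B,
      AddA = (\<lambda>(f, \<eta>, g) (f', \<eta>', g').
                (lax_add A B f f', (\<lambda>x\<in>Obj A. \<eta> x \<uplus>\<^bsub>B\<^esub> \<eta>' x), lax_add A B g g')),
      Swp = (\<lambda>f g. (lax_add A B f g, (\<lambda>x\<in>Obj A. Swp B (LO f x) (LO g x)), lax_add A B g f))\<rparr>"

text \<open>
  In \<open>perm_comp A B C : (Perm(B,C), Perm(A,B)) \<rightarrow> Perm(A,C)\<close> the two variables are \<open>g = xs ! 0\<close> and
  \<open>f = xs ! 1\<close>.
\<close>

definition perm_comp ::
  "('o, 'a) permcat \<Rightarrow> ('o, 'a) permcat \<Rightarrow> ('o, 'a) permcat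
     \<Rightarrow> (('o, 'a) lax, ('o, 'a) laxnt, ('o, 'a) lax, ('o, 'a) laxnt) mfun" where
  "perm_comp A B C =
     mk_mfun [perm_hom B C, perm_hom A B]
       (\<lambda>xs. lax_comp A C (xs ! 0) (xs ! 1))
       (\<lambda>us. case (us ! 0, us ! 1) of ((g, \<theta>, g'), (f, \<eta>, f')) \<Rightarrow>
          (lax_comp A C g f, (\<lambda>x\<in>Obj A. \<theta> (LO f' x) \<cdot>\<^bsub>C\<^esub> LA g (\<eta> x)), lax_comp A C g' f'))
       (\<lambda>i xs y. let g = xs ! 0; f = xs ! 1 in
          if i = 0 then Ide (perm_hom A C) (lax_comp A C (lax_add B C g y) f)
          else (lax_add A C (lax_comp A C g f) (lax_comp A C g y),
                (\<lambda>x\<in>Obj A. LS g (LO f x) (LO y x)),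
                lax_comp A C g (lax_add A B f y)))"

definition Perm :: "(('o, 'a) permcat, ('o, 'a) lax, ('o, 'a) laxnt) pccat" where
  "Perm =
     \<lparr>PcObj = {A. permutative_category A}, PcHom = perm_hom, PcComp = perm_comp, PcIde = lax_id\<rparr>"


section \<open>Closed symmetric monoidal categories and enrichment in them\<close>

record ('s, 't) smc = "('s, 't) cat" +
  Unt   :: "'s"
  Ten   :: "'s \<Rightarrow> 's \<Rightarrow> 's"  (infixr \<open>\<and>o\<index>\<close> 70)
  TenA  :: "'t \<Rightarrow> 't \<Rightarrow> 't"  (infixr \<open>\<and>a\<index>\<close> 70)
  Asc   :: "'s \<Rightarrow> 's \<Rightarrow> 's \<Rightarrow> 't"  \<comment> \<open>\<open>(x \<and> y) \<and> z \<rightarrow> x \<and> (y \<and> z)\<close>\<close>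
  LUn   :: "'s \<Rightarrow> 't"
  RUn   :: "'s \<Rightarrow> 't"
  Brd   :: "'s \<Rightarrow> 's \<Rightarrow> 't"
  IHom  :: "'s \<Rightarrow> 's \<Rightarrow> 's"
  Evl   :: "'s \<Rightarrow> 's \<Rightarrow> 't"  \<comment> \<open>\<open>F(x, y) \<and> x \<rightarrow> y\<close>\<close>

definition inverse_arrows :: "('o, 'a, 'z) cat_scheme \<Rightarrow> 'a \<Rightarrow> 'a \<Rightarrow> bool" where
  "inverse_arrows C u v \<longleftrightarrow>
     u \<in> Arr C \<and> v \<in> homset C (Cod C u) (Dom C u) \<and>
     v \<cdot>\<^bsub>C\<^esub> u = Ide C (Dom C u) \<and> u \<cdot>\<^bsub>C\<^esub> v = Ide C (Cod C u)"

definition iso_arrow :: "('o, 'a, 'z) cat_scheme \<Rightarrow> 'a \<Rightarrow> bool" where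
  "iso_arrow C u \<longleftrightarrow> (\<exists>v. inverse_arrows C u v)"

definition inv_arrow :: "('o, 'a, 'z) cat_scheme \<Rightarrow> 'a \<Rightarrow> 'a" where
  "inv_arrow C u = (THE v. inverse_arrows C u v)"

definition closed_symmetric_monoidal :: "('s, 't) smc \<Rightarrow> bool" where
  "closed_symmetric_monoidal V \<longleftrightarrow>
     category V \<and>
     Unt V \<in> Obj V \<and>
     (\<forall>x\<in>Obj V. \<forall>y\<in>Obj V. x \<and>o\<^bsub>V\<^esub> y \<in> Obj V) \<and>
     (\<forall>u\<in>Arr V. \<forall>v\<in>Arr V.
        u \<and>a\<^bsub>V\<^esub> v \<in> homset V (Dom V u \<and>o\<^bsub>V\<^esub> Dom V v) (Cod V u \<and>o\<^bsub>V\<^esub> Cod V v)) \<and>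
     (\<forall>x\<in>Obj V. \<forall>y\<in>Obj V. Ide V x \<and>a\<^bsub>V\<^esub> Ide V y = Ide V (x \<and>o\<^bsub>V\<^esub> y)) \<and>
     (\<forall>u\<in>Arr V. \<forall>u'\<in>Arr V. \<forall>v\<in>Arr V. \<forall>v'\<in>Arr V. Cod V u = Dom V u' \<and> Cod V v = Dom V v' \<longrightarrow>
        (u' \<cdot>\<^bsub>V\<^esub> u) \<and>a\<^bsub>V\<^esub> (v' \<cdot>\<^bsub>V\<^esub> v) = (u' \<and>a\<^bsub>V\<^esub> v') \<cdot>\<^bsub>V\<^esub> (u \<and>a\<^bsub>V\<^esub> v)) \<and>
     (\<forall>x\<in>Obj V. \<forall>y\<in>Obj V. \<forall>z\<in>Obj V.
        Asc V x y z \<in> homset V ((x \<and>o\<^bsub>V\<^esub> y) \<and>o\<^bsub>V\<^esub> z) (x \<and>o\<^bsub>V\<^esub> (y \<and>o\<^bsub>V\<^esub> z)) \<and> iso_arrow V (Asc V x y z)) \<and>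
     (\<forall>u\<in>Arr V. \<forall>v\<in>Arr V. \<forall>w\<in>Arr V.
        Asc V (Cod V u) (Cod V v) (Cod V w) \<cdot>\<^bsub>V\<^esub> ((u \<and>a\<^bsub>V\<^esub> v) \<and>a\<^bsub>V\<^esub> w)
          = (u \<and>a\<^bsub>V\<^esub> (v \<and>a\<^bsub>V\<^esub> w)) \<cdot>\<^bsub>V\<^esub> Asc V (Dom V u) (Dom V v) (Dom V w)) \<and>
     (\<forall>w\<in>Obj V. \<forall>x\<in>Obj V. \<forall>y\<in>Obj V. \<forall>z\<in>Obj V.
        Asc V w x (y \<and>o\<^bsub>V\<^esub> z) \<cdot>\<^bsub>V\<^esub> Asc V (w \<and>o\<^bsub>V\<^esub> x) y z
          = (Ide V w \<and>a\<^bsub>V\<^esub> Asc V x y z) \<cdot>\<^bsub>V\<^esub> Asc V w (x \<and>o\<^bsub>V\<^esub> y) z \<cdot>\<^bsub>V\<^esub> (Asc V w x y \<and>a\<^bsub>V\<^esub> Ide V z)) \<and>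
     (\<forall>x\<in>Obj V. LUn V x \<in> homset V (Unt V \<and>o\<^bsub>V\<^esub> x) x \<and> iso_arrow V (LUn V x)) \<and>
     (\<forall>x\<in>Obj V. RUn V x \<in> homset V (x \<and>o\<^bsub>V\<^esub> Unt V) x \<and> iso_arrow V (RUn V x)) \<and>
     (\<forall>u\<in>Arr V. LUn V (Cod V u) \<cdot>\<^bsub>V\<^esub> (Ide V (Unt V) \<and>a\<^bsub>V\<^esub> u) = u \<cdot>\<^bsub>V\<^esub> LUn V (Dom V u)) \<and>
     (\<forall>u\<in>Arr V. RUn V (Cod V u) \<cdot>\<^bsub>V\<^esub> (u \<and>a\<^bsub>V\<^esub> Ide V (Unt V)) = u \<cdot>\<^bsub>V\<^esub> RUn V (Dom V u)) \<and>
     (\<forall>x\<in>Obj V. \<forall>y\<in>Obj V.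
        (Ide V x \<and>a\<^bsub>V\<^esub> LUn V y) \<cdot>\<^bsub>V\<^esub> Asc V x (Unt V) y = RUn V x \<and>a\<^bsub>V\<^esub> Ide V y) \<and>
     (\<forall>x\<in>Obj V. \<forall>y\<in>Obj V. Brd V x y \<in> homset V (x \<and>o\<^bsub>V\<^esub> y) (y \<and>o\<^bsub>V\<^esub> x)) \<and>
     (\<forall>u\<in>Arr V. \<forall>v\<in>Arr V.
        Brd V (Cod V u) (Cod V v) \<cdot>\<^bsub>V\<^esub> (u \<and>a\<^bsub>V\<^esub> v) = (v \<and>a\<^bsub>V\<^esub> u) \<cdot>\<^bsub>V\<^esub> Brd V (Dom V u) (Dom V v)) \<and>
     (\<forall>x\<in>Obj V. \<forall>y\<in>Obj V. Brd V y x \<cdot>\<^bsub>V\<^esub> Brd V x y = Ide V (x \<and>o\<^bsub>V\<^esub> y)) \<and>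
     (\<forall>x\<in>Obj V. \<forall>y\<in>Obj V. \<forall>z\<in>Obj V.
        Asc V y z x \<cdot>\<^bsub>V\<^esub> Brd V x (y \<and>o\<^bsub>V\<^esub> z) \<cdot>\<^bsub>V\<^esub> Asc V x y z
          = (Ide V y \<and>a\<^bsub>V\<^esub> Brd V x z) \<cdot>\<^bsub>V\<^esub> Asc V y x z \<cdot>\<^bsub>V\<^esub> (Brd V x y \<and>a\<^bsub>V\<^esub> Ide V z)) \<and>
     (\<forall>x\<in>Obj V. \<forall>y\<in>Obj V.
        IHom V x y \<in> Obj V \<and> Evl V x y \<in> homset V (IHom V x y \<and>o\<^bsub>V\<^esub> x) y) \<and>
     (\<forall>x\<in>Obj V. \<forall>y\<in>Obj V. \<forall>z\<in>Obj V. \<forall>u\<in>homset V (z \<and>o\<^bsub>V\<^esub> x) y.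
        \<exists>!v. v \<in> homset V z (IHom V x y) \<and> Evl V x y \<cdot>\<^bsub>V\<^esub> (v \<and>a\<^bsub>V\<^esub> Ide V x) = u)"

definition curry_arrow :: "('s, 't) smc \<Rightarrow> 's \<Rightarrow> 's \<Rightarrow> 's \<Rightarrow> 't \<Rightarrow> 't" where
  "curry_arrow V z x y u =
     (THE v. v \<in> homset V z (IHom V x y) \<and> Evl V x y \<cdot>\<^bsub>V\<^esub> (v \<and>a\<^bsub>V\<^esub> Ide V x) = u)"

subsection \<open>The multicategory of a symmetric monoidal category\<close>

text \<open>
  \<open>E\<^sub>1 \<and> \<dots> \<and> E\<^sub>k\<close> is bracketed to the right; it is the unit for \<open>k = 0\<close>.
\<close>

fun tens :: "('s, 't) smc \<Rightarrow> 's list \<Rightarrow> 's" where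
  "tens V [] = Unt V"
| "tens V [x] = x"
| "tens V (x # y # ys) = x \<and>o\<^bsub>V\<^esub> tens V (y # ys)"

fun tensA :: "('s, 't) smc \<Rightarrow> 't list \<Rightarrow> 't" where
  "tensA V [] = Ide V (Unt V)"
| "tensA V [u] = u"
| "tensA V (u # v # vs) = u \<and>a\<^bsub>V\<^esub> tensA V (v # vs)"

text \<open>The coherence isomorphism \<open>tens (xs @ ys) \<rightarrow> tens xs \<and> tens ys\<close>.\<close>

fun tens_append :: "('s, 't) smc \<Rightarrow> 's list \<Rightarrow> 's list \<Rightarrow> 't" where
  "tens_append V [] ys = inv_arrow V (LUn V (tens V ys))"
| "tens_append V [x] [] = inv_arrow V (RUn V x)"
| "tens_append V [x] (y # ys) = Ide V (x \<and>o\<^bsub>V\<^esub> tens V (y # ys))"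
| "tens_append V (x # x' # xs) ys =
     inv_arrow V (Asc V x (tens V (x' # xs)) (tens V ys)) \<cdot>\<^bsub>V\<^esub> (Ide V x \<and>a\<^bsub>V\<^esub> tens_append V (x' # xs) ys)"

text \<open>The coherence isomorphism \<open>tens (concat xss) \<rightarrow> tens (map tens xss)\<close>.\<close>

fun tens_concat :: "('s, 't) smc \<Rightarrow> 's list list \<Rightarrow> 't" where
  "tens_concat V [] = Ide V (Unt V)"
| "tens_concat V [xs] = Ide V (tens V xs)"
| "tens_concat V (xs # ys # yss) =
     (Ide V (tens V xs) \<and>a\<^bsub>V\<^esub> tens_concat V (ys # yss)) \<cdot>\<^bsub>V\<^esub> tens_append V xs (concat (ys # yss))"

text \<open>The isomorphism \<open>tens xs \<rightarrow> tens (swap_list i xs)\<close> exchanging the factors \<open>i\<close> and \<open>Suc i\<close>.\<close>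

fun tens_swap :: "('s, 't) smc \<Rightarrow> nat \<Rightarrow> 's list \<Rightarrow> 't" where
  "tens_swap V 0 [x, y] = Brd V x y"
| "tens_swap V 0 (x # y # z # zs) =
     (let r = tens V (z # zs) in
      Asc V y x r \<cdot>\<^bsub>V\<^esub> (Brd V x y \<and>a\<^bsub>V\<^esub> Ide V r) \<cdot>\<^bsub>V\<^esub> inv_arrow V (Asc V x y r))"
| "tens_swap V (Suc i) (x # xs) = Ide V x \<and>a\<^bsub>V\<^esub> tens_swap V i xs"
| "tens_swap V _ xs = Ide V (tens V xs)"

definition smc_multicat :: "('s, 't) smc \<Rightarrow> ('s, 't) multicat" where
  "smc_multicat V =
     \<lparr>MObj = Obj V,
      MMor = (\<lambda>Es E. homset V (tens V Es) E),
      MIde = Ide V,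
      MComp = (\<lambda>Ess Fs E v us. v \<cdot>\<^bsub>V\<^esub> tensA V us \<cdot>\<^bsub>V\<^esub> tens_concat V Ess),
      MSwap = (\<lambda>Es E i u. u \<cdot>\<^bsub>V\<^esub> tens_swap V i (swap_list i Es))\<rparr>"

subsection \<open>Enriched categories\<close>

record ('x, 's, 't) vcat =
  VObj  :: "'x set"
  VHom  :: "'x \<Rightarrow> 'x \<Rightarrow> 's"
  VComp :: "'x \<Rightarrow> 'x \<Rightarrow> 'x \<Rightarrow> 't"  \<comment> \<open>\<open>VComp C X Y Z : C(Y,Z) \<and> C(X,Y) \<rightarrow> C(X,Z)\<close>\<close>
  VIde  :: "'x \<Rightarrow> 't"  \<comment> \<open>from the unit object to \<open>C(X,X)\<close>\<close>

definition v_op :: "('s, 't) smc \<Rightarrow> ('x, 's, 't) vcat \<Rightarrow> ('x, 's, 't) vcat" where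
  "v_op V C =
     \<lparr>VObj = VObj C,
      VHom = (\<lambda>X Y. VHom C Y X),
      VComp = (\<lambda>X Y Z. VComp C Z Y X \<cdot>\<^bsub>V\<^esub> Brd V (VHom C Z Y) (VHom C Y X)),
      VIde = VIde C\<rparr>"

definition v_self :: "('s, 't) smc \<Rightarrow> ('s, 's, 't) vcat" where
  "v_self V =
     \<lparr>VObj = Obj V,
      VHom = IHom V,
      VComp = (\<lambda>x y z. curry_arrow V (IHom V y z \<and>o\<^bsub>V\<^esub> IHom V x y) x z
                 (Evl V y z \<cdot>\<^bsub>V\<^esub> (Ide V (IHom V y z) \<and>a\<^bsub>V\<^esub> Evl V x y) \<cdot>\<^bsub>V\<^esub> Asc V (IHom V y z) (IHom V x y) x)),
      VIde = (\<lambda>x. curry_arrow V (Unt V) x x (LUn V x))\<rparr>"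

record ('x, 'y, 't) vfun =
  VO :: "'x \<Rightarrow> 'y"
  VM :: "'x \<Rightarrow> 'x \<Rightarrow> 't"

definition v_functor ::
  "('s, 't) smc \<Rightarrow> ('x, 's, 't) vcat \<Rightarrow> ('y, 's, 't) vcat \<Rightarrow> ('x, 'y, 't) vfun \<Rightarrow> bool" where
  "v_functor V C D F \<longleftrightarrow>
     VO F \<in> VObj C \<rightarrow>\<^sub>E VObj D \<and>
     (\<forall>X Y. X \<notin> VObj C \<or> Y \<notin> VObj C \<longrightarrow> VM F X Y = undefined) \<and>
     (\<forall>X\<in>VObj C. \<forall>Y\<in>VObj C. VM F X Y \<in> homset V (VHom C X Y) (VHom D (VO F X) (VO F Y))) \<and>
     (\<forall>X\<in>VObj C. \<forall>Y\<in>VObj C. \<forall>Z\<in>VObj C.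
        VM F X Z \<cdot>\<^bsub>V\<^esub> VComp C X Y Z
          = VComp D (VO F X) (VO F Y) (VO F Z) \<cdot>\<^bsub>V\<^esub> (VM F Y Z \<and>a\<^bsub>V\<^esub> VM F X Y)) \<and>
     (\<forall>X\<in>VObj C. VM F X X \<cdot>\<^bsub>V\<^esub> VIde C X = VIde D (VO F X))"

definition v_nat ::
  "('s, 't) smc \<Rightarrow> ('x, 's, 't) vcat \<Rightarrow> ('y, 's, 't) vcat \<Rightarrow> ('x, 'y, 't) vfun
     \<Rightarrow> ('x, 'y, 't) vfun \<Rightarrow> ('x \<Rightarrow> 't) \<Rightarrow> bool" where
  "v_nat V C D F F' \<alpha> \<longleftrightarrow>
     \<alpha> \<in> extensional (VObj C) \<and>
     (\<forall>X\<in>VObj C. \<alpha> X \<in> homset V (Unt V) (VHom D (VO F X) (VO F' X))) \<and>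
     (\<forall>X\<in>VObj C. \<forall>Y\<in>VObj C.
        VComp D (VO F X) (VO F' X) (VO F' Y) \<cdot>\<^bsub>V\<^esub> (VM F' X Y \<and>a\<^bsub>V\<^esub> \<alpha> X) \<cdot>\<^bsub>V\<^esub> inv_arrow V (RUn V (VHom C X Y))
        = VComp D (VO F X) (VO F Y) (VO F' Y) \<cdot>\<^bsub>V\<^esub> (\<alpha> Y \<and>a\<^bsub>V\<^esub> VM F X Y) \<cdot>\<^bsub>V\<^esub> inv_arrow V (LUn V (VHom C X Y)))"

definition Fun_V ::
  "('s, 't) smc \<Rightarrow> ('x, 's, 't) vcat \<Rightarrow> ('y, 's, 't) vcat
     \<Rightarrow> (('x, 'y, 't) vfun, ('x, 'y, 't) vfun \<times> ('x \<Rightarrow> 't) \<times> ('x, 'y, 't) vfun) cat" where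
  "Fun_V V C D =
     \<lparr>Obj = {F. v_functor V C D F},
      Arr = {(F, \<alpha>, F'). v_functor V C D F \<and> v_functor V C D F' \<and> v_nat V C D F F' \<alpha>},
      Dom = (\<lambda>(F, \<alpha>, F'). F),
      Cod = (\<lambda>(F, \<alpha>, F'). F'),
      Ide = (\<lambda>F. (F, (\<lambda>X\<in>VObj C. VIde D (VO F X)), F)),
      Cmp = (\<lambda>(F', \<beta>, F'') (F, \<alpha>, _).
               (F, (\<lambda>X\<in>VObj C. VComp D (VO F X) (VO F' X) (VO F'' X)
                       \<cdot>\<^bsub>V\<^esub> (\<beta> X \<and>a\<^bsub>V\<^esub> \<alpha> X) \<cdot>\<^bsub>V\<^esub> inv_arrow V (LUn V (Unt V))), F''))\<rparr>"

definition K_bullet ::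
  "(('o, 'a) permcat \<Rightarrow> 's) \<Rightarrow> (('o, 'a) permcat list \<Rightarrow> ('o, 'a) permcat \<Rightarrow> ('o, 'a, 'o, 'a) mfun \<Rightarrow> 't)
     \<Rightarrow> ('x, 'o, 'a) pccat \<Rightarrow> ('x, 's, 't) vcat" where
  "K_bullet Ko Km C =
     \<lparr>VObj = PcObj C,
      VHom = (\<lambda>X Y. Ko (PcHom C X Y)),
      VComp = (\<lambda>X Y Z. Km [PcHom C Y Z, PcHom C X Y] (PcHom C X Z) (PcComp C X Y Z)),
      VIde = (\<lambda>X. Km [] (PcHom C X X) (point (PcHom C X X) (PcIde C X)))\<rparr>"


section \<open>Finite G-sets and spans\<close>

type_synonym 'g gset = "nat \<times> ('g \<Rightarrow> nat \<Rightarrow> nat)"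

abbreviation pts :: "'g gset \<Rightarrow> nat set" where
  "pts A \<equiv> {1..fst A}"

definition finite_gsets :: "('g, 'z) monoid_scheme \<Rightarrow> 'g gset set" where
  "finite_gsets G = {(n, \<alpha>). \<alpha> \<in> hom G (sym_group n) \<and> \<alpha> \<in> extensional (carrier G)}"

definition gmaps :: "('g, 'z) monoid_scheme \<Rightarrow> 'g gset \<Rightarrow> 'g gset \<Rightarrow> (nat \<Rightarrow> nat) set" where
  "gmaps G A B =
     {f \<in> pts A \<rightarrow>\<^sub>E pts B. \<forall>g\<in>carrier G. \<forall>x\<in>pts A. f (snd A g x) = snd B g (f x)}"

definition block_sum :: "nat \<Rightarrow> nat \<Rightarrow> (nat \<Rightarrow> nat) \<Rightarrow> (nat \<Rightarrow> nat) \<Rightarrow> nat \<Rightarrow> nat" where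
  "block_sum n n' p q i = (if i \<le> n then p i else n' + q (i - n))"

definition gset_add :: "('g, 'z) monoid_scheme \<Rightarrow> 'g gset \<Rightarrow> 'g gset \<Rightarrow> 'g gset" where
  "gset_add G A B =
     (fst A + fst B, \<lambda>g\<in>carrier G. block_sum (fst A) (fst A) (snd A g) (snd B g))"

text \<open>A span \<open>A \<leftarrow> C \<rightarrow> B\<close> consists of its apex \<open>C\<close>, its left leg and its right leg.\<close>

type_synonym 'g span = "'g gset \<times> (nat \<Rightarrow> nat) \<times> (nat \<Rightarrow> nat)"
type_synonym 'g span_arr = "'g span \<times> (nat \<Rightarrow> nat) \<times> 'g span"

abbreviation apex :: "'g span \<Rightarrow> 'g gset" where "apex S \<equiv> fst S"
abbreviation lleg :: "'g span \<Rightarrow> nat \<Rightarrow> nat" where "lleg S \<equiv> fst (snd S)"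
abbreviation rleg :: "'g span \<Rightarrow> nat \<Rightarrow> nat" where "rleg S \<equiv> snd (snd S)"

definition spans :: "('g, 'z) monoid_scheme \<Rightarrow> 'g gset \<Rightarrow> 'g gset \<Rightarrow> 'g span set" where
  "spans G A B = {(C, l, r). C \<in> finite_gsets G \<and> l \<in> gmaps G C A \<and> r \<in> gmaps G C B}"

definition span_isos :: "('g, 'z) monoid_scheme \<Rightarrow> 'g span \<Rightarrow> 'g span \<Rightarrow> (nat \<Rightarrow> nat) set" where
  "span_isos G S S' =
     {\<phi> \<in> gmaps G (apex S) (apex S').
        bij_betw \<phi> (pts (apex S)) (pts (apex S')) \<and>
        (\<forall>x\<in>pts (apex S). lleg S' (\<phi> x) = lleg S x \<and> rleg S' (\<phi> x) = rleg S x)}"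

definition copair :: "nat \<Rightarrow> nat \<Rightarrow> (nat \<Rightarrow> nat) \<Rightarrow> (nat \<Rightarrow> nat) \<Rightarrow> nat \<Rightarrow> nat" where
  "copair n m f g = (\<lambda>i\<in>{1..n + m}. if i \<le> n then f i else g (i - n))"

definition span_add :: "('g, 'z) monoid_scheme \<Rightarrow> 'g span \<Rightarrow> 'g span \<Rightarrow> 'g span" where
  "span_add G S S' =
     (gset_add G (apex S) (apex S'),
      copair (fst (apex S)) (fst (apex S')) (lleg S) (lleg S'),
      copair (fst (apex S)) (fst (apex S')) (rleg S) (rleg S'))"

definition span_cat ::
  "('g, 'z) monoid_scheme \<Rightarrow> 'g gset \<Rightarrow> 'g gset \<Rightarrow> ('g span, 'g span_arr) permcat" where
  "span_cat G A B =
     \<lparr>Obj = spans G A B,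
      Arr = {(S, \<phi>, S'). S \<in> spans G A B \<and> S' \<in> spans G A B \<and> \<phi> \<in> span_isos G S S'},
      Dom = (\<lambda>(S, \<phi>, S'). S),
      Cod = (\<lambda>(S, \<phi>, S'). S'),
      Ide = (\<lambda>S. (S, (\<lambda>x\<in>pts (apex S). x), S)),
      Cmp = (\<lambda>(_, \<psi>, S'') (S, \<phi>, _). (S, (\<lambda>x\<in>pts (apex S). \<psi> (\<phi> x)), S'')),
      HTop = (\<lambda>S S'. discrete_topology {(S, \<phi>, S') | \<phi>. \<phi> \<in> span_isos G S S'}),
      Zro = ((0, \<lambda>g\<in>carrier G. id), \<lambda>x. undefined, \<lambda>x. undefined),
      Add = span_add G,
      AddA = (\<lambda>(S, \<phi>, S') (T, \<psi>, T').
                (span_add G S T,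
                 (\<lambda>x\<in>pts (apex (span_add G S T)). block_sum (fst (apex S)) (fst (apex S')) \<phi> \<psi> x),
                 span_add G S' T')),
      Swp = (\<lambda>S T. (span_add G S T,
                    (\<lambda>x\<in>pts (apex (span_add G S T)).
                       if x \<le> fst (apex S) then fst (apex T) + x else x - fst (apex S)),
                    span_add G T S))\<rparr>"


section \<open>The Burnside category\<close>

text \<open>
  Composition depends on a choice of pullbacks, which is a parameter here: the lexicographic choice
  \<open>lex_pullbacks\<close> below is an instance (\<open>chosen_pullbacks_lex\<close>), but composition is not strictly
  associative for it.  For example, with the trivial group and \<open>A = {1}\<close>, \<open>B = C = D = {1,2}\<close>, take spans
  with apexes \<open>{1}\<close>, \<open>{1,2,3}\<close>, \<open>{1,2}\<close> and legs (lists of values) \<open>1 | 1\<close>, \<open>112 | 121\<close>, \<open>21 | 12\<close>.  Composing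
  the first two first gives the right leg \<open>12\<close>, because their composite has an identity as right leg,
  whereas composing the last two first gives \<open>21\<close>.

  A choice of pullbacks \<open>pb\<close> assigns to spans \<open>S\<close> from \<open>A\<close> to \<open>B\<close> and \<open>T\<close> from \<open>B\<close> to \<open>C\<close> a pullback
  \<open>pb A B C S T\<close> of the legs \<open>apex S \<rightarrow> B \<leftarrow> apex T\<close>.  It is given together with its two projections, so
  that it is itself a span from \<open>apex S\<close> to \<open>apex T\<close>.
\<close>

type_synonym 'g pullbacks =
  "'g gset \<Rightarrow> 'g gset \<Rightarrow> 'g gset \<Rightarrow> 'g span \<Rightarrow> 'g span \<Rightarrow> 'g span"

definition fibre_product :: "'g span \<Rightarrow> 'g span \<Rightarrow> (nat \<times> nat) set" where
  "fibre_product S T = {(s, t). s \<in> pts (apex S) \<and> t \<in> pts (apex T) \<and> rleg S s = lleg T t}"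

definition chosen_pullbacks :: "('g, 'z) monoid_scheme \<Rightarrow> 'g pullbacks \<Rightarrow> bool" where
  "chosen_pullbacks G pb \<longleftrightarrow>
     (\<forall>A\<in>finite_gsets G. \<forall>B\<in>finite_gsets G. \<forall>C\<in>finite_gsets G.
      \<forall>S\<in>spans G A B. \<forall>T\<in>spans G B C.
        pb A B C S T \<in> spans G (apex S) (apex T) \<and>
        bij_betw (\<lambda>x. (lleg (pb A B C S T) x, rleg (pb A B C S T) x))
          (pts (apex (pb A B C S T))) (fibre_product S T))"

text \<open>The element of the pullback \<open>Q\<close> with projections \<open>s\<close> and \<open>t\<close>.\<close>

definition pb_elt :: "'g span \<Rightarrow> nat \<Rightarrow> nat \<Rightarrow> nat" where
  "pb_elt Q s t = (THE x. x \<in> pts (apex Q) \<and> lleg Q x = s \<and> rleg Q x = t)"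

definition span_comp ::
  "'g pullbacks \<Rightarrow> 'g gset \<Rightarrow> 'g gset \<Rightarrow> 'g gset \<Rightarrow> 'g span \<Rightarrow> 'g span \<Rightarrow> 'g span" where
  "span_comp pb A B C T S =
     (let Q = pb A B C S T in
      (apex Q, (\<lambda>x\<in>pts (apex Q). lleg S (lleg Q x)), (\<lambda>x\<in>pts (apex Q). rleg T (rleg Q x))))"

text \<open>
  The composition functor \<open>(GE(B,C), GE(A,B)) \<rightarrow> GE(A,C)\<close>, with \<open>T = xs ! 0\<close> and \<open>S = xs ! 1\<close>.  On
  isomorphisms and as linearity constraints it has the maps determined by the projections of the
  pullbacks.
\<close>

definition span_comp_functor ::
  "('g, 'z) monoid_scheme \<Rightarrow> 'g pullbacks \<Rightarrow> 'g gset \<Rightarrow> 'g gset \<Rightarrow> 'g gset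
     \<Rightarrow> ('g span, 'g span_arr, 'g span, 'g span_arr) mfun" where
  "span_comp_functor G pb A B C =
     mk_mfun [span_cat G B C, span_cat G A B]
       (\<lambda>xs. span_comp pb A B C (xs ! 0) (xs ! 1))
       (\<lambda>us. case (us ! 0, us ! 1) of ((T, \<psi>, T'), (S, \<phi>, S')) \<Rightarrow>
          let Q = pb A B C S T; Q' = pb A B C S' T' in
          (span_comp pb A B C T S,
           (\<lambda>x\<in>pts (apex Q). pb_elt Q' (\<phi> (lleg Q x)) (\<psi> (rleg Q x))),
           span_comp pb A B C T' S'))
       (\<lambda>i xs Y. let T = xs ! 0; S = xs ! 1; Q = pb A B C S T; n = fst (apex Q) in
          if i = 0 then
            let Q' = pb A B C S Y; R = pb A B C S (span_add G T Y) in
            (span_add G (span_comp pb A B C T S) (span_comp pb A B C Y S),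
             (\<lambda>x\<in>{1..n + fst (apex Q')}.
                if x \<le> n then pb_elt R (lleg Q x) (rleg Q x)
                else pb_elt R (lleg Q' (x - n)) (fst (apex T) + rleg Q' (x - n))),
             span_comp pb A B C (span_add G T Y) S)
          else
            let Q' = pb A B C Y T; R = pb A B C (span_add G S Y) T in
            (span_add G (span_comp pb A B C T S) (span_comp pb A B C T Y),
             (\<lambda>x\<in>{1..n + fst (apex Q')}.
                if x \<le> n then pb_elt R (lleg Q x) (rleg Q x)
                else pb_elt R (fst (apex S) + lleg Q' (x - n)) (rleg Q' (x - n))),
             span_comp pb A B C T (span_add G S Y)))"

definition span_pccat ::
  "('g, 'z) monoid_scheme \<Rightarrow> 'g pullbacks \<Rightarrow> ('g gset, 'g span, 'g span_arr) pccat" where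
  "span_pccat G pb =
     \<lparr>PcObj = finite_gsets G,
      PcHom = span_cat G,
      PcComp = span_comp_functor G pb,
      PcIde = (\<lambda>A. (A, \<lambda>x\<in>pts A. x, \<lambda>x\<in>pts A. x))\<rparr>"

subsection \<open>The lexicographic choice of pullbacks\<close>

definition is_identity :: "'g gset \<Rightarrow> 'g gset \<Rightarrow> (nat \<Rightarrow> nat) \<Rightarrow> bool" where
  "is_identity A B f \<longleftrightarrow> A = B \<and> f = (\<lambda>x\<in>pts A. x)"

definition fibre_list :: "'g span \<Rightarrow> 'g span \<Rightarrow> (nat \<times> nat) list" where
  "fibre_list S T =
     filter (\<lambda>(s, t). rleg S s = lleg T t)
       (List.product [1..<Suc (fst (apex S))] [1..<Suc (fst (apex T))])"

definition position :: "'x list \<Rightarrow> 'x \<Rightarrow> nat" where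
  "position xs x = (THE i. i \<in> {1..length xs} \<and> xs ! (i - 1) = x)"

definition lex_pullbacks :: "('g, 'z) monoid_scheme \<Rightarrow> 'g pullbacks" where
  "lex_pullbacks G A B C S T =
     (if is_identity (apex S) B (rleg S) then (apex T, lleg T, \<lambda>x\<in>pts (apex T). x)
      else if is_identity (apex T) B (lleg T) then (apex S, \<lambda>x\<in>pts (apex S). x, rleg S)
      else
        let ps = fibre_list S T in
        ((length ps,
          \<lambda>g\<in>carrier G. \<lambda>i. if i \<in> {1..length ps}
             then position ps (map_prod (snd (apex S) g) (snd (apex T) g) (ps ! (i - 1))) else i),
         \<lambda>i\<in>{1..length ps}. fst (ps ! (i - 1)),
         \<lambda>i\<in>{1..length ps}. snd (ps ! (i - 1))))"


lemma finite_gset_perm: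
  assumes "A \<in> finite_gsets G" "g \<in> carrier G"
  shows "snd A g permutes pts A"
  using assms by (auto simp: finite_gsets_def hom_def sym_group_def)

lemma finite_gset_mult:
  assumes "A \<in> finite_gsets G" "g \<in> carrier G" "h \<in> carrier G"
  shows "snd A (g \<otimes>\<^bsub>G\<^esub> h) x = snd A g (snd A h x)"
  using assms by (auto simp: finite_gsets_def hom_def sym_group_def)

lemma gmapsD:
  assumes "f \<in> gmaps G A B" "x \<in> pts A"
  shows "f x \<in> pts B" "g \<in> carrier G \<Longrightarrow> f (snd A g x) = snd B g (f x)"
  using assms by (auto simp: gmaps_def PiE_iff)

lemma id_gmaps: "A \<in> finite_gsets G \<Longrightarrow> (\<lambda>x\<in>pts A. x) \<in> gmaps G A A"
  using permutes_in_image[OF finite_gset_perm, of A G]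
  by (auto simp: gmaps_def simp del: One_nat_def atLeastAtMost_iff)

lemma bij_betw_nth_pred:
  assumes "distinct xs" shows "bij_betw (\<lambda>i. xs ! (i - 1)) {1..length xs} (set xs)"
proof -
  have "bij_betw (\<lambda>i. i - 1) {1..length xs} {..<length xs}"
    by (rule bij_betwI[where g = Suc]) auto
  from bij_betw_trans[OF this bij_betw_nth[OF assms refl refl]] show ?thesis
    by (simp add: comp_def)
qed

lemma position_in:
  assumes "distinct xs" "x \<in> set xs"
  shows "position xs x \<in> {1..length xs}" "xs ! (position xs x - 1) = x"
proof -
  have "\<exists>!i. i \<in> {1..length xs} \<and> xs ! (i - 1) = x"
    using bij_betw_nth_pred[OF assms(1)] assms(2) unfolding bij_betw_def inj_on_def
    by (metis (no_types, lifting) imageE)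
  from theI'[OF this] show "position xs x \<in> {1..length xs}" "xs ! (position xs x - 1) = x"
    by (simp_all add: position_def)
qed

lemma position_nth:
  assumes "distinct xs" "i \<in> {1..length xs}" shows "position xs (xs ! (i - 1)) = i"
proof -
  have "xs ! (i - 1) \<in> set xs" using assms(2) by auto
  from position_in[OF assms(1) this] show ?thesis
    using bij_betw_imp_inj_on[OF bij_betw_nth_pred[OF assms(1)]] assms(2) unfolding inj_on_def by blast
qed

lemma chosen_pullbacks_lex:
  assumes "group G"
  shows "chosen_pullbacks G (lex_pullbacks G)"
  unfolding chosen_pullbacks_def
proof (intro ballI)
  fix A B C S T
  assume B: "B \<in> finite_gsets G" and S: "S \<in> spans G A B" and T: "T \<in> spans G B C"
  have gS: "apex S \<in> finite_gsets G" "rleg S \<in> gmaps G (apex S) B"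
    and gT: "apex T \<in> finite_gsets G" "lleg T \<in> gmaps G (apex T) B"
    using S T by (auto simp: spans_def)
  let ?Q = "lex_pullbacks G A B C S T"
  let ?pr = "\<lambda>x. (lleg ?Q x, rleg ?Q x)"
  consider (idS) "is_identity (apex S) B (rleg S)"
    | (idT) "\<not> is_identity (apex S) B (rleg S)" "is_identity (apex T) B (lleg T)"
    | (lex) "\<not> is_identity (apex S) B (rleg S)" "\<not> is_identity (apex T) B (lleg T)"
    by blast
  then show "?Q \<in> spans G (apex S) (apex T) \<and> bij_betw ?pr (pts (apex ?Q)) (fibre_product S T)"
  proof cases
    case idS
    then have Q: "?Q = (apex T, lleg T, \<lambda>x\<in>pts (apex T). x)"
      by (simp add: lex_pullbacks_def)
    have i: "apex S = B" "\<And>x. x \<in> pts B \<Longrightarrow> rleg S x = x"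
      using idS unfolding is_identity_def by simp_all
    have "bij_betw (\<lambda>x. (lleg T x, (\<lambda>x\<in>pts (apex T). x) x)) (pts (apex T)) (fibre_product S T)"
      by (rule bij_betwI[where g = snd]) (use gmapsD(1)[OF gT(2)] i in \<open>auto simp: fibre_product_def\<close>)
    then show ?thesis using gT i id_gmaps[OF gT(1)] unfolding Q by (simp add: spans_def)
  next
    case idT
    then have Q: "?Q = (apex S, \<lambda>x\<in>pts (apex S). x, rleg S)"
      by (simp add: lex_pullbacks_def)
    have i: "apex T = B" "\<And>x. x \<in> pts B \<Longrightarrow> lleg T x = x"
      using idT(2) unfolding is_identity_def by simp_all
    have "bij_betw (\<lambda>x. ((\<lambda>x\<in>pts (apex S). x) x, rleg S x)) (pts (apex S)) (fibre_product S T)"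
      by (rule bij_betwI[where g = fst]) (use gmapsD(1)[OF gS(2)] i in \<open>auto simp: fibre_product_def\<close>)
    then show ?thesis using gS i id_gmaps[OF gS(1)] unfolding Q by (simp add: spans_def)
  next
    case lex
    define ps where "ps = fibre_list S T"
    define a where "a = (\<lambda>g. map_prod (snd (apex S) g) (snd (apex T) g))"
    define \<alpha> where "\<alpha> = (\<lambda>g\<in>carrier G. \<lambda>i. if i \<in> {1..length ps} then position ps (a g (ps ! (i - 1))) else i)"
    have Q: "?Q = ((length ps, \<alpha>), \<lambda>i\<in>{1..length ps}. fst (ps ! (i - 1)), \<lambda>i\<in>{1..length ps}. snd (ps ! (i - 1)))"
      using lex unfolding lex_pullbacks_def Let_def ps_def \<alpha>_def a_def by simp
    have set_ps: "set ps = fibre_product S T"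
      by (auto simp: ps_def fibre_list_def fibre_product_def)
    have dist: "distinct ps"
      by (simp add: ps_def fibre_list_def distinct_product)
    note pos = position_in[OF dist] and pos_nth = position_nth[OF dist]
    have nth: "ps ! (i - 1) \<in> set ps" if "i \<in> {1..length ps}" for i
      using that by auto
    have a_in: "a g p \<in> set ps" if "p \<in> set ps" "g \<in> carrier G" for g p
    proof -
      obtain s t where p: "p = (s, t)" by fastforce
      show ?thesis
        using that permutes_in_image[OF finite_gset_perm[OF gS(1)]] permutes_in_image[OF finite_gset_perm[OF gT(1)]]
          gmapsD(2)[OF gS(2)] gmapsD(2)[OF gT(2)]
        by (simp add: p set_ps fibre_product_def a_def del: One_nat_def atLeastAtMost_iff)
    qed
    have a_mult: "a (g \<otimes>\<^bsub>G\<^esub> h) p = a g (a h p)" if "g \<in> carrier G" "h \<in> carrier G" for g h p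
      using that finite_gset_mult[OF gS(1)] finite_gset_mult[OF gT(1)] by (cases p) (simp add: a_def)
    have \<alpha>_in: "\<alpha> g i \<in> {1..length ps}" and \<alpha>_nth: "ps ! (\<alpha> g i - 1) = a g (ps ! (i - 1))"
      if "g \<in> carrier G" "i \<in> {1..length ps}" for g i
      using pos[OF a_in[OF nth[OF that(2)] that(1)]] that
      by (simp_all add: \<alpha>_def del: One_nat_def atLeastAtMost_iff)
    have \<alpha>_perm: "\<alpha> g permutes {1..length ps}" if g: "g \<in> carrier G" for g
    proof (rule bij_imp_permutes)
      have inj: "inj (a g)"
        using permutes_inj[OF finite_gset_perm[OF gS(1) g]] permutes_inj[OF finite_gset_perm[OF gT(1) g]]
        unfolding a_def by (rule prod.inj_map)
      have "inj_on (\<alpha> g) {1..length ps}"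
      proof (rule inj_onI)
        fix i j assume "i \<in> {1..length ps}" "j \<in> {1..length ps}" "\<alpha> g i = \<alpha> g j"
        then have "ps ! (i - 1) = ps ! (j - 1)" using \<alpha>_nth[OF g, of i] \<alpha>_nth[OF g, of j] injD[OF inj] by metis
        then show "i = j" using pos_nth \<open>i \<in> _\<close> \<open>j \<in> _\<close> by metis
      qed
      then show "bij_betw (\<alpha> g) {1..length ps} {1..length ps}"
        using endo_inj_surj[OF finite_atLeastAtMost image_subsetI[OF \<alpha>_in[OF g]]] by (simp add: bij_betw_def)
      show "\<alpha> g i = i" if "i \<notin> {1..length ps}" for i
        using that g by (auto simp: \<alpha>_def)
    qed
    have \<alpha>_mult: "\<alpha> (g \<otimes>\<^bsub>G\<^esub> h) = \<alpha> g \<circ> \<alpha> h" if g: "g \<in> carrier G" "h \<in> carrier G" for g h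
    proof
      fix i
      have gh: "g \<otimes>\<^bsub>G\<^esub> h \<in> carrier G" using assms g by (simp add: group.is_monoid monoid.m_closed)
      show "\<alpha> (g \<otimes>\<^bsub>G\<^esub> h) i = (\<alpha> g \<circ> \<alpha> h) i"
      proof (cases "i \<in> {1..length ps}")
        case True
        then have "ps ! (\<alpha> (g \<otimes>\<^bsub>G\<^esub> h) i - 1) = ps ! (\<alpha> g (\<alpha> h i) - 1)"
          using \<alpha>_nth[OF gh True] \<alpha>_nth[OF g(2) True] \<alpha>_nth[OF g(1) \<alpha>_in[OF g(2) True]] a_mult[OF g] by simp
        then show ?thesis
          using pos_nth[OF \<alpha>_in[OF gh True]] pos_nth[OF \<alpha>_in[OF g(1) \<alpha>_in[OF g(2) True]]] by simp
      next
        case False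
        then show ?thesis using g gh by (auto simp: \<alpha>_def)
      qed
    qed
    have gP: "(length ps, \<alpha>) \<in> finite_gsets G"
      using \<alpha>_perm \<alpha>_mult by (auto simp: finite_gsets_def hom_def sym_group_def) (simp add: \<alpha>_def)
    have "fst (ps ! (i - 1)) \<in> pts (apex S) \<and> snd (ps ! (i - 1)) \<in> pts (apex T)" if "i \<in> {1..length ps}" for i
      using nth[OF that] unfolding set_ps fibre_product_def by auto
    moreover have "fst (ps ! (\<alpha> g i - 1)) = snd (apex S) g (fst (ps ! (i - 1))) \<and> snd (ps ! (\<alpha> g i - 1)) = snd (apex T) g (snd (ps ! (i - 1)))"
      if "g \<in> carrier G" "i \<in> {1..length ps}" for g i
      using \<alpha>_nth[OF that] by (simp add: a_def)
    ultimately have "?Q \<in> spans G (apex S) (apex T)"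
      unfolding Q using gP \<alpha>_in by (simp add: spans_def gmaps_def del: One_nat_def atLeastAtMost_iff)
    moreover have "bij_betw ?pr (pts (apex ?Q)) (fibre_product S T)"
    proof -
      have "?pr i = ps ! (i - 1)" if "i \<in> pts (apex ?Q)" for i
        using that unfolding Q by simp
      then have "bij_betw ?pr (pts (apex ?Q)) (fibre_product S T)
          = bij_betw (\<lambda>i. ps ! (i - 1)) (pts (apex ?Q)) (fibre_product S T)"
        by (rule bij_betw_cong)
      then show ?thesis
        using bij_betw_nth_pred[OF dist, unfolded set_ps] unfolding Q by simp
    qed
    ultimately show ?thesis ..
  qed
qed


section \<open>Realizing enriched categories in the universe\<close>

text \<open>
  The structure transported along maps \<open>eo\<close>, \<open>ea\<close> that are injective on objects and on morphisms.
\<close>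

definition perm_image ::
  "('o \<Rightarrow> 'p) \<Rightarrow> ('a \<Rightarrow> 'b) \<Rightarrow> ('o, 'a) permcat \<Rightarrow> ('p, 'b) permcat" where
  "perm_image eo ea P =
     (let do = inv_into (Obj P) eo; da = inv_into (Arr P) ea in
      \<lparr>Obj = eo ` Obj P,
       Arr = ea ` Arr P,
       Dom = (\<lambda>u. eo (Dom P (da u))),
       Cod = (\<lambda>u. eo (Cod P (da u))),
       Ide = (\<lambda>x. ea (Ide P (do x))),
       Cmp = (\<lambda>v u. ea (da v \<cdot>\<^bsub>P\<^esub> da u)),
       HTop = (\<lambda>x y. pullback_topology (ea ` homset P (do x) (do y)) da (HTop P (do x) (do y))),
       Zro = eo \<zero>p\<^bsub>P\<^esub>,
       Add = (\<lambda>x y. eo (do x \<boxplus>\<^bsub>P\<^esub> do y)),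
       AddA = (\<lambda>u v. ea (da u \<uplus>\<^bsub>P\<^esub> da v)),
       Swp = (\<lambda>x y. ea (Swp P (do x) (do y)))\<rparr>)"

definition mfun_image ::
  "('o \<Rightarrow> 'p) \<Rightarrow> ('a \<Rightarrow> 'b) \<Rightarrow> ('o, 'a) permcat list \<Rightarrow> ('o, 'a, 'o, 'a) mfun \<Rightarrow> ('p, 'b, 'p, 'b) mfun" where
  "mfun_image eo ea As f =
     (let dos = map2 (\<lambda>A. inv_into (Obj A) eo) As; das = map2 (\<lambda>A. inv_into (Arr A) ea) As in
      mk_mfun (map (perm_image eo ea) As)
        (\<lambda>xs. eo (MO f (dos xs))) (\<lambda>us. ea (MA f (das us)))
        (\<lambda>i xs y. ea (MD f i (dos xs) (inv_into (Obj (As ! i)) eo y))))"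

definition pc_image ::
  "('o \<Rightarrow> 'p) \<Rightarrow> ('a \<Rightarrow> 'b) \<Rightarrow> ('x, 'o, 'a) pccat \<Rightarrow> ('x, 'p, 'b) pccat" where
  "pc_image eo ea C =
     \<lparr>PcObj = PcObj C,
      PcHom = (\<lambda>X Y. perm_image eo ea (PcHom C X Y)),
      PcComp = (\<lambda>X Y Z. mfun_image eo ea [PcHom C Y Z, PcHom C X Y] (PcComp C X Y Z)),
      PcIde = (\<lambda>X. eo (PcIde C X))\<rparr>"

text \<open>
  \<open>eo\<close> and \<open>ea\<close> encode spans and their isomorphisms in the universe types of the small permutative
  categories.
\<close>

definition GE ::
  "('g, 'z) monoid_scheme \<Rightarrow> 'g pullbacks \<Rightarrow> ('g span \<Rightarrow> 'o) \<Rightarrow> ('g span_arr \<Rightarrow> 'a)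
     \<Rightarrow> ('g gset, 'o, 'a) pccat" where
  "GE G pb eo ea = pc_image eo ea (span_pccat G pb)"

definition GB ::
  "(('o, 'a) permcat \<Rightarrow> 's) \<Rightarrow> (('o, 'a) permcat list \<Rightarrow> ('o, 'a) permcat \<Rightarrow> ('o, 'a, 'o, 'a) mfun \<Rightarrow> 't)
     \<Rightarrow> ('g, 'z) monoid_scheme \<Rightarrow> 'g pullbacks \<Rightarrow> ('g span \<Rightarrow> 'o) \<Rightarrow> ('g span_arr \<Rightarrow> 'a)
     \<Rightarrow> ('g gset, 's, 't) vcat" where
  "GB Ko Km G pb eo ea = K_bullet Ko Km (GE G pb eo ea)"

definition encodes_spans ::
  "('g, 'z) monoid_scheme \<Rightarrow> ('g span \<Rightarrow> 'o) \<Rightarrow> ('g span_arr \<Rightarrow> 'a) \<Rightarrow> bool" where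
  "encodes_spans G eo ea \<longleftrightarrow>
     (\<forall>A\<in>finite_gsets G. \<forall>B\<in>finite_gsets G.
        inj_on eo (Obj (span_cat G A B)) \<and> inj_on ea (Arr (span_cat G A B)))"

end

theory Submission
  imports Defs
begin

text \<open>
  The permutative categories \<open>Perm(A,B)\<close> of functors do not lie in the universe on which \<open>K\<close> is
  defined, so \<open>K\<close> cannot be applied to a \<open>PC\<close>-functor \<open>F : C\<^sup>o\<^sup>p \<rightarrow> Perm\<close> directly.  Instead, each lax functor
  \<open>C(Y,X) \<rightarrow> Perm(F X, F Y)\<close> is replaced by its adjoint, the bilinear evaluation functor
  \<open>(C(Y,X), F X) \<rightarrow> F Y\<close>; its two constraints are the components of the structure morphism of \<open>F\<close> and
  the structure morphisms of its values.  Compatibility of \<open>F\<close> with composition becomes an equation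
  of trilinear functors, and naturality of \<open>\<alpha>\<close> an equation of bilinear functors.  The multifunctor \<open>K\<close>
  turns these into equations between maps of spectra, and currying
  \<open>K(C(Y,X)) \<and> K(F X) \<rightarrow> K(F Y)\<close> gives the action of the spectral functor on morphism spectra.
\<close>

section \<open>Currying in a closed symmetric monoidal category\<close>

text \<open>The interchange law of the evaluation functor is what forces the whole structure of
  \<open>Perm\<close> into play: it says that the structure morphisms of the given lax functor are
  monoidal transformations out of a pointwise sum, whose own structure morphism contains the middle
  symmetry. Equations in \<open>perm_hom A B\<close> are tested on components at an object of A,
  where they become equations in B. On the spectral side an arrow into a function object is
  determined by its composite with \<open>Evl\<close>, so every axiom reduces to its uncurried form.
  The coherence needed for this reduction is the triangle axiom together with its left-hand analogue
  \<open>lun_tensor\<close>. The components of a transformation \<alpha> need no such adjoint: each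
  is an object of Perm(F X, F' X), hence a lax functor between categories of the universe, and K
  applies to it as a unary functor. Its image is an ordinary map of spectra and enters the function
  spectrum as a map out of the unit. The argument is made for a PC-category C with homs in the
  universe; the encodings \<open>eo\<close> and \<open>ea\<close> bring the Burnside PC-category
  into this form.\<close>

locale small_category =
  fixes C :: "('o, 'a, 'z) cat_scheme" (structure)
  assumes category: "category C"
begin

lemma homD [dest]:
  assumes "u \<in> homset C x y"
  shows "u \<in> Arr C" "Dom C u = x" "Cod C u = y"
  using assms by (auto simp: homset_def)

lemma homI: "u \<in> Arr C \<Longrightarrow> Dom C u = x \<Longrightarrow> Cod C u = y \<Longrightarrow> u \<in> homset C x y"
  by (auto simp: homset_def)

lemma dom_obj [simp]: "u \<in> Arr C \<Longrightarrow> Dom C u \<in> Obj C"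
  and cod_obj [simp]: "u \<in> Arr C \<Longrightarrow> Cod C u \<in> Obj C"
  using category by (auto simp: category_def)

lemma ide_simps [simp]:
  assumes "x \<in> Obj C"
  shows "Ide C x \<in> Arr C" "Dom C (Ide C x) = x" "Cod C (Ide C x) = x"
  using category assms by (auto simp: category_def homset_def)

lemma comp_simps [simp]:
  assumes "u \<in> Arr C" "v \<in> Arr C" "Cod C u = Dom C v"
  shows "v \<cdot> u \<in> Arr C" "Dom C (v \<cdot> u) = Dom C u" "Cod C (v \<cdot> u) = Cod C v"
  using category assms by (auto simp: category_def homset_def)

lemma comp_ide [simp]:
  shows "u \<in> Arr C \<Longrightarrow> Dom C u = x \<Longrightarrow> u \<cdot> Ide C x = u"
    and "u \<in> Arr C \<Longrightarrow> Cod C u = x \<Longrightarrow> Ide C x \<cdot> u = u"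
  using category by (auto simp: category_def)

lemma comp_assoc:
  assumes "u \<in> Arr C" "v \<in> Arr C" "w \<in> Arr C" "Cod C u = Dom C v" "Cod C v = Dom C w"
  shows "(w \<cdot> v) \<cdot> u = w \<cdot> (v \<cdot> u)"
  using category assms by (auto simp: category_def)

text \<open>Inserting the identity as \<open>u \<cdot> v\<close> after w shows that two inverses
  agree; this makes the description in \<open>inv_arrow\<close> definite.\<close>

lemma inv_arrow_eq:
  assumes "inverse_arrows C u v"
  shows "inv_arrow C u = v"
  unfolding inv_arrow_def
proof (rule the_equality[where P = "inverse_arrows C u", OF assms])
  fix w assume w: "inverse_arrows C u w"
  have "w = w \<cdot> (u \<cdot> v)"
    using w assms by (auto simp: inverse_arrows_def homset_def)
  also have "\<dots> = (w \<cdot> u) \<cdot> v"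
    using w assms by (subst comp_assoc) (auto simp: inverse_arrows_def homset_def)
  also have "\<dots> = v"
    using w assms by (auto simp: inverse_arrows_def homset_def)
  finally show "w = v" .
qed

lemma inv_arrow_simps:
  assumes "iso_arrow C u"
  shows "inv_arrow C u \<in> Arr C" "Dom C (inv_arrow C u) = Cod C u" "Cod C (inv_arrow C u) = Dom C u"
    "inv_arrow C u \<cdot> u = Ide C (Dom C u)" "u \<cdot> inv_arrow C u = Ide C (Cod C u)"
proof -
  obtain v where v: "inverse_arrows C u v" using assms by (auto simp: iso_arrow_def)
  note [simp] = inv_arrow_eq[OF v]
  show "inv_arrow C u \<in> Arr C" "Dom C (inv_arrow C u) = Cod C u" "Cod C (inv_arrow C u) = Dom C u"
    "inv_arrow C u \<cdot> u = Ide C (Dom C u)" "u \<cdot> inv_arrow C u = Ide C (Cod C u)"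
    using v by (auto simp: inverse_arrows_def homset_def)
qed

text \<open>Right cancellation: in the proof of \<open>lun_tensor\<close> it strips associators and
  unitors from an equation.\<close>

lemma iso_arrow_epi:
  assumes "iso_arrow C u" "v \<in> Arr C" "w \<in> Arr C" "Dom C v = Cod C u" "Dom C w = Cod C u" "v \<cdot> u = w \<cdot> u"
  shows "v = w"
proof -
  note i = inv_arrow_simps[OF assms(1)]
  have u: "u \<in> Arr C" using assms by (auto simp: iso_arrow_def inverse_arrows_def)
  have "v = (v \<cdot> u) \<cdot> inv_arrow C u" using i u assms(1-5) by (simp add: comp_assoc)
  also have "\<dots> = (w \<cdot> u) \<cdot> inv_arrow C u" using assms by simp
  also have "\<dots> = w" using i u assms(2-5) by (simp add: comp_assoc)
  finally show ?thesis .
qed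

end

locale closed_smc =
  fixes V :: "('s, 't) smc" (structure)
  assumes csm: "closed_symmetric_monoidal V"

sublocale closed_smc \<subseteq> small_category V
  using csm unfolding closed_symmetric_monoidal_def by unfold_locales (elim conjE)

section \<open>Structure maps of a closed symmetric monoidal category\<close>

context closed_smc
begin

lemma unt_obj [simp]: "Unt V \<in> Obj V"
  and ten_obj [simp]: "x \<in> Obj V \<Longrightarrow> y \<in> Obj V \<Longrightarrow> x \<and>o y \<in> Obj V"
  and ihom_evl: "x \<in> Obj V \<Longrightarrow> y \<in> Obj V \<Longrightarrow> IHom V x y \<in> Obj V \<and> Evl V x y \<in> homset V (IHom V x y \<and>o x) y"
proof -
  have "Unt V \<in> Obj V" "\<forall>x\<in>Obj V. \<forall>y\<in>Obj V. x \<and>o y \<in> Obj V"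
    "\<forall>x\<in>Obj V. \<forall>y\<in>Obj V. IHom V x y \<in> Obj V \<and> Evl V x y \<in> homset V (IHom V x y \<and>o x) y"
    using csm unfolding closed_symmetric_monoidal_def by - (elim conjE, assumption)+
  then show "Unt V \<in> Obj V" "x \<in> Obj V \<Longrightarrow> y \<in> Obj V \<Longrightarrow> x \<and>o y \<in> Obj V"
    "x \<in> Obj V \<Longrightarrow> y \<in> Obj V \<Longrightarrow> IHom V x y \<in> Obj V \<and> Evl V x y \<in> homset V (IHom V x y \<and>o x) y"
    by blast+
qed

lemma ihom_obj [simp]: "x \<in> Obj V \<Longrightarrow> y \<in> Obj V \<Longrightarrow> IHom V x y \<in> Obj V"
  using ihom_evl by blast

lemma evl_simps [simp]:
  assumes "x \<in> Obj V" "y \<in> Obj V"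
  shows "Evl V x y \<in> Arr V" "Dom V (Evl V x y) = IHom V x y \<and>o x" "Cod V (Evl V x y) = y"
  using ihom_evl[OF assms] by (auto simp: homset_def)

lemma tenA_simps [simp]:
  assumes "u \<in> Arr V" "v \<in> Arr V"
  shows "u \<and>a v \<in> Arr V" "Dom V (u \<and>a v) = Dom V u \<and>o Dom V v" "Cod V (u \<and>a v) = Cod V u \<and>o Cod V v"
proof -
  have "\<forall>u\<in>Arr V. \<forall>v\<in>Arr V. u \<and>a v \<in> homset V (Dom V u \<and>o Dom V v) (Cod V u \<and>o Cod V v)"
    using csm unfolding closed_symmetric_monoidal_def by (elim conjE)
  then show "u \<and>a v \<in> Arr V" "Dom V (u \<and>a v) = Dom V u \<and>o Dom V v" "Cod V (u \<and>a v) = Cod V u \<and>o Cod V v"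
    using assms by (auto simp: homset_def)
qed

lemma tenA_ide [simp]: "x \<in> Obj V \<Longrightarrow> y \<in> Obj V \<Longrightarrow> Ide V x \<and>a Ide V y = Ide V (x \<and>o y)"
proof -
  have "\<forall>x\<in>Obj V. \<forall>y\<in>Obj V. Ide V x \<and>a Ide V y = Ide V (x \<and>o y)"
    using csm unfolding closed_symmetric_monoidal_def by (elim conjE)
  then show "x \<in> Obj V \<Longrightarrow> y \<in> Obj V \<Longrightarrow> Ide V x \<and>a Ide V y = Ide V (x \<and>o y)" by blast
qed

lemma tenA_comp:
  assumes "u \<in> Arr V" "u' \<in> Arr V" "v \<in> Arr V" "v' \<in> Arr V" "Cod V u = Dom V u'" "Cod V v = Dom V v'"
  shows "(u' \<and>a v') \<cdot> (u \<and>a v) = (u' \<cdot> u) \<and>a (v' \<cdot> v)"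
proof -
  have "\<forall>u\<in>Arr V. \<forall>u'\<in>Arr V. \<forall>v\<in>Arr V. \<forall>v'\<in>Arr V. Cod V u = Dom V u' \<and> Cod V v = Dom V v' \<longrightarrow>
      (u' \<cdot> u) \<and>a (v' \<cdot> v) = (u' \<and>a v') \<cdot> (u \<and>a v)"
    using csm unfolding closed_symmetric_monoidal_def by (elim conjE)
  then show ?thesis using assms by metis
qed

text \<open>The form of \<open>tenA_comp\<close> that still matches when composites are bracketed to
  the right, so that a remainder w follows the two tensors.\<close>

lemma tenA_comp':
  assumes "u \<in> Arr V" "u' \<in> Arr V" "v \<in> Arr V" "v' \<in> Arr V" "Cod V u = Dom V u'" "Cod V v = Dom V v'"
    "w \<in> Arr V" "Cod V w = Dom V u \<and>o Dom V v"
  shows "(u' \<and>a v') \<cdot> ((u \<and>a v) \<cdot> w) = ((u' \<cdot> u) \<and>a (v' \<cdot> v)) \<cdot> w"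
  using assms by (simp add: tenA_comp flip: comp_assoc)

lemma unitor_hom:
  assumes "x \<in> Obj V"
  shows "LUn V x \<in> homset V (Unt V \<and>o x) x \<and> iso_arrow V (LUn V x)"
    and "RUn V x \<in> homset V (x \<and>o Unt V) x \<and> iso_arrow V (RUn V x)"
proof -
  have "\<forall>x\<in>Obj V. LUn V x \<in> homset V (Unt V \<and>o x) x \<and> iso_arrow V (LUn V x)"
    "\<forall>x\<in>Obj V. RUn V x \<in> homset V (x \<and>o Unt V) x \<and> iso_arrow V (RUn V x)"
    using csm unfolding closed_symmetric_monoidal_def by - (elim conjE, assumption)+
  then show "LUn V x \<in> homset V (Unt V \<and>o x) x \<and> iso_arrow V (LUn V x)"
    "RUn V x \<in> homset V (x \<and>o Unt V) x \<and> iso_arrow V (RUn V x)"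
    using assms by blast+
qed

lemma unitor_simps [simp]:
  assumes "x \<in> Obj V"
  shows "LUn V x \<in> Arr V" "Dom V (LUn V x) = Unt V \<and>o x" "Cod V (LUn V x) = x" "iso_arrow V (LUn V x)"
    and "RUn V x \<in> Arr V" "Dom V (RUn V x) = x \<and>o Unt V" "Cod V (RUn V x) = x" "iso_arrow V (RUn V x)"
  using unitor_hom[OF assms] by (auto simp: homset_def)

lemma asc_hom:
  assumes "x \<in> Obj V" "y \<in> Obj V" "z \<in> Obj V"
  shows "Asc V x y z \<in> homset V ((x \<and>o y) \<and>o z) (x \<and>o (y \<and>o z)) \<and> iso_arrow V (Asc V x y z)"
proof -
  have "\<forall>x\<in>Obj V. \<forall>y\<in>Obj V. \<forall>z\<in>Obj V.
      Asc V x y z \<in> homset V ((x \<and>o y) \<and>o z) (x \<and>o (y \<and>o z)) \<and> iso_arrow V (Asc V x y z)"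
    using csm unfolding closed_symmetric_monoidal_def by (elim conjE)
  then show ?thesis using assms by blast
qed

lemma asc_simps [simp]:
  assumes "x \<in> Obj V" "y \<in> Obj V" "z \<in> Obj V"
  shows "Asc V x y z \<in> Arr V" "Dom V (Asc V x y z) = (x \<and>o y) \<and>o z" "Cod V (Asc V x y z) = x \<and>o (y \<and>o z)"
    "iso_arrow V (Asc V x y z)"
  using asc_hom[OF assms] by (auto simp: homset_def)

lemma asc_nat:
  assumes "u \<in> Arr V" "v \<in> Arr V" "w \<in> Arr V" "Cod V u = x" "Cod V v = y" "Cod V w = z"
  shows "Asc V x y z \<cdot> ((u \<and>a v) \<and>a w) = (u \<and>a (v \<and>a w)) \<cdot> Asc V (Dom V u) (Dom V v) (Dom V w)"
proof -
  have "\<forall>u\<in>Arr V. \<forall>v\<in>Arr V. \<forall>w\<in>Arr V.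
      Asc V (Cod V u) (Cod V v) (Cod V w) \<cdot> ((u \<and>a v) \<and>a w)
        = (u \<and>a (v \<and>a w)) \<cdot> Asc V (Dom V u) (Dom V v) (Dom V w)"
    using csm unfolding closed_symmetric_monoidal_def by (elim conjE)
  then show ?thesis using assms by blast
qed

lemma pentagon:
  assumes "w \<in> Obj V" "x \<in> Obj V" "y \<in> Obj V" "z \<in> Obj V"
  shows "Asc V w x (y \<and>o z) \<cdot> Asc V (w \<and>o x) y z
          = (Ide V w \<and>a Asc V x y z) \<cdot> Asc V w (x \<and>o y) z \<cdot> (Asc V w x y \<and>a Ide V z)"
proof -
  have "\<forall>w\<in>Obj V. \<forall>x\<in>Obj V. \<forall>y\<in>Obj V. \<forall>z\<in>Obj V. Asc V w x (y \<and>o z) \<cdot> Asc V (w \<and>o x) y z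
          = (Ide V w \<and>a Asc V x y z) \<cdot> Asc V w (x \<and>o y) z \<cdot> (Asc V w x y \<and>a Ide V z)"
    using csm unfolding closed_symmetric_monoidal_def by (elim conjE)
  then show ?thesis using assms by blast
qed

lemma lun_nat:
  assumes "u \<in> Arr V" "Cod V u = x"
  shows "LUn V x \<cdot> (Ide V (Unt V) \<and>a u) = u \<cdot> LUn V (Dom V u)"
proof -
  have "\<forall>u\<in>Arr V. LUn V (Cod V u) \<cdot> (Ide V (Unt V) \<and>a u) = u \<cdot> LUn V (Dom V u)"
    using csm unfolding closed_symmetric_monoidal_def by (elim conjE)
  then show ?thesis using assms by blast
qed

lemma triangle:
  assumes "x \<in> Obj V" "y \<in> Obj V"
  shows "(Ide V x \<and>a LUn V y) \<cdot> Asc V x (Unt V) y = RUn V x \<and>a Ide V y"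
proof -
  have "\<forall>x\<in>Obj V. \<forall>y\<in>Obj V. (Ide V x \<and>a LUn V y) \<cdot> Asc V x (Unt V) y = RUn V x \<and>a Ide V y"
    using csm unfolding closed_symmetric_monoidal_def by (elim conjE)
  then show ?thesis using assms by blast
qed

section \<open>The universal property of function objects and composition in the
  self-enrichment\<close>

lemma curry_ex1:
  assumes "x \<in> Obj V" "y \<in> Obj V" "z \<in> Obj V" "u \<in> homset V (z \<and>o x) y"
  shows "\<exists>!v. v \<in> homset V z (IHom V x y) \<and> Evl V x y \<cdot> (v \<and>a Ide V x) = u"
proof -
  have "\<forall>x\<in>Obj V. \<forall>y\<in>Obj V. \<forall>z\<in>Obj V. \<forall>u\<in>homset V (z \<and>o x) y.
      \<exists>!v. v \<in> homset V z (IHom V x y) \<and> Evl V x y \<cdot> (v \<and>a Ide V x) = u"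
    using csm unfolding closed_symmetric_monoidal_def by (elim conjE)
  then show ?thesis using assms by blast
qed

lemma curry_simps [simp]:
  assumes "x \<in> Obj V" "y \<in> Obj V" "z \<in> Obj V" "u \<in> Arr V" "Dom V u = z \<and>o x" "Cod V u = y"
  shows "curry_arrow V z x y u \<in> Arr V" "Dom V (curry_arrow V z x y u) = z"
    "Cod V (curry_arrow V z x y u) = IHom V x y" "Evl V x y \<cdot> (curry_arrow V z x y u \<and>a Ide V x) = u"
  using theI'[OF curry_ex1[OF assms(1-3) homI[OF assms(4-6)]]] unfolding curry_arrow_def homset_def
  by auto

text \<open>The uniqueness half of the universal property. The equations between arrows into
  \<open>IHom\<close> in this section are proved through it, by comparing evaluations.\<close>

lemma evl_cancel:
  assumes "x \<in> Obj V" "y \<in> Obj V" "v \<in> Arr V" "w \<in> Arr V" "Dom V v = Dom V w"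
    "Cod V v = IHom V x y" "Cod V w = IHom V x y"
    "Evl V x y \<cdot> (v \<and>a Ide V x) = Evl V x y \<cdot> (w \<and>a Ide V x)"
  shows "v = w"
proof -
  have "Evl V x y \<cdot> (w \<and>a Ide V x) \<in> homset V (Dom V w \<and>o x) y"
    using assms by (intro homI) simp_all
  from curry_ex1[OF assms(1,2) _ this] show ?thesis
    using assms(3-8) by (auto simp: homset_def)
qed

text \<open>Kelly's argument: after tensoring with the unit on the left, which is faithful, the equation
  follows from the pentagon and two triangles.\<close>

lemma lun_tensor:
  assumes x: "x \<in> Obj V" and y: "y \<in> Obj V"
  shows "LUn V (x \<and>o y) \<cdot> Asc V (Unt V) x y = LUn V x \<and>a Ide V y"
proof -
  let ?I = "Unt V" and ?J = "Ide V (Unt V)"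
  let ?p = "Asc V ?I (?I \<and>o x) y \<cdot> (Asc V ?I ?I x \<and>a Ide V y)"
  let ?l = "LUn V (x \<and>o y) \<cdot> Asc V ?I x y" and ?r = "LUn V x \<and>a Ide V y"
  note [simp] = x y
  have "(?J \<and>a ?l) \<cdot> ?p = (?J \<and>a LUn V (x \<and>o y)) \<cdot> ((?J \<and>a Asc V ?I x y) \<cdot> ?p)"
    by (simp add: tenA_comp')
  also have "(?J \<and>a Asc V ?I x y) \<cdot> ?p = Asc V ?I ?I (x \<and>o y) \<cdot> Asc V (?I \<and>o ?I) x y"
    by (subst pentagon) (simp_all add: comp_assoc)
  also have "(?J \<and>a LUn V (x \<and>o y)) \<cdot> \<dots> = (RUn V ?I \<and>a Ide V (x \<and>o y)) \<cdot> Asc V (?I \<and>o ?I) x y"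
    by (simp add: triangle flip: comp_assoc)
  also have "\<dots> = Asc V ?I x y \<cdot> ((RUn V ?I \<and>a Ide V x) \<and>a Ide V y)"
    by (simp add: asc_nat)
  also have "\<dots> = Asc V ?I x y \<cdot> (((?J \<and>a LUn V x) \<cdot> Asc V ?I ?I x) \<and>a Ide V y)"
    by (simp add: triangle)
  also have "\<dots> = Asc V ?I x y \<cdot> (((?J \<and>a LUn V x) \<and>a Ide V y) \<cdot> (Asc V ?I ?I x \<and>a Ide V y))"
    by (simp add: tenA_comp)
  also have "\<dots> = (?J \<and>a ?r) \<cdot> ?p"
    by (simp add: asc_nat flip: comp_assoc)
  finally have eq: "((?J \<and>a ?l) \<cdot> Asc V ?I (?I \<and>o x) y) \<cdot> (Asc V ?I ?I x \<and>a Ide V y)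
      = ((?J \<and>a ?r) \<cdot> Asc V ?I (?I \<and>o x) y) \<cdot> (Asc V ?I ?I x \<and>a Ide V y)"
    by (simp add: comp_assoc)
  have "inverse_arrows V (Asc V ?I ?I x \<and>a Ide V y) (inv_arrow V (Asc V ?I ?I x) \<and>a Ide V y)"
    by (simp add: inverse_arrows_def homset_def tenA_comp inv_arrow_simps)
  then have iso: "iso_arrow V (Asc V ?I ?I x \<and>a Ide V y)" by (auto simp: iso_arrow_def)
  have "(?J \<and>a ?l) \<cdot> Asc V ?I (?I \<and>o x) y = (?J \<and>a ?r) \<cdot> Asc V ?I (?I \<and>o x) y"
    by (rule iso_arrow_epi[OF iso _ _ _ _ eq]) simp_all
  note eq = this
  have "?J \<and>a ?l = ?J \<and>a ?r"
    by (rule iso_arrow_epi[OF _ _ _ _ _ eq]) simp_all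
  then have "LUn V (x \<and>o y) \<cdot> (?J \<and>a ?l) = LUn V (x \<and>o y) \<cdot> (?J \<and>a ?r)"
    by simp
  then have eq: "?l \<cdot> LUn V ((?I \<and>o x) \<and>o y) = ?r \<cdot> LUn V ((?I \<and>o x) \<and>o y)"
    by (simp add: lun_nat)
  show ?thesis
    by (rule iso_arrow_epi[OF _ _ _ _ _ eq]) simp_all
qed

text \<open>Composition in \<open>v_self\<close> is a curried arrow, so evaluating it leaves two
  successive evaluations after an associator, and naturality of the associator moves m and n to the
  front. The tail r makes the lemma fit both a bare tensor (r an identity) and a tensor preceded by
  an inverse unitor, as in \<open>v_nat\<close> and \<open>Fun_V\<close>.\<close>

lemma evl_self_comp:
  assumes "x \<in> Obj V" "y \<in> Obj V" "z \<in> Obj V" "m \<in> Arr V" "n \<in> Arr V" "r \<in> Arr V"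
    "Cod V m = IHom V y z" "Cod V n = IHom V x y" "Cod V r = Dom V m \<and>o Dom V n"
  shows "Evl V x z \<cdot> ((VComp (v_self V) x y z \<cdot> ((m \<and>a n) \<cdot> r)) \<and>a Ide V x)
    = Evl V y z \<cdot> ((m \<and>a (Evl V x y \<cdot> (n \<and>a Ide V x))) \<cdot> (Asc V (Dom V m) (Dom V n) x \<cdot> (r \<and>a Ide V x)))"
proof -
  note [simp] = assms
  let ?yz = "IHom V y z" and ?xy = "IHom V x y" and ?i = "Ide V x"
  define c where "c = Evl V y z \<cdot> (Ide V ?yz \<and>a Evl V x y) \<cdot> Asc V ?yz ?xy x"
  have c: "VComp (v_self V) x y z = curry_arrow V (?yz \<and>o ?xy) x z c"
    by (simp add: v_self_def c_def)
  have [simp]: "c \<in> Arr V" "Dom V c = (?yz \<and>o ?xy) \<and>o x" "Cod V c = z"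
    by (simp_all add: c_def)
  \<comment> \<open>Both sides are collected into one tensor under \<open>Evl\<close>. The rule
    \<open>curry_simps(4)\<close> is held back because it would reduce the right-hand side
    only.\<close>
  have "Evl V x z \<cdot> ((VComp (v_self V) x y z \<cdot> ((m \<and>a n) \<cdot> r)) \<and>a ?i)
    = (Evl V x z \<cdot> (curry_arrow V (?yz \<and>o ?xy) x z c \<and>a ?i)) \<cdot> (((m \<and>a n) \<and>a ?i) \<cdot> (r \<and>a ?i))"
    unfolding c by (simp add: comp_assoc tenA_comp tenA_comp' del: curry_simps(4))
  also have "\<dots> = Evl V y z \<cdot> ((Ide V ?yz \<and>a Evl V x y) \<cdot> ((Asc V ?yz ?xy x \<cdot> ((m \<and>a n) \<and>a ?i)) \<cdot> (r \<and>a ?i)))"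
    by (simp add: c_def comp_assoc)
  also have "Asc V ?yz ?xy x \<cdot> ((m \<and>a n) \<and>a ?i) = (m \<and>a (n \<and>a ?i)) \<cdot> Asc V (Dom V m) (Dom V n) x"
    by (simp add: asc_nat)
  finally show ?thesis
    by (simp add: comp_assoc tenA_comp')
qed

lemma self_comp_simps [simp]:
  assumes "x \<in> Obj V" "y \<in> Obj V" "z \<in> Obj V"
  shows "VComp (v_self V) x y z \<in> Arr V" "Dom V (VComp (v_self V) x y z) = IHom V y z \<and>o IHom V x y"
    "Cod V (VComp (v_self V) x y z) = IHom V x z"
  using assms by (simp_all add: v_self_def)

text \<open>The premise \<open>eq\<close> is the associativity of an action in uncurried form:
  acting through the composite c is acting by h and then by k. Its transpose says that the curried
  maps respect composition; this becomes the composition axiom of the spectral functor.\<close>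

lemma curry_comp:
  assumes obj: "x \<in> Obj V" "y \<in> Obj V" "z \<in> Obj V" "h \<in> Obj V" "k \<in> Obj V" "l \<in> Obj V"
    and d: "d \<in> homset V (h \<and>o x) y" and e: "e \<in> homset V (k \<and>o y) z" and f: "f \<in> homset V (l \<and>o x) z"
    and c: "c \<in> homset V (k \<and>o h) l"
    and eq: "f \<cdot> (c \<and>a Ide V x) = e \<cdot> ((Ide V k \<and>a d) \<cdot> Asc V k h x)"
  shows "curry_arrow V l x z f \<cdot> c
    = VComp (v_self V) x y z \<cdot> (curry_arrow V k y z e \<and>a curry_arrow V h x y d)"
    (is "?f \<cdot> c = ?C \<cdot> (?e \<and>a ?d)")
proof (rule evl_cancel[where x = x and y = z])
  note [simp] = obj homD[OF d] homD[OF e] homD[OF f] homD[OF c]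
  \<comment> \<open>The identity is inserted only to serve as the tail r of
    \<open>evl_self_comp\<close>.\<close>
  have "Evl V x z \<cdot> ((?C \<cdot> (?e \<and>a ?d)) \<and>a Ide V x) = Evl V x z \<cdot> ((?C \<cdot> ((?e \<and>a ?d) \<cdot> Ide V (k \<and>o h))) \<and>a Ide V x)"
    by simp
  also have "\<dots> = Evl V y z \<cdot> ((?e \<and>a d) \<cdot> Asc V k h x)"
    by (subst evl_self_comp) simp_all
  also have "\<dots> = (Evl V y z \<cdot> (?e \<and>a Ide V y)) \<cdot> ((Ide V k \<and>a d) \<cdot> Asc V k h x)"
    by (simp add: comp_assoc tenA_comp' del: curry_simps(4))
  also have "\<dots> = (Evl V x z \<cdot> (?f \<and>a Ide V x)) \<cdot> (c \<and>a Ide V x)"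
    by (simp add: eq)
  also have "\<dots> = Evl V x z \<cdot> ((?f \<cdot> c) \<and>a Ide V x)"
    by (simp add: comp_assoc tenA_comp del: curry_simps(4))
  finally show "Evl V x z \<cdot> ((?f \<cdot> c) \<and>a Ide V x) = Evl V x z \<cdot> ((?C \<cdot> (?e \<and>a ?d)) \<and>a Ide V x)" ..
  show "?f \<cdot> c \<in> Arr V" "?C \<cdot> (?e \<and>a ?d) \<in> Arr V" "Dom V (?f \<cdot> c) = Dom V (?C \<cdot> (?e \<and>a ?d))"
    "Cod V (?f \<cdot> c) = IHom V x z" "Cod V (?C \<cdot> (?e \<and>a ?d)) = IHom V x z" "x \<in> Obj V" "z \<in> Obj V"
    by simp_all
qed

text \<open>Naturality of currying in the parameter h. It is applied with i the unit of an enriched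
  category, to check that the spectral functor preserves identities.\<close>

lemma curry_precomp:
  assumes obj: "x \<in> Obj V" "y \<in> Obj V" "h \<in> Obj V" "k \<in> Obj V"
    and e: "e \<in> homset V (h \<and>o x) y" and i: "i \<in> homset V k h"
  shows "curry_arrow V h x y e \<cdot> i = curry_arrow V k x y (e \<cdot> (i \<and>a Ide V x))"
    (is "?e \<cdot> i = ?c")
proof (rule evl_cancel[where x = x and y = y])
  note [simp] = obj homD[OF e] homD[OF i]
  have "Evl V x y \<cdot> ((?e \<cdot> i) \<and>a Ide V x) = (Evl V x y \<cdot> (?e \<and>a Ide V x)) \<cdot> (i \<and>a Ide V x)"
    by (simp add: comp_assoc tenA_comp del: curry_simps(4))
  then show "Evl V x y \<cdot> ((?e \<cdot> i) \<and>a Ide V x) = Evl V x y \<cdot> (?c \<and>a Ide V x)"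
    by simp
  show "?e \<cdot> i \<in> Arr V" "?c \<in> Arr V" "Dom V (?e \<cdot> i) = Dom V ?c"
    "Cod V (?e \<cdot> i) = IHom V x y" "Cod V ?c = IHom V x y" "x \<in> Obj V" "y \<in> Obj V"
    by simp_all
qed

text \<open>The name of the arrow a: its transpose after identifying \<open>Unt V \<and>o x\<close>
  with x. The components of a \<open>v_nat\<close> are arrows out of the unit, so maps of spectra
  have to be turned into this form.\<close>

definition global_elt :: "'s \<Rightarrow> 's \<Rightarrow> 't \<Rightarrow> 't" where
  "global_elt x y a = curry_arrow V (Unt V) x y (a \<cdot> LUn V x)"

lemma global_elt_hom:
  assumes "x \<in> Obj V" "y \<in> Obj V" "a \<in> homset V x y"
  shows "global_elt x y a \<in> homset V (Unt V) (IHom V x y)"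
  using assms homD[OF assms(3)] by (intro homI) (simp_all add: global_elt_def)

lemma global_elt_ide: "x \<in> Obj V \<Longrightarrow> global_elt x x (Ide V x) = VIde (v_self V) x"
  by (simp add: global_elt_def v_self_def)

text \<open>The left-hand side is the composition of components in \<open>Fun_V\<close>. Evaluating
  it yields b and a with left unitors in between; naturality of the unitor brings b and a to the
  front, and the unitors that remain cancel.\<close>

lemma global_elt_comp:
  assumes obj: "x \<in> Obj V" "y \<in> Obj V" "z \<in> Obj V" and a: "a \<in> homset V x y" and b: "b \<in> homset V y z"
  shows "VComp (v_self V) x y z \<cdot> (global_elt y z b \<and>a global_elt x y a) \<cdot> inv_arrow V (LUn V (Unt V))
    = global_elt x z (b \<cdot> a)"
    (is "?C \<cdot> (?b \<and>a ?a) \<cdot> ?i = ?c")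
proof -
  note [simp] = obj homD[OF a] homD[OF b]
  note inv = inv_arrow_simps[of "LUn V (Unt V)", simplified]
  note ga = global_elt_hom[OF obj(1,2) a] and gb = global_elt_hom[OF obj(2,3) b]
    and gc = global_elt_hom[of x z "b \<cdot> a", OF _ _ homI, simplified]
  note [simp] = homD[OF ga] homD[OF gb] homD[OF gc] inv(1-3)
  have ev: "Evl V x z \<cdot> (?c \<and>a Ide V x) = b \<cdot> (a \<cdot> LUn V x)"
    by (simp add: global_elt_def comp_assoc)
  have eva: "Evl V x y \<cdot> (?a \<and>a Ide V x) = a \<cdot> LUn V x"
    by (simp add: global_elt_def)
  have evb: "Evl V y z \<cdot> (?b \<and>a Ide V y) = b \<cdot> LUn V y"
    by (simp add: global_elt_def)
  have "?C \<cdot> ((?b \<and>a ?a) \<cdot> ?i) = ?c"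
  proof (rule evl_cancel[where x = x and y = z])
    have "Evl V x z \<cdot> ((?C \<cdot> ((?b \<and>a ?a) \<cdot> ?i)) \<and>a Ide V x)
      = Evl V y z \<cdot> ((?b \<and>a (a \<cdot> LUn V x)) \<cdot> (Asc V (Unt V) (Unt V) x \<cdot> (?i \<and>a Ide V x)))"
      by (subst evl_self_comp) (simp_all add: eva)
    also have "\<dots> = (Evl V y z \<cdot> (?b \<and>a Ide V y)) \<cdot>
        ((Ide V (Unt V) \<and>a (a \<cdot> LUn V x)) \<cdot> (Asc V (Unt V) (Unt V) x \<cdot> (?i \<and>a Ide V x)))"
      by (simp add: comp_assoc tenA_comp')
    also have "\<dots> = b \<cdot> ((LUn V y \<cdot> (Ide V (Unt V) \<and>a (a \<cdot> LUn V x))) \<cdot> (Asc V (Unt V) (Unt V) x \<cdot> (?i \<and>a Ide V x)))"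
      by (simp add: evb comp_assoc)
    also have "\<dots> = b \<cdot> (a \<cdot> (LUn V x \<cdot> ((LUn V (Unt V \<and>o x) \<cdot> Asc V (Unt V) (Unt V) x) \<cdot> (?i \<and>a Ide V x))))"
      by (simp add: lun_nat comp_assoc)
    \<comment> \<open>By \<open>lun_tensor\<close> the first factor is the unitor of
      \<open>Unt V\<close> tensored with x, which is inverse to \<open>?i\<close> tensored with
      x.\<close>
    also have "(LUn V (Unt V \<and>o x) \<cdot> Asc V (Unt V) (Unt V) x) \<cdot> (?i \<and>a Ide V x) = Ide V (Unt V \<and>o x)"
      by (simp add: lun_tensor tenA_comp inv)
    finally show "Evl V x z \<cdot> ((?C \<cdot> ((?b \<and>a ?a) \<cdot> ?i)) \<and>a Ide V x) = Evl V x z \<cdot> (?c \<and>a Ide V x)"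
      by (simp add: ev)
  qed simp_all
  then show ?thesis by (simp add: comp_assoc)
qed

text \<open>The premise \<open>eq\<close> is naturality in uncurried form, and the conclusion is the
  equation demanded by \<open>v_nat\<close>. Its two sides evaluate to the two sides of
  \<open>eq\<close>: on the left the inverse right unitor is absorbed by \<open>triangle\<close>, on
  the right the inverse left unitor is absorbed by \<open>lun_tensor\<close>.\<close>

lemma curry_natural:
  assumes obj: "x \<in> Obj V" "y \<in> Obj V" "x' \<in> Obj V" "y' \<in> Obj V" "h \<in> Obj V"
    and d: "d \<in> homset V (h \<and>o x) y" and e: "e \<in> homset V (h \<and>o x') y'"
    and a: "a \<in> homset V x x'" and b: "b \<in> homset V y y'"
    and eq: "e \<cdot> (Ide V h \<and>a a) = b \<cdot> d"
  shows "VComp (v_self V) x x' y' \<cdot> (curry_arrow V h x' y' e \<and>a global_elt x x' a) \<cdot> inv_arrow V (RUn V h)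
    = VComp (v_self V) x y y' \<cdot> (global_elt y y' b \<and>a curry_arrow V h x y d) \<cdot> inv_arrow V (LUn V h)"
    (is "?C \<cdot> (?e \<and>a ?a) \<cdot> ?r = ?C' \<cdot> (?b \<and>a ?d) \<cdot> ?l")
proof -
  note [simp] = obj homD[OF a] homD[OF b] homD[OF d] homD[OF e]
  note invl = inv_arrow_simps[of "LUn V h", simplified] and invr = inv_arrow_simps[of "RUn V h", simplified]
  note ga = global_elt_hom[OF obj(1,3) a] and gb = global_elt_hom[OF obj(2,4) b]
  note [simp] = homD[OF ga] homD[OF gb] invl(1-3) invr(1-3)
  have eva: "Evl V x x' \<cdot> (?a \<and>a Ide V x) = a \<cdot> LUn V x"
    by (simp add: global_elt_def)
  have evb: "Evl V y y' \<cdot> (?b \<and>a Ide V y) = b \<cdot> LUn V y"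
    by (simp add: global_elt_def)
  have "?C \<cdot> ((?e \<and>a ?a) \<cdot> ?r) = ?C' \<cdot> ((?b \<and>a ?d) \<cdot> ?l)"
  proof (rule evl_cancel[where x = x and y = y'])
    have "Evl V x y' \<cdot> ((?C \<cdot> ((?e \<and>a ?a) \<cdot> ?r)) \<and>a Ide V x)
      = Evl V x' y' \<cdot> ((?e \<and>a (a \<cdot> LUn V x)) \<cdot> (Asc V h (Unt V) x \<cdot> (?r \<and>a Ide V x)))"
      by (subst evl_self_comp) (simp_all add: eva)
    also have "\<dots> = (Evl V x' y' \<cdot> (?e \<and>a Ide V x')) \<cdot> ((Ide V h \<and>a a) \<cdot>
        (((Ide V h \<and>a LUn V x) \<cdot> Asc V h (Unt V) x) \<cdot> (?r \<and>a Ide V x)))"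
      by (simp add: comp_assoc tenA_comp' del: curry_simps(4))
    also have "\<dots> = e \<cdot> (Ide V h \<and>a a)"
      by (simp add: triangle tenA_comp invr)
    also have "\<dots> = b \<cdot> (d \<cdot> ((LUn V (h \<and>o x) \<cdot> Asc V (Unt V) h x) \<cdot> (?l \<and>a Ide V x)))"
      by (simp add: eq lun_tensor tenA_comp invl)
    also have "\<dots> = b \<cdot> ((LUn V y \<cdot> (Ide V (Unt V) \<and>a d)) \<cdot> (Asc V (Unt V) h x \<cdot> (?l \<and>a Ide V x)))"
      by (simp add: lun_nat comp_assoc)
    also have "\<dots> = (Evl V y y' \<cdot> (?b \<and>a Ide V y)) \<cdot> ((Ide V (Unt V) \<and>a d) \<cdot> (Asc V (Unt V) h x \<cdot> (?l \<and>a Ide V x)))"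
      by (simp add: evb comp_assoc)
    also have "\<dots> = Evl V y y' \<cdot> ((?b \<and>a d) \<cdot> (Asc V (Unt V) h x \<cdot> (?l \<and>a Ide V x)))"
      by (simp add: comp_assoc tenA_comp')
    also have "\<dots> = Evl V x y' \<cdot> ((?C' \<cdot> ((?b \<and>a ?d) \<cdot> ?l)) \<and>a Ide V x)"
      by (subst evl_self_comp) simp_all
    finally show "Evl V x y' \<cdot> ((?C \<cdot> ((?e \<and>a ?a) \<cdot> ?r)) \<and>a Ide V x)
      = Evl V x y' \<cdot> ((?C' \<cdot> ((?b \<and>a ?d) \<cdot> ?l)) \<and>a Ide V x)" .
  qed simp_all
  then show ?thesis by (simp add: comp_assoc)
qed

end

section \<open>Bilinear functors\<close>

lemma obj_tuples_simps [simp]: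
  "[] \<in> obj_tuples []"
  "x # xs \<in> obj_tuples (A # As) \<longleftrightarrow> x \<in> Obj A \<and> xs \<in> obj_tuples As"
  by (simp_all add: obj_tuples_def)

lemma arr_tuples_simps [simp]:
  "[] \<in> arr_tuples []"
  "u # us \<in> arr_tuples (A # As) \<longleftrightarrow> u \<in> Arr A \<and> us \<in> arr_tuples As"
  by (simp_all add: arr_tuples_def)

lemma ball_obj_tuples:
  "(\<forall>xs\<in>obj_tuples []. P xs) \<longleftrightarrow> P []"
  "(\<forall>xs\<in>obj_tuples (A # As). Q xs) \<longleftrightarrow> (\<forall>x\<in>Obj A. \<forall>xs\<in>obj_tuples As. Q (x # xs))"
  by (auto simp: obj_tuples_def list_all2_Cons2)

lemma ball_arr_tuples:
  "(\<forall>us\<in>arr_tuples []. P us) \<longleftrightarrow> P []"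
  "(\<forall>us\<in>arr_tuples (A # As). Q us) \<longleftrightarrow> (\<forall>u\<in>Arr A. \<forall>us\<in>arr_tuples As. Q (u # us))"
  by (auto simp: arr_tuples_def list_all2_Cons2)

lemma mk_mfun_simps [simp]:
  "xs \<in> obj_tuples As \<Longrightarrow> MO (mk_mfun As fo fa d) xs = fo xs"
  "us \<in> arr_tuples As \<Longrightarrow> MA (mk_mfun As fo fa d) us = fa us"
  "i < length As \<Longrightarrow> xs \<in> obj_tuples As \<Longrightarrow> y \<in> Obj (As ! i) \<Longrightarrow> MD (mk_mfun As fo fa d) i xs y = d i xs y"
  by (simp_all add: mk_mfun_def)

text \<open>Values outside the domain are fixed by \<open>mk_mfun\<close>, so two composites agree
  as soon as they agree on objects, arrows and constraints inside it. The equations of bilinear and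
  trilinear functors below are proved by this rule.\<close>

lemma mk_mfun_cong:
  assumes "\<And>xs. xs \<in> obj_tuples As \<Longrightarrow> fo xs = fo' xs"
    and "\<And>us. us \<in> arr_tuples As \<Longrightarrow> fa us = fa' us"
    and "\<And>i xs y. i < length As \<Longrightarrow> xs \<in> obj_tuples As \<Longrightarrow> y \<in> Obj (As ! i) \<Longrightarrow> d i xs y = d' i xs y"
  shows "mk_mfun As fo fa d = mk_mfun As fo' fa' d'"
  using assms by (auto simp: mk_mfun_def intro!: restrict_ext ext)

lemma mk_mfun_MO_MA_MD [simp]:
  "mk_mfun As (MO (mk_mfun As fo fa d)) (MA (mk_mfun As fo fa d)) (MD (mk_mfun As fo fa d)) = mk_mfun As fo fa d"
  by (rule mk_mfun_cong) simp_all

lemma mk_lax_simps [simp]: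
  "x \<in> Obj A \<Longrightarrow> LO (mk_lax A fo fa d) x = fo x"
  "u \<in> Arr A \<Longrightarrow> LA (mk_lax A fo fa d) u = fa u"
  "x \<in> Obj A \<Longrightarrow> y \<in> Obj A \<Longrightarrow> LS (mk_lax A fo fa d) x y = d x y"
  by (simp_all add: mk_lax_def)

section \<open>Calculation in a permutative category\<close>

locale permutative = small_category P
  for P :: "('o, 'a) permcat" (structure) +
  assumes permutative: "permutative_category P"
begin

lemma zro_obj [simp]: "\<zero>p \<in> Obj P"
  and add_obj [simp]: "x \<in> Obj P \<Longrightarrow> y \<in> Obj P \<Longrightarrow> x \<boxplus> y \<in> Obj P"
proof -
  have "\<zero>p \<in> Obj P" "\<forall>x\<in>Obj P. \<forall>y\<in>Obj P. x \<boxplus> y \<in> Obj P"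
    using permutative unfolding permutative_category_def by - (elim conjE, assumption)+
  then show "\<zero>p \<in> Obj P" "x \<in> Obj P \<Longrightarrow> y \<in> Obj P \<Longrightarrow> x \<boxplus> y \<in> Obj P" by blast+
qed

lemma topspace_hom:
  assumes "x \<in> Obj P" "y \<in> Obj P"
  shows "topspace (HTop P x y) = homset P x y"
proof -
  have "\<forall>x\<in>Obj P. \<forall>y\<in>Obj P. topspace (HTop P x y) = homset P x y"
    using permutative unfolding permutative_category_def by (elim conjE)
  with assms show ?thesis by blast
qed

lemma continuous_comp:
  assumes "x \<in> Obj P" "y \<in> Obj P" "z \<in> Obj P"
  shows "continuous_map (prod_topology (HTop P y z) (HTop P x y)) (HTop P x z) (\<lambda>(v, u). v \<cdot> u)"
proof -
  have "\<forall>x\<in>Obj P. \<forall>y\<in>Obj P. \<forall>z\<in>Obj P.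
      continuous_map (prod_topology (HTop P y z) (HTop P x y)) (HTop P x z) (\<lambda>(v, u). v \<cdot> u)"
    using permutative unfolding permutative_category_def by (elim conjE)
  with assms show ?thesis by blast
qed

lemma addA_simps [simp]:
  assumes "u \<in> Arr P" "v \<in> Arr P"
  shows "u \<uplus> v \<in> Arr P" "Dom P (u \<uplus> v) = Dom P u \<boxplus> Dom P v" "Cod P (u \<uplus> v) = Cod P u \<boxplus> Cod P v"
proof -
  have "\<forall>u\<in>Arr P. \<forall>v\<in>Arr P. u \<uplus> v \<in> homset P (Dom P u \<boxplus> Dom P v) (Cod P u \<boxplus> Cod P v)"
    using permutative unfolding permutative_category_def by (elim conjE)
  then show "u \<uplus> v \<in> Arr P" "Dom P (u \<uplus> v) = Dom P u \<boxplus> Dom P v" "Cod P (u \<uplus> v) = Cod P u \<boxplus> Cod P v"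
    using assms by (auto simp: homset_def)
qed

lemma addA_ide [simp]:
  assumes "x \<in> Obj P" "y \<in> Obj P"
  shows "Ide P x \<uplus> Ide P y = Ide P (x \<boxplus> y)"
proof -
  have "\<forall>x\<in>Obj P. \<forall>y\<in>Obj P. Ide P x \<uplus> Ide P y = Ide P (x \<boxplus> y)"
    using permutative unfolding permutative_category_def by (elim conjE)
  with assms show ?thesis by blast
qed

lemma addA_comp:
  assumes "u \<in> Arr P" "u' \<in> Arr P" "v \<in> Arr P" "v' \<in> Arr P" "Cod P u = Dom P u'" "Cod P v = Dom P v'"
  shows "(u' \<uplus> v') \<cdot> (u \<uplus> v) = (u' \<cdot> u) \<uplus> (v' \<cdot> v)"
proof -
  have "\<forall>u\<in>Arr P. \<forall>u'\<in>Arr P. \<forall>v\<in>Arr P. \<forall>v'\<in>Arr P. Cod P u = Dom P u' \<and> Cod P v = Dom P v' \<longrightarrow>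
        (u' \<cdot> u) \<uplus> (v' \<cdot> v) = (u' \<uplus> v') \<cdot> (u \<uplus> v)"
    using permutative unfolding permutative_category_def by (elim conjE)
  with assms show ?thesis by metis
qed

lemma add_assoc:
  assumes "x \<in> Obj P" "y \<in> Obj P" "z \<in> Obj P"
  shows "(x \<boxplus> y) \<boxplus> z = x \<boxplus> (y \<boxplus> z)"
proof -
  have "\<forall>x\<in>Obj P. \<forall>y\<in>Obj P. \<forall>z\<in>Obj P. (x \<boxplus> y) \<boxplus> z = x \<boxplus> (y \<boxplus> z)"
    using permutative unfolding permutative_category_def by (elim conjE)
  with assms show ?thesis by blast
qed

lemma add_zro [simp]:
  assumes "x \<in> Obj P"
  shows "\<zero>p \<boxplus> x = x" "x \<boxplus> \<zero>p = x"
proof -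
  have "\<forall>x\<in>Obj P. \<zero>p \<boxplus> x = x \<and> x \<boxplus> \<zero>p = x"
    using permutative unfolding permutative_category_def by (elim conjE)
  with assms show "\<zero>p \<boxplus> x = x" "x \<boxplus> \<zero>p = x" by blast+
qed

lemma swp_simps [simp]:
  assumes "x \<in> Obj P" "y \<in> Obj P"
  shows "Swp P x y \<in> Arr P" "Dom P (Swp P x y) = x \<boxplus> y" "Cod P (Swp P x y) = y \<boxplus> x"
    "Swp P y x \<cdot> Swp P x y = Ide P (x \<boxplus> y)"
proof -
  have "\<forall>x\<in>Obj P. \<forall>y\<in>Obj P. Swp P x y \<in> homset P (x \<boxplus> y) (y \<boxplus> x)"
    "\<forall>x\<in>Obj P. \<forall>y\<in>Obj P. Swp P y x \<cdot> Swp P x y = Ide P (x \<boxplus> y)"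
    using permutative unfolding permutative_category_def by - (elim conjE, assumption)+
  with assms show "Swp P x y \<in> Arr P" "Dom P (Swp P x y) = x \<boxplus> y" "Cod P (Swp P x y) = y \<boxplus> x"
    "Swp P y x \<cdot> Swp P x y = Ide P (x \<boxplus> y)"
    by (auto simp: homset_def)
qed

lemma middle_swap_involutive:
  assumes "a \<in> Obj P" "b \<in> Obj P" "c \<in> Obj P" "d \<in> Obj P"
  shows "(Ide P a \<uplus> Swp P c b \<uplus> Ide P d) \<cdot> (Ide P a \<uplus> Swp P b c \<uplus> Ide P d) = Ide P (a \<boxplus> (b \<boxplus> c) \<boxplus> d)"
  using assms by (simp add: addA_comp)

end

section \<open>Linearity in one of two variables, with curried functions instead of lists\<close>

lemma permutativeI: "permutative_category P \<Longrightarrow> permutative P"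
  unfolding permutative_def permutative_axioms_def small_category_def permutative_category_def by blast

text \<open>Tuples always list the variable in A first, whereas \<open>left_linear B A\<close>
  quantifies over B first; this rule bridges the two orders.\<close>

lemma ball_swap: "\<forall>x\<in>A. \<forall>y\<in>B. P x y \<Longrightarrow> \<forall>y\<in>B. \<forall>x\<in>A. P x y"
  by blast

text \<open>The clauses of \<open>multilinear\<close> that concern the constraint in the first of
  two variables. Linearity in the second variable is the same predicate with the arguments
  exchanged, so each clause is stated once.\<close>

definition left_linear ::
  "('o, 'a) permcat \<Rightarrow> ('o, 'a) permcat \<Rightarrow> ('p, 'b) permcat \<Rightarrow> ('o \<Rightarrow> 'o \<Rightarrow> 'p) \<Rightarrow> ('a \<Rightarrow> 'a \<Rightarrow> 'b)
     \<Rightarrow> ('o \<Rightarrow> 'o \<Rightarrow> 'o \<Rightarrow> 'b) \<Rightarrow> bool" where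
  "left_linear A B C fo fa d \<longleftrightarrow>
     (\<forall>y\<in>Obj B. fo \<zero>p\<^bsub>A\<^esub> y = \<zero>p\<^bsub>C\<^esub>) \<and>
     (\<forall>v\<in>Arr B. fa (Ide A \<zero>p\<^bsub>A\<^esub>) v = Ide C \<zero>p\<^bsub>C\<^esub>) \<and>
     (\<forall>x\<in>Obj A. \<forall>y\<in>Obj B. \<forall>x'\<in>Obj A. d x y x' \<in> homset C (fo x y \<boxplus>\<^bsub>C\<^esub> fo x' y) (fo (x \<boxplus>\<^bsub>A\<^esub> x') y)) \<and>
     (\<forall>u\<in>Arr A. \<forall>v\<in>Arr B. \<forall>u'\<in>Arr A.
        d (Cod A u) (Cod B v) (Cod A u') \<cdot>\<^bsub>C\<^esub> (fa u v \<uplus>\<^bsub>C\<^esub> fa u' v)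
          = fa (u \<uplus>\<^bsub>A\<^esub> u') v \<cdot>\<^bsub>C\<^esub> d (Dom A u) (Dom B v) (Dom A u')) \<and>
     (\<forall>x\<in>Obj A. \<forall>y\<in>Obj B. \<forall>x'\<in>Obj A. x' = \<zero>p\<^bsub>A\<^esub> \<or> x = \<zero>p\<^bsub>A\<^esub> \<or> y = \<zero>p\<^bsub>B\<^esub> \<longrightarrow>
        d x y x' = Ide C (fo (x \<boxplus>\<^bsub>A\<^esub> x') y)) \<and>
     (\<forall>x\<in>Obj A. \<forall>y\<in>Obj B. \<forall>x'\<in>Obj A. \<forall>x''\<in>Obj A.
        d x y (x' \<boxplus>\<^bsub>A\<^esub> x'') \<cdot>\<^bsub>C\<^esub> (Ide C (fo x y) \<uplus>\<^bsub>C\<^esub> d x' y x'')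
          = d (x \<boxplus>\<^bsub>A\<^esub> x') y x'' \<cdot>\<^bsub>C\<^esub> (d x y x' \<uplus>\<^bsub>C\<^esub> Ide C (fo x'' y))) \<and>
     (\<forall>x\<in>Obj A. \<forall>y\<in>Obj B. \<forall>x'\<in>Obj A.
        fa (Swp A x x') (Ide B y) \<cdot>\<^bsub>C\<^esub> d x y x' = d x' y x \<cdot>\<^bsub>C\<^esub> Swp C (fo x y) (fo x' y))"

definition bilinear ::
  "('o, 'a) permcat \<Rightarrow> ('o, 'a) permcat \<Rightarrow> ('p, 'b) permcat \<Rightarrow> ('o \<Rightarrow> 'o \<Rightarrow> 'p) \<Rightarrow> ('a \<Rightarrow> 'a \<Rightarrow> 'b)
     \<Rightarrow> ('o \<Rightarrow> 'o \<Rightarrow> 'o \<Rightarrow> 'b) \<Rightarrow> ('o \<Rightarrow> 'o \<Rightarrow> 'o \<Rightarrow> 'b) \<Rightarrow> bool" where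
  "bilinear A B C fo fa d e \<longleftrightarrow>
     (\<forall>x\<in>Obj A. \<forall>y\<in>Obj B. fo x y \<in> Obj C) \<and>
     (\<forall>u\<in>Arr A. \<forall>v\<in>Arr B. fa u v \<in> homset C (fo (Dom A u) (Dom B v)) (fo (Cod A u) (Cod B v))) \<and>
     (\<forall>x\<in>Obj A. \<forall>y\<in>Obj B. fa (Ide A x) (Ide B y) = Ide C (fo x y)) \<and>
     (\<forall>u\<in>Arr A. \<forall>v\<in>Arr B. \<forall>u'\<in>Arr A. \<forall>v'\<in>Arr B. Cod A u = Dom A u' \<and> Cod B v = Dom B v' \<longrightarrow>
        fa (u' \<cdot>\<^bsub>A\<^esub> u) (v' \<cdot>\<^bsub>B\<^esub> v) = fa u' v' \<cdot>\<^bsub>C\<^esub> fa u v) \<and>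
     (\<forall>x\<in>Obj A. \<forall>y\<in>Obj B. \<forall>x'\<in>Obj A. \<forall>y'\<in>Obj B.
        continuous_map (prod_topology (HTop A x x') (HTop B y y')) (HTop C (fo x y) (fo x' y')) (\<lambda>(u, v). fa u v)) \<and>
     left_linear A B C fo fa d \<and>
     left_linear B A C (\<lambda>y x. fo x y) (\<lambda>v u. fa u v) (\<lambda>y x. e x y) \<and>
     (\<forall>x\<in>Obj A. \<forall>y\<in>Obj B. \<forall>x'\<in>Obj A. \<forall>y'\<in>Obj B.
        e (x \<boxplus>\<^bsub>A\<^esub> x') y y' \<cdot>\<^bsub>C\<^esub> (d x y x' \<uplus>\<^bsub>C\<^esub> d x y' x')
          = d x (y \<boxplus>\<^bsub>B\<^esub> y') x' \<cdot>\<^bsub>C\<^esub> (e x y y' \<uplus>\<^bsub>C\<^esub> e x' y y')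
              \<cdot>\<^bsub>C\<^esub> (Ide C (fo x y) \<uplus>\<^bsub>C\<^esub> Swp C (fo x' y) (fo x y') \<uplus>\<^bsub>C\<^esub> Ide C (fo x' y')))"

text \<open>The middle symmetry is an involution, so interchange for the variables \<open>(0, 1)\<close> implies it for \<open>(1, 0)\<close>.\<close>

lemma bilinear_interchange:
  assumes "permutative_category A" "permutative_category B" "permutative_category C" "bilinear A B C fo fa d e"
    and x: "x \<in> Obj A" "x' \<in> Obj A" and y: "y \<in> Obj B" "y' \<in> Obj B"
  shows "d x (y \<boxplus>\<^bsub>B\<^esub> y') x' \<cdot>\<^bsub>C\<^esub> (e x y y' \<uplus>\<^bsub>C\<^esub> e x' y y')
    = e (x \<boxplus>\<^bsub>A\<^esub> x') y y' \<cdot>\<^bsub>C\<^esub> (d x y x' \<uplus>\<^bsub>C\<^esub> d x y' x')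
        \<cdot>\<^bsub>C\<^esub> (Ide C (fo x y) \<uplus>\<^bsub>C\<^esub> Swp C (fo x y') (fo x' y) \<uplus>\<^bsub>C\<^esub> Ide C (fo x' y'))"
proof -
  interpret A: permutative A by (rule permutativeI) fact
  interpret B: permutative B by (rule permutativeI) fact
  interpret C: permutative C by (rule permutativeI) fact
  note b = assms(4)[unfolded bilinear_def left_linear_def]
  note [simp] = x y
  have fo: "\<forall>x\<in>Obj A. \<forall>y\<in>Obj B. fo x y \<in> Obj C" using b by (elim conjE)
  then have fo [simp]: "fo x y \<in> Obj C" if "x \<in> Obj A" "y \<in> Obj B" for x y using that by blast
  have d: "\<forall>x\<in>Obj A. \<forall>y\<in>Obj B. \<forall>x'\<in>Obj A. d x y x' \<in> homset C (fo x y \<boxplus>\<^bsub>C\<^esub> fo x' y) (fo (x \<boxplus>\<^bsub>A\<^esub> x') y)"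
    and e: "\<forall>y\<in>Obj B. \<forall>x\<in>Obj A. \<forall>y'\<in>Obj B. e x y y' \<in> homset C (fo x y \<boxplus>\<^bsub>C\<^esub> fo x y') (fo x (y \<boxplus>\<^bsub>B\<^esub> y'))"
    using b by - (elim conjE, assumption)+
  have d [simp]: "d x y x' \<in> Arr C" "Dom C (d x y x') = fo x y \<boxplus>\<^bsub>C\<^esub> fo x' y" "Cod C (d x y x') = fo (x \<boxplus>\<^bsub>A\<^esub> x') y"
    if "x \<in> Obj A" "y \<in> Obj B" "x' \<in> Obj A" for x y x'
    using d that by (auto simp: homset_def)
  have e [simp]: "e x y y' \<in> Arr C" "Dom C (e x y y') = fo x y \<boxplus>\<^bsub>C\<^esub> fo x y'" "Cod C (e x y y') = fo x (y \<boxplus>\<^bsub>B\<^esub> y')"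
    if "x \<in> Obj A" "y \<in> Obj B" "y' \<in> Obj B" for x y y'
    using e that by (auto simp: homset_def)
  have assoc: "fo x y \<boxplus>\<^bsub>C\<^esub> (p \<boxplus>\<^bsub>C\<^esub> q) \<boxplus>\<^bsub>C\<^esub> fo x' y' = (fo x y \<boxplus>\<^bsub>C\<^esub> p) \<boxplus>\<^bsub>C\<^esub> (q \<boxplus>\<^bsub>C\<^esub> fo x' y')"
    if "p \<in> Obj C" "q \<in> Obj C" for p q
    using that by (simp add: C.add_assoc)
  let ?l = "d x (y \<boxplus>\<^bsub>B\<^esub> y') x' \<cdot>\<^bsub>C\<^esub> (e x y y' \<uplus>\<^bsub>C\<^esub> e x' y y')"
  let ?s = "Ide C (fo x y) \<uplus>\<^bsub>C\<^esub> Swp C (fo x' y) (fo x y') \<uplus>\<^bsub>C\<^esub> Ide C (fo x' y')"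
  let ?t = "Ide C (fo x y) \<uplus>\<^bsub>C\<^esub> Swp C (fo x y') (fo x' y) \<uplus>\<^bsub>C\<^esub> Ide C (fo x' y')"
  have i: "e (x \<boxplus>\<^bsub>A\<^esub> x') y y' \<cdot>\<^bsub>C\<^esub> (d x y x' \<uplus>\<^bsub>C\<^esub> d x y' x') = ?l \<cdot>\<^bsub>C\<^esub> ?s"
    using assms(4) x y unfolding bilinear_def by simp
  have "?l \<cdot>\<^bsub>C\<^esub> ?s \<cdot>\<^bsub>C\<^esub> ?t = ?l \<cdot>\<^bsub>C\<^esub> (?s \<cdot>\<^bsub>C\<^esub> ?t)"
    by (rule C.comp_assoc) (simp_all add: assoc)
  also have "\<dots> = ?l"
    by (subst C.middle_swap_involutive) (simp_all add: assoc)
  finally show ?thesis by (simp only: i)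
qed

text \<open>Pairs and functions on a two-element index set form homeomorphic spaces; each direction
  composes with the comparison map. The index set is written \<open>{..<Suc (Suc 0)}\<close> because
  this is what the length of a two-element list simplifies to.\<close>

lemma continuous_map_pair_tuple:
  "continuous_map (product_topology T {..<Suc (Suc 0)}) X (\<lambda>\<phi>. g (\<phi> 0) (\<phi> (Suc 0))) \<longleftrightarrow>
   continuous_map (prod_topology (T 0) (T (Suc 0))) X (\<lambda>(u, v). g u v)"
  (is "?L \<longleftrightarrow> ?R")
proof
  assume ?L
  have eq: "(\<lambda>(u, v). g u v) = (\<lambda>\<phi>. g (\<phi> 0) (\<phi> (Suc 0))) \<circ> (\<lambda>(u, v). \<lambda>i\<in>{..<Suc (Suc 0)}. if i = 0 then u else v)"
    by auto
  have "continuous_map (prod_topology (T 0) (T (Suc 0))) (product_topology T {..<Suc (Suc 0)})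
      (\<lambda>(u, v). \<lambda>i\<in>{..<Suc (Suc 0)}. if i = 0 then u else v)"
    by (auto simp: continuous_map_componentwise less_Suc_eq case_prod_unfold
        intro: continuous_map_fst continuous_map_snd)
  then show ?R unfolding eq by (rule continuous_map_compose) fact
next
  assume ?R
  have eq: "(\<lambda>\<phi>. g (\<phi> 0) (\<phi> (Suc 0))) = (\<lambda>(u, v). g u v) \<circ> (\<lambda>\<phi>. (\<phi> 0, \<phi> (Suc 0)))"
    by auto
  have "continuous_map (product_topology T {..<Suc (Suc 0)}) (prod_topology (T 0) (T (Suc 0)))
      (\<lambda>\<phi>. (\<phi> 0, \<phi> (Suc 0)))"
    by (intro continuous_map_pairedI continuous_map_product_projection) auto
  then show ?L unfolding eq by (rule continuous_map_compose) fact
qed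

text \<open>Running through tuples of length two turns the clauses of \<open>multilinear\<close>
  into those of \<open>bilinear\<close>. The two differ in the order of quantifiers, in the product
  topology, in the shape of the zero conditions, and in the second instance of the interchange law,
  which \<open>bilinear_interchange\<close> supplies.\<close>

lemma multilinear_pair_iff:
  assumes "permutative_category A" "permutative_category B" "permutative_category C"
  shows "multilinear [A, B] C f \<longleftrightarrow> f = mk_mfun [A, B] (MO f) (MA f) (MD f) \<and>
    bilinear A B C (\<lambda>x y. MO f [x, y]) (\<lambda>u v. MA f [u, v]) (\<lambda>x y. MD f 0 [x, y]) (\<lambda>x y. MD f (Suc 0) [x, y])"
    (is "?M \<longleftrightarrow> ?mk \<and> ?B")
proof -
  note [simp] = ball_obj_tuples ball_arr_tuples All_less_Suc2 Ex_less_Suc2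
  have z: "\<zero>p\<^bsub>A\<^esub> \<in> Obj A" "\<zero>p\<^bsub>B\<^esub> \<in> Obj B" "Ide A \<zero>p\<^bsub>A\<^esub> \<in> Arr A" "Ide B \<zero>p\<^bsub>B\<^esub> \<in> Arr B"
    using assms(1,2)[THEN permutativeI]
    by (simp_all add: permutative.zro_obj small_category.ide_simps permutative.axioms(1))
  have cont: "continuous_map (product_topology (\<lambda>i. HTop ([A, B] ! i) ([x, y] ! i) ([x', y'] ! i)) {..<Suc (Suc 0)}) T
      (\<lambda>\<phi>. MA f [\<phi> 0, \<phi> (Suc 0)])
    \<longleftrightarrow> continuous_map (prod_topology (HTop A x x') (HTop B y y')) T (\<lambda>(u, v). MA f [u, v])" for x y x' y' T
    by (subst continuous_map_pair_tuple) simp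
  \<comment> \<open>Simplification presents each zero condition as a conjunction of implications
    into which the equation has already been substituted. These equivalences convert that shape into
    the clauses of \<open>left_linear\<close>.\<close>
  have unit: "(\<forall>x\<in>Obj A. \<forall>y\<in>Obj B. (x = \<zero>p\<^bsub>A\<^esub> \<longrightarrow> P \<zero>p\<^bsub>A\<^esub> y) \<and> (y = \<zero>p\<^bsub>B\<^esub> \<longrightarrow> Q x \<zero>p\<^bsub>B\<^esub>))
      \<longleftrightarrow> (\<forall>y\<in>Obj B. P \<zero>p\<^bsub>A\<^esub> y) \<and> (\<forall>x\<in>Obj A. Q x \<zero>p\<^bsub>B\<^esub>)" for P Q
    using z by blast
  have unit': "(\<forall>x\<in>Arr A. \<forall>y\<in>Arr B. (x = Ide A \<zero>p\<^bsub>A\<^esub> \<longrightarrow> P (Ide A \<zero>p\<^bsub>A\<^esub>) y) \<and> (y = Ide B \<zero>p\<^bsub>B\<^esub> \<longrightarrow> Q x (Ide B \<zero>p\<^bsub>B\<^esub>)))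
      \<longleftrightarrow> (\<forall>y\<in>Arr B. P (Ide A \<zero>p\<^bsub>A\<^esub>) y) \<and> (\<forall>x\<in>Arr A. Q x (Ide B \<zero>p\<^bsub>B\<^esub>))" for P Q
    using z by blast
  have unit1: "(\<forall>x\<in>Obj A. \<forall>y\<in>Obj B. \<forall>x'\<in>Obj A. (x' = \<zero>p\<^bsub>A\<^esub> \<longrightarrow> P x y \<zero>p\<^bsub>A\<^esub>) \<and> (x = \<zero>p\<^bsub>A\<^esub> \<longrightarrow> P \<zero>p\<^bsub>A\<^esub> y x') \<and> (y = \<zero>p\<^bsub>B\<^esub> \<longrightarrow> P x \<zero>p\<^bsub>B\<^esub> x'))
     \<longleftrightarrow> (\<forall>x\<in>Obj A. \<forall>y\<in>Obj B. \<forall>x'\<in>Obj A. x' = \<zero>p\<^bsub>A\<^esub> \<or> x = \<zero>p\<^bsub>A\<^esub> \<or> y = \<zero>p\<^bsub>B\<^esub> \<longrightarrow> P x y x')" for P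
    using z by blast
  have unit2: "(\<forall>x\<in>Obj A. \<forall>y\<in>Obj B. \<forall>y'\<in>Obj B. (y' = \<zero>p\<^bsub>B\<^esub> \<longrightarrow> P x y \<zero>p\<^bsub>B\<^esub>) \<and> (x = \<zero>p\<^bsub>A\<^esub> \<longrightarrow> P \<zero>p\<^bsub>A\<^esub> y y') \<and> (y = \<zero>p\<^bsub>B\<^esub> \<longrightarrow> P x \<zero>p\<^bsub>B\<^esub> y'))
     \<longleftrightarrow> (\<forall>y\<in>Obj B. \<forall>x\<in>Obj A. \<forall>y'\<in>Obj B. y' = \<zero>p\<^bsub>B\<^esub> \<or> y = \<zero>p\<^bsub>B\<^esub> \<or> x = \<zero>p\<^bsub>A\<^esub> \<longrightarrow> P x y y')" for P
    using z by blast
  note unit = unit[of "\<lambda>x y. MO f [x, y] = \<zero>p\<^bsub>C\<^esub>" "\<lambda>x y. MO f [x, y] = \<zero>p\<^bsub>C\<^esub>"]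
    unit'[of "\<lambda>u v. MA f [u, v] = Ide C \<zero>p\<^bsub>C\<^esub>" "\<lambda>u v. MA f [u, v] = Ide C \<zero>p\<^bsub>C\<^esub>"]
    unit1[of "\<lambda>x y x'. MD f 0 [x, y] x' = Ide C (MO f [x \<boxplus>\<^bsub>A\<^esub> x', y])"]
    unit2[of "\<lambda>x y y'. MD f (Suc 0) [x, y] y' = Ide C (MO f [x, y \<boxplus>\<^bsub>B\<^esub> y'])"]
  show ?thesis
  proof
    assume "?mk \<and> ?B"
    then have mk: ?mk and b: ?B by blast+
    note i = bilinear_interchange[OF assms b]
    have i: "\<forall>x\<in>Obj A. \<forall>y\<in>Obj B. \<forall>y'\<in>Obj B. \<forall>x'\<in>Obj A.
       MD f 0 [x, y \<boxplus>\<^bsub>B\<^esub> y'] x' \<cdot>\<^bsub>C\<^esub> (MD f (Suc 0) [x, y] y' \<uplus>\<^bsub>C\<^esub> MD f (Suc 0) [x', y] y') =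
       MD f (Suc 0) [x \<boxplus>\<^bsub>A\<^esub> x', y] y' \<cdot>\<^bsub>C\<^esub> (MD f 0 [x, y] x' \<uplus>\<^bsub>C\<^esub> MD f 0 [x, y'] x') \<cdot>\<^bsub>C\<^esub>
       (Ide C (MO f [x, y]) \<uplus>\<^bsub>C\<^esub> Swp C (MO f [x, y']) (MO f [x', y]) \<uplus>\<^bsub>C\<^esub> Ide C (MO f [x', y']))"
      by (intro ballI i)
    show ?M unfolding multilinear_def
      apply (rule conjI[OF mk])
      apply (simp add: cont)
      apply (simp only: unit) \<comment> \<open>the simplifier would expand the right-hand sides of \<open>unit\<close> again\<close>
      using b i unfolding bilinear_def left_linear_def
      by (elim conjE, intro conjI) (assumption | (rule ball_swap, assumption))+
  next
    assume M: ?M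
    then have mk: ?mk unfolding multilinear_def by (elim conjE)
    note m = M[unfolded multilinear_def, THEN conjunct2, simplified, simplified cont unit]
    have ?B unfolding bilinear_def left_linear_def using m
      by (elim conjE, intro conjI) (assumption | (rule ball_swap, assumption))+
    with mk show "?mk \<and> ?B" by blast
  qed
qed

text \<open>Only values on objects and arrows matter, also for continuity, since the points of the
  hom spaces are arrows. It replaces lookups in a \<open>mk_mfun\<close> by the functions from which
  it was built.\<close>

lemma bilinear_cong:
  assumes "permutative_category A" "permutative_category B"
    and fo: "\<And>x y. x \<in> Obj A \<Longrightarrow> y \<in> Obj B \<Longrightarrow> fo x y = fo' x y"
    and fa: "\<And>u v. u \<in> Arr A \<Longrightarrow> v \<in> Arr B \<Longrightarrow> fa u v = fa' u v"
    and d: "\<And>x y x'. x \<in> Obj A \<Longrightarrow> y \<in> Obj B \<Longrightarrow> x' \<in> Obj A \<Longrightarrow> d x y x' = d' x y x'"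
    and e: "\<And>x y y'. x \<in> Obj A \<Longrightarrow> y \<in> Obj B \<Longrightarrow> y' \<in> Obj B \<Longrightarrow> e x y y' = e' x y y'"
  shows "bilinear A B C fo fa d e \<longleftrightarrow> bilinear A B C fo' fa' d' e'"
proof -
  interpret A: permutative A by (rule permutativeI) fact
  interpret B: permutative B by (rule permutativeI) fact
  have cont: "continuous_map (prod_topology (HTop A x x') (HTop B y y')) T (\<lambda>(u, v). fa u v)
      \<longleftrightarrow> continuous_map (prod_topology (HTop A x x') (HTop B y y')) T (\<lambda>(u, v). fa' u v)"
    if "x \<in> Obj A" "x' \<in> Obj A" "y \<in> Obj B" "y' \<in> Obj B" for x x' y y' T
    by (rule iffI; erule continuous_map_eq)
      (use that in \<open>auto simp: A.topspace_hom B.topspace_hom homset_def fa\<close>)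
  show ?thesis
    unfolding bilinear_def left_linear_def
    by (intro conj_cong ball_cong refl; simp add: fo fa d e cont)
qed

text \<open>The two linearity clauses trade places and continuity is transported along the exchange
  of factors. The one clause that is not symmetric is the interchange law, which becomes its other
  instance.\<close>

lemma bilinear_flip:
  assumes "permutative_category A" "permutative_category B" "permutative_category C" "bilinear A B C fo fa d e"
  shows "bilinear B A C (\<lambda>y x. fo x y) (\<lambda>v u. fa u v) (\<lambda>y x. e x y) (\<lambda>y x. d x y)"
proof -
  have i: "\<forall>y\<in>Obj B. \<forall>x\<in>Obj A. \<forall>y'\<in>Obj B. \<forall>x'\<in>Obj A.
      d x (y \<boxplus>\<^bsub>B\<^esub> y') x' \<cdot>\<^bsub>C\<^esub> (e x y y' \<uplus>\<^bsub>C\<^esub> e x' y y')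
      = e (x \<boxplus>\<^bsub>A\<^esub> x') y y' \<cdot>\<^bsub>C\<^esub> (d x y x' \<uplus>\<^bsub>C\<^esub> d x y' x')
        \<cdot>\<^bsub>C\<^esub> (Ide C (fo x y) \<uplus>\<^bsub>C\<^esub> Swp C (fo x y') (fo x' y) \<uplus>\<^bsub>C\<^esub> Ide C (fo x' y'))"
    by (intro ballI bilinear_interchange[OF assms])
  have base: "\<forall>x\<in>Obj A. \<forall>y\<in>Obj B. fo x y \<in> Obj C"
    "\<forall>u\<in>Arr A. \<forall>v\<in>Arr B. fa u v \<in> homset C (fo (Dom A u) (Dom B v)) (fo (Cod A u) (Cod B v))"
    "\<forall>x\<in>Obj A. \<forall>y\<in>Obj B. fa (Ide A x) (Ide B y) = Ide C (fo x y)"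
    and comp: "\<forall>u\<in>Arr A. \<forall>v\<in>Arr B. \<forall>u'\<in>Arr A. \<forall>v'\<in>Arr B. Cod A u = Dom A u' \<and> Cod B v = Dom B v' \<longrightarrow>
        fa (u' \<cdot>\<^bsub>A\<^esub> u) (v' \<cdot>\<^bsub>B\<^esub> v) = fa u' v' \<cdot>\<^bsub>C\<^esub> fa u v"
    and cont: "\<forall>x\<in>Obj A. \<forall>y\<in>Obj B. \<forall>x'\<in>Obj A. \<forall>y'\<in>Obj B.
        continuous_map (prod_topology (HTop A x x') (HTop B y y')) (HTop C (fo x y) (fo x' y')) (\<lambda>(u, v). fa u v)"
    and lin: "left_linear A B C fo fa d" "left_linear B A C (\<lambda>y x. fo x y) (\<lambda>v u. fa u v) (\<lambda>y x. e x y)"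
    using assms(4) unfolding bilinear_def by - (elim conjE, assumption)+
  have cont': "continuous_map (prod_topology (HTop B y y') (HTop A x x')) (HTop C (fo x y) (fo x' y')) (\<lambda>(v, u). fa u v)"
    if "x \<in> Obj A" "x' \<in> Obj A" "y \<in> Obj B" "y' \<in> Obj B" for x x' y y'
  proof -
    have eq: "(\<lambda>(v, u). fa u v) = (\<lambda>(u, v). fa u v) \<circ> (\<lambda>(v, u). (u, v))" by auto
    have "continuous_map (prod_topology (HTop A x x') (HTop B y y')) (HTop C (fo x y) (fo x' y')) (\<lambda>(u, v). fa u v)"
      using cont that by blast
    moreover have "continuous_map (prod_topology (HTop B y y') (HTop A x x')) (prod_topology (HTop A x x') (HTop B y y')) (\<lambda>(v, u). (u, v))"
      by (simp add: case_prod_unfold continuous_map_pairedI continuous_map_fst continuous_map_snd)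
    ultimately show ?thesis unfolding eq by (rule continuous_map_compose[rotated])
  qed
  have comp': "\<forall>v\<in>Arr B. \<forall>u\<in>Arr A. \<forall>v'\<in>Arr B. \<forall>u'\<in>Arr A. Cod B v = Dom B v' \<and> Cod A u = Dom A u' \<longrightarrow>
        fa (u' \<cdot>\<^bsub>A\<^esub> u) (v' \<cdot>\<^bsub>B\<^esub> v) = fa u' v' \<cdot>\<^bsub>C\<^esub> fa u v"
    using comp by simp
  show ?thesis
    unfolding bilinear_def
    by (intro conjI ball_swap[OF base(1)] ball_swap[OF base(2)] ball_swap[OF base(3)] comp' lin i ballI cont')
qed

lemma multilinear_mk_mfun_pair:
  assumes "permutative_category A" "permutative_category B" "permutative_category C" "bilinear A B C fo fa d e"
  shows "multilinear [A, B] C (mk_mfun [A, B] (\<lambda>xs. fo (xs ! 0) (xs ! 1)) (\<lambda>us. fa (us ! 0) (us ! 1))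
    (\<lambda>i xs. if i = 0 then d (xs ! 0) (xs ! 1) else e (xs ! 0) (xs ! 1)))" (is "multilinear _ _ ?f")
proof -
  have "bilinear A B C (\<lambda>x y. MO ?f [x, y]) (\<lambda>u v. MA ?f [u, v]) (\<lambda>x y. MD ?f 0 [x, y]) (\<lambda>x y. MD ?f (Suc 0) [x, y])"
    by (subst bilinear_cong[OF assms(1,2), where fo' = fo and fa' = fa and d' = d and e' = e]) (simp_all add: assms(4))
  then show ?thesis by (simp add: multilinear_pair_iff[OF assms(1-3)])
qed

text \<open>Composition in an opposite PC-category is a functor of this form, and K can be applied
  to it only when it is known to be multilinear.\<close>

lemma multilinear_mswap_pair:
  assumes "permutative_category A" "permutative_category B" "permutative_category C" "multilinear [A, B] C f"
  shows "multilinear [B, A] C (mswap [A, B] 0 f)"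
proof -
  \<comment> \<open>The transposition exchanges the two arguments and, through
    \<open>transpose\<close>, also the two constraints.\<close>
  have "mswap [A, B] 0 f = mk_mfun [B, A] (\<lambda>xs. MO f [xs ! 1, xs ! 0]) (\<lambda>us. MA f [us ! 1, us ! 0])
      (\<lambda>i xs. if i = 0 then MD f (Suc 0) [xs ! 1, xs ! 0] else MD f 0 [xs ! 1, xs ! 0])"
    unfolding mswap_def swap_list_def
    by (simp, rule mk_mfun_cong)
      (auto simp: obj_tuples_def arr_tuples_def list_all2_Cons2 transpose_def less_Suc_eq)
  then show ?thesis
    using multilinear_mk_mfun_pair[OF assms(2,1,3) bilinear_flip[OF assms(1-3)
      multilinear_pair_iff[OF assms(1-3), THEN iffD1, OF assms(4), THEN conjunct2]]]
    by simp
qed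

lemma multilinear_point:
  assumes "permutative_category B" "x \<in> Obj B"
  shows "multilinear [] B (point B x)"
proof -
  interpret B: permutative B by (rule permutativeI) fact
  show ?thesis
    using assms(2) unfolding multilinear_def point_def
    by (auto simp: ball_obj_tuples ball_arr_tuples B.topspace_hom homset_def)
qed

section \<open>Lax functors into \<open>Perm(A,B)\<close> and evaluation\<close>

locale lax_symmetric_monoidal =
  A: permutative A + B: permutative B
  for A :: "('o, 'a) permcat" and B :: "('p, 'b) permcat" and f :: "('o, 'a, 'p, 'b) laxfun" +
  assumes lax_functor: "lax_functor A B f"
begin

lemma LO_obj [simp]: "x \<in> Obj A \<Longrightarrow> LO f x \<in> Obj B"
  and LA_ide: "x \<in> Obj A \<Longrightarrow> LA f (Ide A x) = Ide B (LO f x)"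
  and LA_comp: "u \<in> Arr A \<Longrightarrow> v \<in> Arr A \<Longrightarrow> Cod A u = Dom A v \<Longrightarrow> LA f (v \<cdot>\<^bsub>A\<^esub> u) = LA f v \<cdot>\<^bsub>B\<^esub> LA f u"
  using lax_functor by (simp_all add: lax_functor_def is_functor_def)

lemma LA_simps [simp]:
  assumes "u \<in> Arr A"
  shows "LA f u \<in> Arr B" "Dom B (LA f u) = LO f (Dom A u)" "Cod B (LA f u) = LO f (Cod A u)"
  using lax_functor assms by (simp_all add: lax_functor_def is_functor_def homset_def)

lemma LO_zro [simp]: "LO f \<zero>p\<^bsub>A\<^esub> = \<zero>p\<^bsub>B\<^esub>"
  using lax_functor by (simp add: lax_functor_def)

lemma continuous_LA:
  assumes "x \<in> Obj A" "y \<in> Obj A"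
  shows "continuous_map (HTop A x y) (HTop B (LO f x) (LO f y)) (LA f)"
  using lax_functor assms by (simp add: lax_functor_def)

lemma LS_simps [simp]:
  assumes "x \<in> Obj A" "y \<in> Obj A"
  shows "LS f x y \<in> Arr B" "Dom B (LS f x y) = LO f x \<boxplus>\<^bsub>B\<^esub> LO f y" "Cod B (LS f x y) = LO f (x \<boxplus>\<^bsub>A\<^esub> y)"
  using lax_functor assms by (simp_all add: lax_functor_def homset_def)

lemma LS_zro [simp]:
  assumes "x \<in> Obj A"
  shows "LS f x \<zero>p\<^bsub>A\<^esub> = Ide B (LO f x)" "LS f \<zero>p\<^bsub>A\<^esub> x = Ide B (LO f x)"
  using lax_functor assms by (simp_all add: lax_functor_def)

lemma LS_nat:
  assumes "u \<in> Arr A" "v \<in> Arr A"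
  shows "LS f (Cod A u) (Cod A v) \<cdot>\<^bsub>B\<^esub> (LA f u \<uplus>\<^bsub>B\<^esub> LA f v) = LA f (u \<uplus>\<^bsub>A\<^esub> v) \<cdot>\<^bsub>B\<^esub> LS f (Dom A u) (Dom A v)"
proof -
  have "\<forall>u\<in>Arr A. \<forall>v\<in>Arr A.
        LS f (Cod A u) (Cod A v) \<cdot>\<^bsub>B\<^esub> (LA f u \<uplus>\<^bsub>B\<^esub> LA f v)
          = LA f (u \<uplus>\<^bsub>A\<^esub> v) \<cdot>\<^bsub>B\<^esub> LS f (Dom A u) (Dom A v)"
    using lax_functor unfolding lax_functor_def by (elim conjE)
  with assms show ?thesis by blast
qed

lemma LS_assoc:
  assumes "x \<in> Obj A" "y \<in> Obj A" "z \<in> Obj A"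
  shows "LS f x (y \<boxplus>\<^bsub>A\<^esub> z) \<cdot>\<^bsub>B\<^esub> (Ide B (LO f x) \<uplus>\<^bsub>B\<^esub> LS f y z)
          = LS f (x \<boxplus>\<^bsub>A\<^esub> y) z \<cdot>\<^bsub>B\<^esub> (LS f x y \<uplus>\<^bsub>B\<^esub> Ide B (LO f z))"
proof -
  have "\<forall>x\<in>Obj A. \<forall>y\<in>Obj A. \<forall>z\<in>Obj A.
        LS f x (y \<boxplus>\<^bsub>A\<^esub> z) \<cdot>\<^bsub>B\<^esub> (Ide B (LO f x) \<uplus>\<^bsub>B\<^esub> LS f y z)
          = LS f (x \<boxplus>\<^bsub>A\<^esub> y) z \<cdot>\<^bsub>B\<^esub> (LS f x y \<uplus>\<^bsub>B\<^esub> Ide B (LO f z))"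
    using lax_functor unfolding lax_functor_def by (elim conjE)
  with assms show ?thesis by blast
qed

lemma LS_swp:
  assumes "x \<in> Obj A" "y \<in> Obj A"
  shows "LA f (Swp A x y) \<cdot>\<^bsub>B\<^esub> LS f x y = LS f y x \<cdot>\<^bsub>B\<^esub> Swp B (LO f x) (LO f y)"
proof -
  have "\<forall>x\<in>Obj A. \<forall>y\<in>Obj A. LA f (Swp A x y) \<cdot>\<^bsub>B\<^esub> LS f x y = LS f y x \<cdot>\<^bsub>B\<^esub> Swp B (LO f x) (LO f y)"
    using lax_functor unfolding lax_functor_def by (elim conjE)
  with assms show ?thesis by blast
qed

text \<open>The axioms of a lax functor are the one-variable case of multilinearity, with no
  interchange law. Only continuity takes work, as the space of arrows is now a product over a
  one-element index set.\<close>

lemma multilinear_unary: "multilinear [A] B (unary A f)"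
proof -
  have "continuous_map (product_topology (\<lambda>i. HTop ([A] ! i) ([x] ! i) ([y] ! i)) {..<Suc 0})
     (HTop B (LO f x) (LO f y)) (\<lambda>\<phi>. MA (unary A f) [\<phi> 0])" if "x \<in> Obj A" "y \<in> Obj A" for x y
  proof (rule continuous_map_eq)
    have "continuous_map (product_topology (\<lambda>i. HTop ([A] ! i) ([x] ! i) ([y] ! i)) {..<Suc 0}) (HTop A x y) (\<lambda>\<phi>. \<phi> 0)"
      using continuous_map_product_projection[of 0 "{..<Suc 0}" "\<lambda>i. HTop ([A] ! i) ([x] ! i) ([y] ! i)"] by simp
    from continuous_map_compose[OF this continuous_LA[OF that]]
    show "continuous_map (product_topology (\<lambda>i. HTop ([A] ! i) ([x] ! i) ([y] ! i)) {..<Suc 0})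
      (HTop B (LO f x) (LO f y)) (\<lambda>\<phi>. LA f (\<phi> 0))" by (simp add: comp_def)
    show "LA f (\<phi> 0) = MA (unary A f) [\<phi> 0]"
      if "\<phi> \<in> topspace (product_topology (\<lambda>i. HTop ([A] ! i) ([x] ! i) ([y] ! i)) {..<Suc 0})" for \<phi>
    proof -
      have "\<phi> 0 \<in> homset A x y"
        using PiE_mem[OF that[unfolded topspace_product_topology], of 0] \<open>x \<in> Obj A\<close> \<open>y \<in> Obj A\<close>
        by (simp add: A.topspace_hom)
      then show ?thesis by (simp add: unary_def homset_def)
    qed
  qed
  then show ?thesis
    unfolding multilinear_def
    by (simp add: ball_obj_tuples ball_arr_tuples unary_def LA_ide LA_comp LS_nat LS_assoc LS_swp homset_def)
qed

end

lemma lax_symmetric_monoidalI: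
  "permutative_category A \<Longrightarrow> permutative_category B \<Longrightarrow> lax_functor A B f \<Longrightarrow> lax_symmetric_monoidal A B f"
  by (simp add: lax_symmetric_monoidal_def lax_symmetric_monoidal_axioms_def permutativeI)

abbreviation components :: "('o, 'a) laxnt \<Rightarrow> 'o \<Rightarrow> 'a" where
  "components t \<equiv> fst (snd t)"

text \<open>On a pair (u, w) of arrows this is the diagonal of the naturality square of the
  transformation \<open>LA \<Phi> u\<close> at w; of the two paths, the one that applies the source
  functor to w first is chosen.\<close>

definition perm_eval ::
  "('o, 'a) permcat \<Rightarrow> ('o, 'a) permcat \<Rightarrow> ('o, 'a) permcat \<Rightarrow> ('o, 'a, ('o, 'a) lax, ('o, 'a) laxnt) laxfun
     \<Rightarrow> ('o, 'a, 'o, 'a) mfun" where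
  "perm_eval H A B \<Phi> =
     mk_mfun [H, A] (\<lambda>xs. LO (LO \<Phi> (xs ! 0)) (xs ! 1))
       (\<lambda>us. components (LA \<Phi> (us ! 0)) (Cod A (us ! 1)) \<cdot>\<^bsub>B\<^esub> LA (LO \<Phi> (Dom H (us ! 0))) (us ! 1))
       (\<lambda>i xs. if i = 0 then (\<lambda>y. components (LS \<Phi> (xs ! 0) y) (xs ! 1)) else LS (LO \<Phi> (xs ! 0)) (xs ! 1))"

section \<open>Lax functors into Perm(A,B), read off one component at a time\<close>

locale lax_to_perm_hom =
  H: permutative H + A: permutative A + B: permutative B
  for H :: "('o, 'a) permcat" and A :: "('o, 'a) permcat" and B :: "('o, 'a) permcat"
    and \<Phi> :: "('o, 'a, ('o, 'a) lax, ('o, 'a) laxnt) laxfun" +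
  assumes lax_functor: "lax_functor H (perm_hom A B) \<Phi>"
begin

lemma lax_value:
  assumes "s \<in> Obj H"
  shows "lax_symmetric_monoidal A B (LO \<Phi> s)"
proof -
  have "\<forall>s\<in>Obj H. LO \<Phi> s \<in> Obj (perm_hom A B)"
    using lax_functor unfolding lax_functor_def is_functor_def by (elim conjE)
  then show ?thesis using assms
    by (intro lax_symmetric_monoidalI A.permutative B.permutative) (simp add: perm_hom_def)
qed

lemmas value_simps [simp] =
  lax_symmetric_monoidal.LO_obj[OF lax_value] lax_symmetric_monoidal.LA_simps[OF lax_value]
  lax_symmetric_monoidal.LO_zro[OF lax_value] lax_symmetric_monoidal.LS_simps[OF lax_value]
  lax_symmetric_monoidal.LS_zro[OF lax_value]

lemma arr_value:
  assumes "u \<in> Arr H"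
  shows "LA \<Phi> u = (LO \<Phi> (Dom H u), components (LA \<Phi> u), LO \<Phi> (Cod H u))"
    and "monoidal_nat A B (LO \<Phi> (Dom H u)) (LO \<Phi> (Cod H u)) (components (LA \<Phi> u))"
proof -
  have "\<forall>u\<in>Arr H. LA \<Phi> u \<in> homset (perm_hom A B) (LO \<Phi> (Dom H u)) (LO \<Phi> (Cod H u))"
    using lax_functor unfolding lax_functor_def is_functor_def by (elim conjE)
  then have "LA \<Phi> u \<in> homset (perm_hom A B) (LO \<Phi> (Dom H u)) (LO \<Phi> (Cod H u))" using assms by blast
  then show "LA \<Phi> u = (LO \<Phi> (Dom H u), components (LA \<Phi> u), LO \<Phi> (Cod H u))"
    "monoidal_nat A B (LO \<Phi> (Dom H u)) (LO \<Phi> (Cod H u)) (components (LA \<Phi> u))"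
    by (auto simp: perm_hom_def homset_def)
qed

lemma str_value:
  assumes "s \<in> Obj H" "t \<in> Obj H"
  shows "LS \<Phi> s t = (lax_add A B (LO \<Phi> s) (LO \<Phi> t), components (LS \<Phi> s t), LO \<Phi> (s \<boxplus>\<^bsub>H\<^esub> t))"
    and "monoidal_nat A B (lax_add A B (LO \<Phi> s) (LO \<Phi> t)) (LO \<Phi> (s \<boxplus>\<^bsub>H\<^esub> t)) (components (LS \<Phi> s t))"
proof -
  have "\<forall>s\<in>Obj H. \<forall>t\<in>Obj H. LS \<Phi> s t \<in> homset (perm_hom A B) (LO \<Phi> s \<boxplus>\<^bsub>perm_hom A B\<^esub> LO \<Phi> t) (LO \<Phi> (s \<boxplus>\<^bsub>H\<^esub> t))"
    using lax_functor unfolding lax_functor_def by (elim conjE)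
  then have "LS \<Phi> s t \<in> homset (perm_hom A B) (LO \<Phi> s \<boxplus>\<^bsub>perm_hom A B\<^esub> LO \<Phi> t) (LO \<Phi> (s \<boxplus>\<^bsub>H\<^esub> t))" using assms by blast
  then show "LS \<Phi> s t = (lax_add A B (LO \<Phi> s) (LO \<Phi> t), components (LS \<Phi> s t), LO \<Phi> (s \<boxplus>\<^bsub>H\<^esub> t))"
    "monoidal_nat A B (lax_add A B (LO \<Phi> s) (LO \<Phi> t)) (LO \<Phi> (s \<boxplus>\<^bsub>H\<^esub> t)) (components (LS \<Phi> s t))"
    by (auto simp: perm_hom_def homset_def)
qed

lemma arr_components [simp]:
  assumes "u \<in> Arr H" "x \<in> Obj A"
  shows "components (LA \<Phi> u) x \<in> Arr B" "Dom B (components (LA \<Phi> u) x) = LO (LO \<Phi> (Dom H u)) x"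
    "Cod B (components (LA \<Phi> u) x) = LO (LO \<Phi> (Cod H u)) x"
  using arr_value(2)[OF assms(1)] assms(2) by (simp_all add: monoidal_nat_def homset_def)

lemma arr_naturality:
  assumes "u \<in> Arr H" "w \<in> Arr A" "Cod A w = y"
  shows "components (LA \<Phi> u) y \<cdot>\<^bsub>B\<^esub> LA (LO \<Phi> (Dom H u)) w
    = LA (LO \<Phi> (Cod H u)) w \<cdot>\<^bsub>B\<^esub> components (LA \<Phi> u) (Dom A w)"
proof -
  have "\<forall>w\<in>Arr A. components (LA \<Phi> u) (Cod A w) \<cdot>\<^bsub>B\<^esub> LA (LO \<Phi> (Dom H u)) w
    = LA (LO \<Phi> (Cod H u)) w \<cdot>\<^bsub>B\<^esub> components (LA \<Phi> u) (Dom A w)"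
    using arr_value(2)[OF assms(1)] unfolding monoidal_nat_def by (elim conjE)
  with assms show ?thesis by blast
qed

lemma arr_zro [simp]: "u \<in> Arr H \<Longrightarrow> components (LA \<Phi> u) \<zero>p\<^bsub>A\<^esub> = Ide B \<zero>p\<^bsub>B\<^esub>"
  using arr_value(2)[of u] by (simp add: monoidal_nat_def)

lemma arr_monoidal:
  assumes "u \<in> Arr H" "x \<in> Obj A" "y \<in> Obj A"
  shows "components (LA \<Phi> u) (x \<boxplus>\<^bsub>A\<^esub> y) \<cdot>\<^bsub>B\<^esub> LS (LO \<Phi> (Dom H u)) x y
    = LS (LO \<Phi> (Cod H u)) x y \<cdot>\<^bsub>B\<^esub> (components (LA \<Phi> u) x \<uplus>\<^bsub>B\<^esub> components (LA \<Phi> u) y)"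
proof -
  have "\<forall>x\<in>Obj A. \<forall>y\<in>Obj A. components (LA \<Phi> u) (x \<boxplus>\<^bsub>A\<^esub> y) \<cdot>\<^bsub>B\<^esub> LS (LO \<Phi> (Dom H u)) x y
    = LS (LO \<Phi> (Cod H u)) x y \<cdot>\<^bsub>B\<^esub> (components (LA \<Phi> u) x \<uplus>\<^bsub>B\<^esub> components (LA \<Phi> u) y)"
    using arr_value(2)[OF assms(1)] unfolding monoidal_nat_def by (elim conjE)
  with assms show ?thesis by blast
qed

lemma arr_ide:
  assumes "s \<in> Obj H" "x \<in> Obj A"
  shows "components (LA \<Phi> (Ide H s)) x = Ide B (LO (LO \<Phi> s) x)"
proof -
  have "LA \<Phi> (Ide H s) = Ide (perm_hom A B) (LO \<Phi> s)"
    using lax_functor assms unfolding lax_functor_def is_functor_def by (elim conjE) blast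
  then show ?thesis using assms by (simp add: perm_hom_def)
qed

lemma arr_comp:
  assumes "u \<in> Arr H" "v \<in> Arr H" "Cod H u = Dom H v" "x \<in> Obj A"
  shows "components (LA \<Phi> (v \<cdot>\<^bsub>H\<^esub> u)) x = components (LA \<Phi> v) x \<cdot>\<^bsub>B\<^esub> components (LA \<Phi> u) x"
proof -
  have "\<forall>u\<in>Arr H. \<forall>v\<in>Arr H. Cod H u = Dom H v \<longrightarrow> LA \<Phi> (v \<cdot>\<^bsub>H\<^esub> u) = LA \<Phi> v \<cdot>\<^bsub>perm_hom A B\<^esub> LA \<Phi> u"
    using lax_functor unfolding lax_functor_def is_functor_def by (elim conjE)
  then have "LA \<Phi> (v \<cdot>\<^bsub>H\<^esub> u) = LA \<Phi> v \<cdot>\<^bsub>perm_hom A B\<^esub> LA \<Phi> u" using assms by blast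
  then show ?thesis using assms by (simp add: perm_hom_def case_prod_unfold)
qed

lemma str_components [simp]:
  assumes "s \<in> Obj H" "t \<in> Obj H" "x \<in> Obj A"
  shows "components (LS \<Phi> s t) x \<in> Arr B"
    "Dom B (components (LS \<Phi> s t) x) = LO (LO \<Phi> s) x \<boxplus>\<^bsub>B\<^esub> LO (LO \<Phi> t) x"
    "Cod B (components (LS \<Phi> s t) x) = LO (LO \<Phi> (s \<boxplus>\<^bsub>H\<^esub> t)) x"
  using str_value(2)[OF assms(1,2)] assms by (simp_all add: monoidal_nat_def homset_def lax_add_def)

lemma str_naturality:
  assumes "s \<in> Obj H" "t \<in> Obj H" "w \<in> Arr A" "Cod A w = y"
  shows "components (LS \<Phi> s t) y \<cdot>\<^bsub>B\<^esub> (LA (LO \<Phi> s) w \<uplus>\<^bsub>B\<^esub> LA (LO \<Phi> t) w)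
    = LA (LO \<Phi> (s \<boxplus>\<^bsub>H\<^esub> t)) w \<cdot>\<^bsub>B\<^esub> components (LS \<Phi> s t) (Dom A w)"
proof -
  have "\<forall>w\<in>Arr A. components (LS \<Phi> s t) (Cod A w) \<cdot>\<^bsub>B\<^esub> LA (lax_add A B (LO \<Phi> s) (LO \<Phi> t)) w
    = LA (LO \<Phi> (s \<boxplus>\<^bsub>H\<^esub> t)) w \<cdot>\<^bsub>B\<^esub> components (LS \<Phi> s t) (Dom A w)"
    using str_value(2)[OF assms(1,2)] unfolding monoidal_nat_def by (elim conjE)
  then have "components (LS \<Phi> s t) (Cod A w) \<cdot>\<^bsub>B\<^esub> LA (lax_add A B (LO \<Phi> s) (LO \<Phi> t)) w
    = LA (LO \<Phi> (s \<boxplus>\<^bsub>H\<^esub> t)) w \<cdot>\<^bsub>B\<^esub> components (LS \<Phi> s t) (Dom A w)"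
    using assms by blast
  then show ?thesis using assms by (simp add: lax_add_def)
qed

lemma str_zro_right [simp]: "s \<in> Obj H \<Longrightarrow> t \<in> Obj H \<Longrightarrow> components (LS \<Phi> s t) \<zero>p\<^bsub>A\<^esub> = Ide B \<zero>p\<^bsub>B\<^esub>"
  using str_value(2)[of s t] by (simp add: monoidal_nat_def)

text \<open>The structure morphism of \<open>\<Phi>\<close> is an arrow of
  \<open>perm_hom A B\<close>, so it is monoidal for the structure of \<open>lax_add\<close>, and
  this brings in the symmetry. Up to bracketing, this is the interchange law of the evaluation
  functor.\<close>

lemma str_monoidal:
  assumes "s \<in> Obj H" "t \<in> Obj H" "x \<in> Obj A" "y \<in> Obj A"
  shows "components (LS \<Phi> s t) (x \<boxplus>\<^bsub>A\<^esub> y) \<cdot>\<^bsub>B\<^esub> ((LS (LO \<Phi> s) x y \<uplus>\<^bsub>B\<^esub> LS (LO \<Phi> t) x y)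
        \<cdot>\<^bsub>B\<^esub> (Ide B (LO (LO \<Phi> s) x) \<uplus>\<^bsub>B\<^esub> Swp B (LO (LO \<Phi> t) x) (LO (LO \<Phi> s) y) \<uplus>\<^bsub>B\<^esub> Ide B (LO (LO \<Phi> t) y)))
    = LS (LO \<Phi> (s \<boxplus>\<^bsub>H\<^esub> t)) x y \<cdot>\<^bsub>B\<^esub> (components (LS \<Phi> s t) x \<uplus>\<^bsub>B\<^esub> components (LS \<Phi> s t) y)"
proof -
  have "\<forall>x\<in>Obj A. \<forall>y\<in>Obj A. components (LS \<Phi> s t) (x \<boxplus>\<^bsub>A\<^esub> y) \<cdot>\<^bsub>B\<^esub> LS (lax_add A B (LO \<Phi> s) (LO \<Phi> t)) x y
    = LS (LO \<Phi> (s \<boxplus>\<^bsub>H\<^esub> t)) x y \<cdot>\<^bsub>B\<^esub> (components (LS \<Phi> s t) x \<uplus>\<^bsub>B\<^esub> components (LS \<Phi> s t) y)"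
    using str_value(2)[OF assms(1,2)] unfolding monoidal_nat_def by (elim conjE)
  then have "components (LS \<Phi> s t) (x \<boxplus>\<^bsub>A\<^esub> y) \<cdot>\<^bsub>B\<^esub> LS (lax_add A B (LO \<Phi> s) (LO \<Phi> t)) x y
    = LS (LO \<Phi> (s \<boxplus>\<^bsub>H\<^esub> t)) x y \<cdot>\<^bsub>B\<^esub> (components (LS \<Phi> s t) x \<uplus>\<^bsub>B\<^esub> components (LS \<Phi> s t) y)"
    using assms by blast
  then show ?thesis using assms by (simp add: lax_add_def)
qed

lemma LO_zro: "LO \<Phi> \<zero>p\<^bsub>H\<^esub> = lax_zero A B"
  using lax_functor by (simp add: lax_functor_def perm_hom_def)

lemma str_zro_left [simp]:
  assumes "s \<in> Obj H" "x \<in> Obj A"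
  shows "components (LS \<Phi> s \<zero>p\<^bsub>H\<^esub>) x = Ide B (LO (LO \<Phi> s) x)"
    "components (LS \<Phi> \<zero>p\<^bsub>H\<^esub> s) x = Ide B (LO (LO \<Phi> s) x)"
proof -
  have "\<forall>s\<in>Obj H. LS \<Phi> s \<zero>p\<^bsub>H\<^esub> = Ide (perm_hom A B) (LO \<Phi> s) \<and> LS \<Phi> \<zero>p\<^bsub>H\<^esub> s = Ide (perm_hom A B) (LO \<Phi> s)"
    using lax_functor unfolding lax_functor_def by (elim conjE)
  then show "components (LS \<Phi> s \<zero>p\<^bsub>H\<^esub>) x = Ide B (LO (LO \<Phi> s) x)"
    "components (LS \<Phi> \<zero>p\<^bsub>H\<^esub> s) x = Ide B (LO (LO \<Phi> s) x)"
    using assms by (simp_all add: perm_hom_def)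
qed

lemma str_nat:
  assumes "u \<in> Arr H" "v \<in> Arr H" "x \<in> Obj A"
  shows "components (LS \<Phi> (Cod H u) (Cod H v)) x \<cdot>\<^bsub>B\<^esub> (components (LA \<Phi> u) x \<uplus>\<^bsub>B\<^esub> components (LA \<Phi> v) x)
    = components (LA \<Phi> (u \<uplus>\<^bsub>H\<^esub> v)) x \<cdot>\<^bsub>B\<^esub> components (LS \<Phi> (Dom H u) (Dom H v)) x"
proof -
  let ?P = "perm_hom A B"
  have "\<forall>u\<in>Arr H. \<forall>v\<in>Arr H. LS \<Phi> (Cod H u) (Cod H v) \<cdot>\<^bsub>?P\<^esub> (LA \<Phi> u \<uplus>\<^bsub>?P\<^esub> LA \<Phi> v)
      = LA \<Phi> (u \<uplus>\<^bsub>H\<^esub> v) \<cdot>\<^bsub>?P\<^esub> LS \<Phi> (Dom H u) (Dom H v)"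
    using lax_functor unfolding lax_functor_def by (elim conjE)
  then have "components (LS \<Phi> (Cod H u) (Cod H v) \<cdot>\<^bsub>?P\<^esub> (LA \<Phi> u \<uplus>\<^bsub>?P\<^esub> LA \<Phi> v)) x
      = components (LA \<Phi> (u \<uplus>\<^bsub>H\<^esub> v) \<cdot>\<^bsub>?P\<^esub> LS \<Phi> (Dom H u) (Dom H v)) x"
    using assms by simp
  then show ?thesis using assms by (simp add: perm_hom_def case_prod_unfold)
qed

lemma str_assoc:
  assumes "s \<in> Obj H" "t \<in> Obj H" "r \<in> Obj H" "x \<in> Obj A"
  shows "components (LS \<Phi> s (t \<boxplus>\<^bsub>H\<^esub> r)) x \<cdot>\<^bsub>B\<^esub> (Ide B (LO (LO \<Phi> s) x) \<uplus>\<^bsub>B\<^esub> components (LS \<Phi> t r) x)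
    = components (LS \<Phi> (s \<boxplus>\<^bsub>H\<^esub> t) r) x \<cdot>\<^bsub>B\<^esub> (components (LS \<Phi> s t) x \<uplus>\<^bsub>B\<^esub> Ide B (LO (LO \<Phi> r) x))"
proof -
  let ?P = "perm_hom A B"
  have "\<forall>s\<in>Obj H. \<forall>t\<in>Obj H. \<forall>r\<in>Obj H.
      LS \<Phi> s (t \<boxplus>\<^bsub>H\<^esub> r) \<cdot>\<^bsub>?P\<^esub> (Ide ?P (LO \<Phi> s) \<uplus>\<^bsub>?P\<^esub> LS \<Phi> t r)
      = LS \<Phi> (s \<boxplus>\<^bsub>H\<^esub> t) r \<cdot>\<^bsub>?P\<^esub> (LS \<Phi> s t \<uplus>\<^bsub>?P\<^esub> Ide ?P (LO \<Phi> r))"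
    using lax_functor unfolding lax_functor_def by (elim conjE)
  then have "components (LS \<Phi> s (t \<boxplus>\<^bsub>H\<^esub> r) \<cdot>\<^bsub>?P\<^esub> (Ide ?P (LO \<Phi> s) \<uplus>\<^bsub>?P\<^esub> LS \<Phi> t r)) x
      = components (LS \<Phi> (s \<boxplus>\<^bsub>H\<^esub> t) r \<cdot>\<^bsub>?P\<^esub> (LS \<Phi> s t \<uplus>\<^bsub>?P\<^esub> Ide ?P (LO \<Phi> r))) x"
    using assms by simp
  then show ?thesis using assms by (simp add: perm_hom_def case_prod_unfold)
qed

lemma str_swp:
  assumes "s \<in> Obj H" "t \<in> Obj H" "x \<in> Obj A"
  shows "components (LA \<Phi> (Swp H s t)) x \<cdot>\<^bsub>B\<^esub> components (LS \<Phi> s t) x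
    = components (LS \<Phi> t s) x \<cdot>\<^bsub>B\<^esub> Swp B (LO (LO \<Phi> s) x) (LO (LO \<Phi> t) x)"
proof -
  let ?P = "perm_hom A B"
  have "\<forall>s\<in>Obj H. \<forall>t\<in>Obj H. LA \<Phi> (Swp H s t) \<cdot>\<^bsub>?P\<^esub> LS \<Phi> s t = LS \<Phi> t s \<cdot>\<^bsub>?P\<^esub> Swp ?P (LO \<Phi> s) (LO \<Phi> t)"
    using lax_functor unfolding lax_functor_def by (elim conjE)
  then have "components (LA \<Phi> (Swp H s t) \<cdot>\<^bsub>?P\<^esub> LS \<Phi> s t) x = components (LS \<Phi> t s \<cdot>\<^bsub>?P\<^esub> Swp ?P (LO \<Phi> s) (LO \<Phi> t)) x"
    using assms by simp
  then show ?thesis using assms by (simp add: perm_hom_def case_prod_unfold)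
qed

end

section \<open>Evaluation is bilinear\<close>

context lax_to_perm_hom
begin

text \<open>Linearity in the first variable is the lax structure of \<open>\<Phi>\<close> at x. For
  naturality the constraint passes the components of u and u' by \<open>str_nat\<close>, and then
  the images of w because it is itself a natural transformation.\<close>

lemma ev_left_linear:
  "left_linear H A B (\<lambda>s x. LO (LO \<Phi> s) x) (\<lambda>u w. components (LA \<Phi> u) (Cod A w) \<cdot>\<^bsub>B\<^esub> LA (LO \<Phi> (Dom H u)) w)
    (\<lambda>s x s'. components (LS \<Phi> s s') x)"
proof -
  let ?c = "\<lambda>u. components (LA \<Phi> u)" and ?d = "\<lambda>s t. components (LS \<Phi> s t)"
  have nat: "?d (Cod H u) (Cod H u') (Cod A w) \<cdot>\<^bsub>B\<^esub>
        ((?c u (Cod A w) \<cdot>\<^bsub>B\<^esub> LA (LO \<Phi> (Dom H u)) w) \<uplus>\<^bsub>B\<^esub> (?c u' (Cod A w) \<cdot>\<^bsub>B\<^esub> LA (LO \<Phi> (Dom H u')) w))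
      = ?c (u \<uplus>\<^bsub>H\<^esub> u') (Cod A w) \<cdot>\<^bsub>B\<^esub> LA (LO \<Phi> (Dom H (u \<uplus>\<^bsub>H\<^esub> u'))) w \<cdot>\<^bsub>B\<^esub> ?d (Dom H u) (Dom H u') (Dom A w)"
    (is "?l = ?r") if [simp]: "u \<in> Arr H" "u' \<in> Arr H" "w \<in> Arr A" for u u' w
  proof -
    have "?l = (?d (Cod H u) (Cod H u') (Cod A w) \<cdot>\<^bsub>B\<^esub> (?c u (Cod A w) \<uplus>\<^bsub>B\<^esub> ?c u' (Cod A w)))
        \<cdot>\<^bsub>B\<^esub> (LA (LO \<Phi> (Dom H u)) w \<uplus>\<^bsub>B\<^esub> LA (LO \<Phi> (Dom H u')) w)"
      by (simp add: B.comp_assoc B.addA_comp)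
    also have "\<dots> = ?c (u \<uplus>\<^bsub>H\<^esub> u') (Cod A w) \<cdot>\<^bsub>B\<^esub> (?d (Dom H u) (Dom H u') (Cod A w)
        \<cdot>\<^bsub>B\<^esub> (LA (LO \<Phi> (Dom H u)) w \<uplus>\<^bsub>B\<^esub> LA (LO \<Phi> (Dom H u')) w))"
      by (simp add: str_nat B.comp_assoc)
    also have "\<dots> = ?r"
      by (simp add: str_naturality B.comp_assoc)
    finally show ?thesis .
  qed
  have zro: "LA (lax_zero A B) w = Ide B \<zero>p\<^bsub>B\<^esub>" if "w \<in> Arr A" for w
    using that by (simp add: lax_zero_def)
  have zro': "LO (lax_zero A B) x = \<zero>p\<^bsub>B\<^esub>" if "x \<in> Obj A" for x
    using that by (simp add: lax_zero_def)
  have swp: "?c (Swp H s t) x \<cdot>\<^bsub>B\<^esub> LA (LO \<Phi> (s \<boxplus>\<^bsub>H\<^esub> t)) (Ide A x) \<cdot>\<^bsub>B\<^esub> ?d s t x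
     = ?d t s x \<cdot>\<^bsub>B\<^esub> Swp B (LO (LO \<Phi> s) x) (LO (LO \<Phi> t) x)" if [simp]: "s \<in> Obj H" "t \<in> Obj H" "x \<in> Obj A" for s t x
    using str_swp[OF that] by (simp add: lax_symmetric_monoidal.LA_ide[OF lax_value])
  show ?thesis
    unfolding left_linear_def
    by (intro conjI ballI impI B.homI)
      (auto simp: LO_zro zro zro' arr_ide nat str_assoc swp)
qed

text \<open>Linearity in the second variable is the lax structure of the functors
  \<open>LO \<Phi> s\<close>. Naturality in u holds because the transformation
  \<open>LA \<Phi> u\<close> is monoidal. At the zero object of H the value is
  \<open>lax_zero\<close>, whose structure morphisms are identities of zero.\<close>

lemma ev_right_linear:
  "left_linear A H B (\<lambda>x s. LO (LO \<Phi> s) x) (\<lambda>w u. components (LA \<Phi> u) (Cod A w) \<cdot>\<^bsub>B\<^esub> LA (LO \<Phi> (Dom H u)) w)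
    (\<lambda>x s x'. LS (LO \<Phi> s) x x')"
proof -
  let ?c = "\<lambda>u. components (LA \<Phi> u)"
  note lax = lax_symmetric_monoidal.LA_ide[OF lax_value] lax_symmetric_monoidal.LS_nat[OF lax_value]
    lax_symmetric_monoidal.LS_assoc[OF lax_value] lax_symmetric_monoidal.LS_swp[OF lax_value]
  have nat: "LS (LO \<Phi> (Cod H u)) (Cod A w) (Cod A w') \<cdot>\<^bsub>B\<^esub>
        ((?c u (Cod A w) \<cdot>\<^bsub>B\<^esub> LA (LO \<Phi> (Dom H u)) w) \<uplus>\<^bsub>B\<^esub> (?c u (Cod A w') \<cdot>\<^bsub>B\<^esub> LA (LO \<Phi> (Dom H u)) w'))
      = ?c u (Cod A (w \<uplus>\<^bsub>A\<^esub> w')) \<cdot>\<^bsub>B\<^esub> LA (LO \<Phi> (Dom H u)) (w \<uplus>\<^bsub>A\<^esub> w') \<cdot>\<^bsub>B\<^esub> LS (LO \<Phi> (Dom H u)) (Dom A w) (Dom A w')"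
    (is "?l = ?r") if [simp]: "u \<in> Arr H" "w' \<in> Arr A" "w \<in> Arr A" for u w w'
  proof -
    have "?l = (LS (LO \<Phi> (Cod H u)) (Cod A w) (Cod A w') \<cdot>\<^bsub>B\<^esub> (?c u (Cod A w) \<uplus>\<^bsub>B\<^esub> ?c u (Cod A w')))
        \<cdot>\<^bsub>B\<^esub> (LA (LO \<Phi> (Dom H u)) w \<uplus>\<^bsub>B\<^esub> LA (LO \<Phi> (Dom H u)) w')"
      by (simp add: B.comp_assoc B.addA_comp)
    also have "\<dots> = ?c u (Cod A (w \<uplus>\<^bsub>A\<^esub> w')) \<cdot>\<^bsub>B\<^esub> (LS (LO \<Phi> (Dom H u)) (Cod A w) (Cod A w')
        \<cdot>\<^bsub>B\<^esub> (LA (LO \<Phi> (Dom H u)) w \<uplus>\<^bsub>B\<^esub> LA (LO \<Phi> (Dom H u)) w'))"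
      by (simp add: B.comp_assoc flip: arr_monoidal)
    also have "\<dots> = ?r"
      by (simp add: lax B.comp_assoc)
    finally show ?thesis .
  qed
  have zro: "LA (LO \<Phi> s) (Ide A \<zero>p\<^bsub>A\<^esub>) = Ide B \<zero>p\<^bsub>B\<^esub>" if "s \<in> Obj H" for s
    using that by (simp add: lax)
  have zro': "LO (lax_zero A B) x = \<zero>p\<^bsub>B\<^esub>" "LS (lax_zero A B) x y = Ide B \<zero>p\<^bsub>B\<^esub>" if "x \<in> Obj A" "y \<in> Obj A" for x y
    using that by (simp_all add: lax_zero_def)
  show ?thesis
    unfolding left_linear_def
    by (intro conjI ballI impI B.homI)
      (auto simp: LO_zro zro zro' arr_ide nat lax(3,4))
qed

text \<open>On the given hom spaces the codomain of w is y and the domain of u is s, so the formula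
  is composition in B applied to two continuous maps. Taking the component at y is continuous
  because transformations carry the topology pulled back from the product.\<close>

lemma ev_continuous:
  assumes [simp]: "s \<in> Obj H" "x \<in> Obj A" "t \<in> Obj H" "y \<in> Obj A"
  shows "continuous_map (prod_topology (HTop H s t) (HTop A x y)) (HTop B (LO (LO \<Phi> s) x) (LO (LO \<Phi> t) y))
    (\<lambda>(u, w). components (LA \<Phi> u) (Cod A w) \<cdot>\<^bsub>B\<^esub> LA (LO \<Phi> (Dom H u)) w)"
proof -
  let ?F = "LO \<Phi> s" and ?G = "LO \<Phi> t"
  let ?T = "product_topology (\<lambda>x. HTop B (LO ?F x) (LO ?G x)) (Obj A)"
  have "continuous_map (HTop H s t) (HTop (perm_hom A B) ?F ?G) (LA \<Phi>)"
  proof -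
    have "\<forall>s\<in>Obj H. \<forall>t\<in>Obj H. continuous_map (HTop H s t) (HTop (perm_hom A B) (LO \<Phi> s) (LO \<Phi> t)) (LA \<Phi>)"
      using lax_functor unfolding lax_functor_def by (elim conjE)
    then show ?thesis by simp
  qed
  moreover have "continuous_map (HTop (perm_hom A B) ?F ?G) ?T (\<lambda>(_, \<eta>, _). \<eta>)"
    unfolding perm_hom_def by simp (intro continuous_map_pullback[where g = id, simplified] continuous_map_id)
  ultimately have "continuous_map (HTop H s t) ?T ((\<lambda>(_, \<eta>, _). \<eta>) \<circ> LA \<Phi>)"
    by (rule continuous_map_compose)
  from continuous_map_compose[OF this continuous_map_product_projection[of y]]
  have "continuous_map (HTop H s t) (HTop B (LO ?F y) (LO ?G y)) (\<lambda>u. components (LA \<Phi> u) y)"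
    by (simp add: comp_def case_prod_unfold)
  note evaluate = continuous_map_compose[OF continuous_map_fst this, unfolded comp_def]
  have "continuous_map (HTop A x y) (HTop B (LO ?F x) (LO ?F y)) (LA ?F)"
    by (rule lax_symmetric_monoidal.continuous_LA[OF lax_value]) simp_all
  note apply_F = continuous_map_compose[OF continuous_map_snd this, unfolded comp_def]
  have "continuous_map (prod_topology (HTop H s t) (HTop A x y))
      (prod_topology (HTop B (LO ?F y) (LO ?G y)) (HTop B (LO ?F x) (LO ?F y)))
      (\<lambda>p. (components (LA \<Phi> (fst p)) y, LA ?F (snd p)))"
    by (intro continuous_map_pairedI evaluate apply_F)
  from continuous_map_compose[OF this B.continuous_comp]
  have "continuous_map (prod_topology (HTop H s t) (HTop A x y)) (HTop B (LO ?F x) (LO ?G y))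
      (\<lambda>p. components (LA \<Phi> (fst p)) y \<cdot>\<^bsub>B\<^esub> LA ?F (snd p))"
    by (simp add: comp_def)
  then show ?thesis
    by (rule continuous_map_eq) (auto simp: H.topspace_hom A.topspace_hom homset_def)
qed

text \<open>The naturality square of u at w' exchanges the two middle factors.\<close>

lemma ev_comp:
  assumes [simp]: "u \<in> Arr H" "u' \<in> Arr H" "w \<in> Arr A" "w' \<in> Arr A" "Cod H u = Dom H u'" "Cod A w = Dom A w'"
  shows "components (LA \<Phi> (u' \<cdot>\<^bsub>H\<^esub> u)) (Cod A w') \<cdot>\<^bsub>B\<^esub> LA (LO \<Phi> (Dom H u)) (w' \<cdot>\<^bsub>A\<^esub> w)
    = (components (LA \<Phi> u') (Cod A w') \<cdot>\<^bsub>B\<^esub> LA (LO \<Phi> (Dom H u')) w')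
      \<cdot>\<^bsub>B\<^esub> (components (LA \<Phi> u) (Dom A w') \<cdot>\<^bsub>B\<^esub> LA (LO \<Phi> (Dom H u)) w)"
    (is "?l = ?r")
proof -
  have "?l = components (LA \<Phi> u') (Cod A w') \<cdot>\<^bsub>B\<^esub>
      ((components (LA \<Phi> u) (Cod A w') \<cdot>\<^bsub>B\<^esub> LA (LO \<Phi> (Dom H u)) w') \<cdot>\<^bsub>B\<^esub> LA (LO \<Phi> (Dom H u)) w)"
    by (simp add: arr_comp lax_symmetric_monoidal.LA_comp[OF lax_value] B.comp_assoc)
  also have "\<dots> = ?r"
    by (simp add: arr_naturality[of u w' "Cod A w'"] B.comp_assoc)
  finally show ?thesis .
qed

lemma ev_bilinear:
  "bilinear H A B (\<lambda>s x. LO (LO \<Phi> s) x) (\<lambda>u w. components (LA \<Phi> u) (Cod A w) \<cdot>\<^bsub>B\<^esub> LA (LO \<Phi> (Dom H u)) w)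
    (\<lambda>s x s'. components (LS \<Phi> s s') x) (\<lambda>s x x'. LS (LO \<Phi> s) x x')"
  unfolding bilinear_def
proof (intro conjI ballI impI ev_left_linear ev_right_linear ev_continuous)
  fix s x s' x' assume [simp]: "s \<in> Obj H" "x \<in> Obj A" "s' \<in> Obj H" "x' \<in> Obj A"
  show "LS (LO \<Phi> (s \<boxplus>\<^bsub>H\<^esub> s')) x x' \<cdot>\<^bsub>B\<^esub> (components (LS \<Phi> s s') x \<uplus>\<^bsub>B\<^esub> components (LS \<Phi> s s') x')
    = components (LS \<Phi> s s') (x \<boxplus>\<^bsub>A\<^esub> x') \<cdot>\<^bsub>B\<^esub> (LS (LO \<Phi> s) x x' \<uplus>\<^bsub>B\<^esub> LS (LO \<Phi> s') x x') \<cdot>\<^bsub>B\<^esub>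
      (Ide B (LO (LO \<Phi> s) x) \<uplus>\<^bsub>B\<^esub> Swp B (LO (LO \<Phi> s') x) (LO (LO \<Phi> s) x') \<uplus>\<^bsub>B\<^esub> Ide B (LO (LO \<Phi> s') x'))"
    by (subst B.comp_assoc) (simp_all add: str_monoidal B.add_assoc)
qed (auto simp: arr_ide ev_comp lax_symmetric_monoidal.LA_ide[OF lax_value] intro!: B.homI)

lemma multilinear_perm_eval: "multilinear [H, A] B (perm_eval H A B \<Phi>)"
  using multilinear_mk_mfun_pair[OF H.permutative A.permutative B.permutative ev_bilinear]
  by (simp add: perm_eval_def)

end

section \<open>Composition in Perm evaluated at an object\<close>

lemma perm_hom_comp_component:
  "x \<in> Obj A \<Longrightarrow> components (v \<cdot>\<^bsub>perm_hom A B\<^esub> u) x = components v x \<cdot>\<^bsub>B\<^esub> components u x"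
  by (simp add: perm_hom_def case_prod_unfold)

lemma perm_hom_ide_components [simp]:
  "fst (Ide (perm_hom A B) f) = f" "snd (snd (Ide (perm_hom A B) f)) = f"
  "x \<in> Obj A \<Longrightarrow> components (Ide (perm_hom A B) f) x = Ide B (LO f x)"
  by (simp_all add: perm_hom_def)

lemma perm_hom_obj: "f \<in> Obj (perm_hom A B) \<longleftrightarrow> lax_functor A B f"
  by (simp add: perm_hom_def)

lemma perm_hom_arr:
  "u \<in> Arr (perm_hom A B) \<longleftrightarrow> lax_functor A B (fst u) \<and> lax_functor A B (snd (snd u)) \<and>
    monoidal_nat A B (fst u) (snd (snd u)) (components u)"
  by (auto simp: perm_hom_def)

lemma perm_comp_MO:
  "lax_functor B C g \<Longrightarrow> lax_functor A B f \<Longrightarrow> MO (perm_comp A B C) [g, f] = lax_comp A C g f"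
  by (simp add: perm_comp_def perm_hom_obj)

lemma perm_comp_MA_component:
  assumes "v \<in> Arr (perm_hom B C)" "u \<in> Arr (perm_hom A B)" "x \<in> Obj A"
  shows "components (MA (perm_comp A B C) [v, u]) x
    = components v (LO (snd (snd u)) x) \<cdot>\<^bsub>C\<^esub> LA (fst v) (components u x)"
  using assms by (simp add: perm_comp_def case_prod_unfold)

lemma perm_comp_MD_component:
  assumes "lax_functor B C g" "lax_functor A B f" "x \<in> Obj A"
  shows "lax_functor B C g' \<Longrightarrow> LO f x \<in> Obj B \<Longrightarrow>
      components (MD (perm_comp A B C) 0 [g, f] g') x = Ide C (LO g (LO f x) \<boxplus>\<^bsub>C\<^esub> LO g' (LO f x))"
    and "lax_functor A B f' \<Longrightarrow> components (MD (perm_comp A B C) (Suc 0) [g, f] f') x = LS g (LO f x) (LO f' x)"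
  using assms by (simp_all add: perm_comp_def perm_hom_obj perm_hom_def lax_comp_def lax_add_def)

lemma lax_comp_simps [simp]:
  "x \<in> Obj A \<Longrightarrow> LO (lax_comp A C g f) x = LO g (LO f x)"
  "u \<in> Arr A \<Longrightarrow> LA (lax_comp A C g f) u = LA g (LA f u)"
  "x \<in> Obj A \<Longrightarrow> y \<in> Obj A \<Longrightarrow> LS (lax_comp A C g f) x y = LA g (LS f x y) \<cdot>\<^bsub>C\<^esub> LS g (LO f x) (LO f y)"
  by (simp_all add: lax_comp_def)

lemma lax_id_simps [simp]:
  "x \<in> Obj A \<Longrightarrow> LO (lax_id A) x = x"
  "u \<in> Arr A \<Longrightarrow> LA (lax_id A) u = u"
  "x \<in> Obj A \<Longrightarrow> y \<in> Obj A \<Longrightarrow> LS (lax_id A) x y = Ide A (x \<boxplus>\<^bsub>A\<^esub> y)"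
  by (simp_all add: lax_id_def)

lemma unary_simps [simp]:
  "x \<in> Obj A \<Longrightarrow> MO (unary A f) [x] = LO f x"
  "u \<in> Arr A \<Longrightarrow> MA (unary A f) [u] = LA f u"
  "x \<in> Obj A \<Longrightarrow> y \<in> Obj A \<Longrightarrow> MD (unary A f) 0 [x] y = LS f x y"
  by (simp_all add: unary_def)

lemma point_simps [simp]: "MO (point B x) [] = x" "MA (point B x) [] = Ide B x"
  by (simp_all add: point_def)

lemma perm_eval_simps [simp]:
  assumes "s \<in> Obj H" "x \<in> Obj A"
  shows "MO (perm_eval H A B \<Phi>) [s, x] = LO (LO \<Phi> s) x"
    "t \<in> Obj H \<Longrightarrow> MD (perm_eval H A B \<Phi>) 0 [s, x] t = components (LS \<Phi> s t) x"
    "y \<in> Obj A \<Longrightarrow> MD (perm_eval H A B \<Phi>) (Suc 0) [s, x] y = LS (LO \<Phi> s) x y"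
  using assms by (simp_all add: perm_eval_def)

lemma perm_eval_MA [simp]:
  assumes "u \<in> Arr H" "w \<in> Arr A"
  shows "MA (perm_eval H A B \<Phi>) [u, w] = components (LA \<Phi> u) (Cod A w) \<cdot>\<^bsub>B\<^esub> LA (LO \<Phi> (Dom H u)) w"
  using assms by (simp add: perm_eval_def)

context lax_to_perm_hom
begin

lemma lax_functor_value: "s \<in> Obj H \<Longrightarrow> lax_functor A B (LO \<Phi> s)"
  using lax_symmetric_monoidal.lax_functor[OF lax_value] .

lemma arr_in_perm_hom: "u \<in> Arr H \<Longrightarrow> LA \<Phi> u \<in> Arr (perm_hom A B)"
  by (subst arr_value(1), assumption) (simp add: perm_hom_arr lax_functor_value arr_value(2))

lemma arr_ends [simp]:
  assumes "u \<in> Arr H"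
  shows "fst (LA \<Phi> u) = LO \<Phi> (Dom H u)" "snd (snd (LA \<Phi> u)) = LO \<Phi> (Cod H u)"
  using arr_value(1)[OF assms] by (metis fst_conv snd_conv)+

end

context lax_to_perm_hom
begin

lemma str_in_perm_hom: "s \<in> Obj H \<Longrightarrow> t \<in> Obj H \<Longrightarrow> LS \<Phi> s t \<in> Arr (perm_hom A B)"
proof -
  assume st: "s \<in> Obj H" "t \<in> Obj H"
  have "\<forall>s\<in>Obj H. \<forall>t\<in>Obj H. LS \<Phi> s t \<in> homset (perm_hom A B) (LO \<Phi> s \<boxplus>\<^bsub>perm_hom A B\<^esub> LO \<Phi> t) (LO \<Phi> (s \<boxplus>\<^bsub>H\<^esub> t))"
    using lax_functor unfolding lax_functor_def by (elim conjE)
  then show ?thesis using st by (auto simp: homset_def)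
qed

lemma str_ends:
  assumes "s \<in> Obj H" "t \<in> Obj H"
  shows "fst (LS \<Phi> s t) = lax_add A B (LO \<Phi> s) (LO \<Phi> t)" "snd (snd (LS \<Phi> s t)) = LO \<Phi> (s \<boxplus>\<^bsub>H\<^esub> t)"
  using str_value(1)[OF assms] by (metis fst_conv snd_conv)+

text \<open>The identity on a value of \<open>\<Phi>\<close> is the image of an identity of H, so no
  monoidality has to be checked by hand.\<close>

lemma ide_in_perm_hom:
  assumes "s \<in> Obj H"
  shows "Ide (perm_hom A B) (LO \<Phi> s) \<in> Arr (perm_hom A B)"
proof -
  have "LA \<Phi> (Ide H s) = Ide (perm_hom A B) (LO \<Phi> s)"
    using lax_functor assms unfolding lax_functor_def is_functor_def by (elim conjE) blast
  then show ?thesis using arr_in_perm_hom[of "Ide H s"] assms by simp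
qed

end

section \<open>The composition axiom of a PC-functor as an equation of trilinear functors\<close>

locale perm_composition =
  P: lax_to_perm_hom H A B \<Phi> + Q: lax_to_perm_hom K B C \<Psi> + R: lax_to_perm_hom L A C \<Theta>
  for H K L A B C :: "('o, 'a) permcat" and \<Phi> \<Psi> \<Theta> +
  fixes c :: "('o, 'a, 'o, 'a) mfun"
  assumes comp: "multilinear [K, H] L c"
    and eq: "mcomp [[K, H]] [L] (perm_hom A C) (unary L \<Theta>) [c]
      = mcomp [[K], [H]] [perm_hom B C, perm_hom A B] (perm_hom A C) (perm_comp A B C) [unary K \<Psi>, unary H \<Phi>]"
begin

lemma comp_bilinear:
  "bilinear K H L (\<lambda>x y. MO c [x, y]) (\<lambda>u v. MA c [u, v]) (\<lambda>x y. MD c 0 [x, y]) (\<lambda>x y. MD c (Suc 0) [x, y])"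
  using multilinear_pair_iff[THEN iffD1, OF Q.H.permutative P.H.permutative R.H.permutative comp] by blast

lemma comp_obj [simp]: "t \<in> Obj K \<Longrightarrow> s \<in> Obj H \<Longrightarrow> MO c [t, s] \<in> Obj L"
proof -
  have "\<forall>t\<in>Obj K. \<forall>s\<in>Obj H. MO c [t, s] \<in> Obj L"
    using comp_bilinear unfolding bilinear_def by (elim conjE)
  then show "t \<in> Obj K \<Longrightarrow> s \<in> Obj H \<Longrightarrow> MO c [t, s] \<in> Obj L" by blast
qed

lemma comp_arr [simp]:
  assumes "v \<in> Arr K" "u \<in> Arr H"
  shows "MA c [v, u] \<in> Arr L" "Dom L (MA c [v, u]) = MO c [Dom K v, Dom H u]" "Cod L (MA c [v, u]) = MO c [Cod K v, Cod H u]"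
proof -
  have "\<forall>v\<in>Arr K. \<forall>u\<in>Arr H.
      MA c [v, u] \<in> homset L (MO c [Dom K v, Dom H u]) (MO c [Cod K v, Cod H u])"
    using comp_bilinear unfolding bilinear_def by (elim conjE)
  then show "MA c [v, u] \<in> Arr L" "Dom L (MA c [v, u]) = MO c [Dom K v, Dom H u]"
    "Cod L (MA c [v, u]) = MO c [Cod K v, Cod H u]"
    using assms by (auto simp: homset_def)
qed

lemma comp_constraints [simp]:
  assumes "t \<in> Obj K" "s \<in> Obj H"
  shows "t' \<in> Obj K \<Longrightarrow> MD c 0 [t, s] t' \<in> Arr L"
    "t' \<in> Obj K \<Longrightarrow> Dom L (MD c 0 [t, s] t') = MO c [t, s] \<boxplus>\<^bsub>L\<^esub> MO c [t', s]"
    "t' \<in> Obj K \<Longrightarrow> Cod L (MD c 0 [t, s] t') = MO c [t \<boxplus>\<^bsub>K\<^esub> t', s]"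
    "s' \<in> Obj H \<Longrightarrow> MD c (Suc 0) [t, s] s' \<in> Arr L"
    "s' \<in> Obj H \<Longrightarrow> Dom L (MD c (Suc 0) [t, s] s') = MO c [t, s] \<boxplus>\<^bsub>L\<^esub> MO c [t, s']"
    "s' \<in> Obj H \<Longrightarrow> Cod L (MD c (Suc 0) [t, s] s') = MO c [t, s \<boxplus>\<^bsub>H\<^esub> s']"
proof -
  have "\<forall>t\<in>Obj K. \<forall>s\<in>Obj H. \<forall>t'\<in>Obj K.
      MD c 0 [t, s] t' \<in> homset L (MO c [t, s] \<boxplus>\<^bsub>L\<^esub> MO c [t', s]) (MO c [t \<boxplus>\<^bsub>K\<^esub> t', s])"
    "\<forall>s\<in>Obj H. \<forall>t\<in>Obj K. \<forall>s'\<in>Obj H.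
      MD c (Suc 0) [t, s] s' \<in> homset L (MO c [t, s] \<boxplus>\<^bsub>L\<^esub> MO c [t, s']) (MO c [t, s \<boxplus>\<^bsub>H\<^esub> s'])"
    using comp_bilinear unfolding bilinear_def left_linear_def by - (elim conjE, assumption)+
  then show "t' \<in> Obj K \<Longrightarrow> MD c 0 [t, s] t' \<in> Arr L"
    "t' \<in> Obj K \<Longrightarrow> Dom L (MD c 0 [t, s] t') = MO c [t, s] \<boxplus>\<^bsub>L\<^esub> MO c [t', s]"
    "t' \<in> Obj K \<Longrightarrow> Cod L (MD c 0 [t, s] t') = MO c [t \<boxplus>\<^bsub>K\<^esub> t', s]"
    "s' \<in> Obj H \<Longrightarrow> MD c (Suc 0) [t, s] s' \<in> Arr L"
    "s' \<in> Obj H \<Longrightarrow> Dom L (MD c (Suc 0) [t, s] s') = MO c [t, s] \<boxplus>\<^bsub>L\<^esub> MO c [t, s']"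
    "s' \<in> Obj H \<Longrightarrow> Cod L (MD c (Suc 0) [t, s] s') = MO c [t, s \<boxplus>\<^bsub>H\<^esub> s']"
    using assms by (auto simp: homset_def)
qed

lemma comp_value:
  assumes "t \<in> Obj K" "s \<in> Obj H"
  shows "LO \<Theta> (MO c [t, s]) = lax_comp A C (LO \<Psi> t) (LO \<Phi> s)"
proof -
  have "LO \<Theta> (MO c [t, s]) = MO (mcomp [[K, H]] [L] (perm_hom A C) (unary L \<Theta>) [c]) [t, s]"
    using assms by (simp add: mcomp_def)
  also have "\<dots> = lax_comp A C (LO \<Psi> t) (LO \<Phi> s)" unfolding eq
    using assms by (simp add: mcomp_def perm_comp_MO P.lax_functor_value Q.lax_functor_value)
  finally show ?thesis .
qed

lemma comp_arr_value:
  assumes "v \<in> Arr K" "u \<in> Arr H" "x \<in> Obj A"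
  shows "components (LA \<Theta> (MA c [v, u])) x
    = components (LA \<Psi> v) (LO (LO \<Phi> (Cod H u)) x) \<cdot>\<^bsub>C\<^esub> LA (LO \<Psi> (Dom K v)) (components (LA \<Phi> u) x)"
proof -
  have "LA \<Theta> (MA c [v, u]) = MA (mcomp [[K, H]] [L] (perm_hom A C) (unary L \<Theta>) [c]) [v, u]"
    using assms by (simp add: mcomp_def)
  also have "\<dots> = MA (perm_comp A B C) [LA \<Psi> v, LA \<Phi> u]" unfolding eq
    using assms by (simp add: mcomp_def)
  finally show ?thesis
    using assms by (simp add: perm_comp_MA_component P.arr_in_perm_hom Q.arr_in_perm_hom)
qed

text \<open>Comparison of the first constraints on the two sides of \<open>eq\<close>. Composition
  in Perm is strictly additive in its first variable, and \<open>LO \<Phi> s\<close> enters through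
  its identity transformation; hence a single component of the structure morphism of
  \<open>\<Psi>\<close> remains.\<close>

lemma comp_str_left:
  assumes [simp]: "t \<in> Obj K" "s \<in> Obj H" "t' \<in> Obj K" "x \<in> Obj A"
  shows "components (LA \<Theta> (MD c 0 [t, s] t')) x \<cdot>\<^bsub>C\<^esub> components (LS \<Theta> (MO c [t, s]) (MO c [t', s])) x
    = components (LS \<Psi> t t') (LO (LO \<Phi> s) x)"
proof -
  let ?P = "perm_hom A C"
  have "LA \<Theta> (MD c 0 [t, s] t') \<cdot>\<^bsub>?P\<^esub> LS \<Theta> (MO c [t, s]) (MO c [t', s])
      = MD (mcomp [[K, H]] [L] (perm_hom A C) (unary L \<Theta>) [c]) 0 [t, s] t'"
    by (simp add: mcomp_def Let_def)
  also have "\<dots> = MA (perm_comp A B C) [LS \<Psi> t t', Ide (perm_hom A B) (LO \<Phi> s)]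
      \<cdot>\<^bsub>?P\<^esub> MD (perm_comp A B C) 0 [LO \<Psi> t, LO \<Phi> s] (LO \<Psi> t')" unfolding eq
    by (simp add: mcomp_def Let_def)
  finally have "components (LA \<Theta> (MD c 0 [t, s] t')) x \<cdot>\<^bsub>C\<^esub> components (LS \<Theta> (MO c [t, s]) (MO c [t', s])) x
    = components (MA (perm_comp A B C) [LS \<Psi> t t', Ide (perm_hom A B) (LO \<Phi> s)]) x
      \<cdot>\<^bsub>C\<^esub> components (MD (perm_comp A B C) 0 [LO \<Psi> t, LO \<Phi> s] (LO \<Psi> t')) x"
    by (simp only: perm_hom_comp_component[OF assms(4), symmetric])
  also have "components (MA (perm_comp A B C) [LS \<Psi> t t', Ide (perm_hom A B) (LO \<Phi> s)]) x
      = components (LS \<Psi> t t') (LO (LO \<Phi> s) x)"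
    by (subst perm_comp_MA_component)
      (simp_all add: Q.str_in_perm_hom P.ide_in_perm_hom Q.str_ends
        lax_add_def lax_symmetric_monoidal.LA_ide[OF Q.lax_value])
  also have "components (MD (perm_comp A B C) 0 [LO \<Psi> t, LO \<Phi> s] (LO \<Psi> t')) x
      = Ide C (LO (LO \<Psi> t) (LO (LO \<Phi> s) x) \<boxplus>\<^bsub>C\<^esub> LO (LO \<Psi> t') (LO (LO \<Phi> s) x))"
    by (rule perm_comp_MD_component(1)) (simp_all add: P.lax_functor_value Q.lax_functor_value)
  finally show ?thesis by simp
qed

text \<open>Comparison of the second constraints. Here composition in Perm contributes the structure
  morphism of the outer functor \<open>LO \<Psi> t\<close>, which gives the last factor.\<close>

lemma comp_str_right:
  assumes [simp]: "t \<in> Obj K" "s \<in> Obj H" "s' \<in> Obj H" "x \<in> Obj A"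
  shows "components (LA \<Theta> (MD c (Suc 0) [t, s] s')) x \<cdot>\<^bsub>C\<^esub> components (LS \<Theta> (MO c [t, s]) (MO c [t, s'])) x
    = LA (LO \<Psi> t) (components (LS \<Phi> s s') x) \<cdot>\<^bsub>C\<^esub> LS (LO \<Psi> t) (LO (LO \<Phi> s) x) (LO (LO \<Phi> s') x)"
proof -
  let ?P = "perm_hom A C"
  have "LA \<Theta> (MD c (Suc 0) [t, s] s') \<cdot>\<^bsub>?P\<^esub> LS \<Theta> (MO c [t, s]) (MO c [t, s'])
      = MD (mcomp [[K, H]] [L] (perm_hom A C) (unary L \<Theta>) [c]) (Suc 0) [t, s] s'"
    by (simp add: mcomp_def Let_def)
  also have "\<dots> = MA (perm_comp A B C) [Ide (perm_hom B C) (LO \<Psi> t), LS \<Phi> s s']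
      \<cdot>\<^bsub>?P\<^esub> MD (perm_comp A B C) (Suc 0) [LO \<Psi> t, LO \<Phi> s] (LO \<Phi> s')" unfolding eq
    by (simp add: mcomp_def Let_def)
  finally have "components (LA \<Theta> (MD c (Suc 0) [t, s] s')) x \<cdot>\<^bsub>C\<^esub> components (LS \<Theta> (MO c [t, s]) (MO c [t, s'])) x
    = components (MA (perm_comp A B C) [Ide (perm_hom B C) (LO \<Psi> t), LS \<Phi> s s']) x
      \<cdot>\<^bsub>C\<^esub> components (MD (perm_comp A B C) (Suc 0) [LO \<Psi> t, LO \<Phi> s] (LO \<Phi> s')) x"
    by (simp only: perm_hom_comp_component[OF assms(4), symmetric])
  also have "components (MA (perm_comp A B C) [Ide (perm_hom B C) (LO \<Psi> t), LS \<Phi> s s']) x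
      = LA (LO \<Psi> t) (components (LS \<Phi> s s') x)"
    by (subst perm_comp_MA_component)
      (simp_all add: P.str_in_perm_hom Q.ide_in_perm_hom P.str_ends)
  also have "components (MD (perm_comp A B C) (Suc 0) [LO \<Psi> t, LO \<Phi> s] (LO \<Phi> s')) x
      = LS (LO \<Psi> t) (LO (LO \<Phi> s) x) (LO (LO \<Phi> s') x)"
    by (rule perm_comp_MD_component(2)) (simp_all add: P.lax_functor_value Q.lax_functor_value)
  finally show ?thesis .
qed

end

lemma obj_tuples_iff:
  "xs \<in> obj_tuples [] \<longleftrightarrow> xs = []"
  "xs \<in> obj_tuples (A # As) \<longleftrightarrow> (\<exists>x ys. xs = x # ys \<and> x \<in> Obj A \<and> ys \<in> obj_tuples As)"
  by (auto simp: obj_tuples_def list_all2_Cons2)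

lemma arr_tuples_iff:
  "us \<in> arr_tuples [] \<longleftrightarrow> us = []"
  "us \<in> arr_tuples (A # As) \<longleftrightarrow> (\<exists>u vs. us = u # vs \<and> u \<in> Arr A \<and> vs \<in> arr_tuples As)"
  by (auto simp: arr_tuples_def list_all2_Cons2)

context perm_composition
begin

text \<open>Acting by a composite is acting twice. Objects and arrows agree by
  \<open>comp_value\<close> and \<open>comp_arr_value\<close>; the constraints in the two hom
  variables are \<open>comp_str_left\<close> and \<open>comp_str_right\<close>, and the constraint
  in A is the structure morphism of a composite of lax functors.\<close>

lemma perm_eval_comp:
  "mcomp [[K, H], [A]] [L, A] C (perm_eval L A C \<Theta>) [c, unary A (lax_id A)]
   = mcomp [[K], [H, A]] [K, B] C (perm_eval K B C \<Psi>) [unary K (lax_id K), perm_eval H A B \<Phi>]"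
  (is "?l = ?r")
proof -
  note lax = lax_symmetric_monoidal.LA_ide[OF P.lax_value] lax_symmetric_monoidal.LA_ide[OF Q.lax_value]
    lax_symmetric_monoidal.LA_comp[OF Q.lax_value]
  note R_LA_ide = lax_symmetric_monoidal.LA_ide[OF R.lax_value]
  show ?thesis
    unfolding mcomp_def Let_def concat.simps append.simps list.map
  proof (rule mk_mfun_cong, goal_cases)
    case (1 xs)
    then show ?case by (auto simp: obj_tuples_iff comp_value)
  next
    case (2 us)
    then obtain v u w where us: "us = [v, u, w]" and [simp]: "v \<in> Arr K" "u \<in> Arr H" "w \<in> Arr A"
      by (auto simp: arr_tuples_iff)
    show ?case
      by (simp add: us comp_arr_value comp_value lax Q.B.comp_assoc)
  next
    case (3 i xs y)
    then obtain t s x where xs: "xs = [t, s, x]" and [simp]: "t \<in> Obj K" "s \<in> Obj H" "x \<in> Obj A"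
      by (auto simp: obj_tuples_iff)
    \<comment> \<open>Position 1 is the second variable of c in the left-hand composite but the
      first variable of the inner evaluation in the right-hand one; position 2 is the variable in
      A.\<close>
    from 3(1) consider "i = 0" | "i = Suc 0" | "i = Suc (Suc 0)" by force
    then show ?case
    proof cases
      case 1
      with 3 have [simp]: "y \<in> Obj K" by simp
      show ?thesis
        using comp_str_left[of t s y x] by (simp add: 1 xs lax R_LA_ide Q.arr_ide)
    next
      case 2
      with 3 have [simp]: "y \<in> Obj H" by simp
      show ?thesis
        using comp_str_right[of t s y x] by (simp add: 2 xs lax R_LA_ide Q.arr_ide)
    next
      case 3
      with \<open>y \<in> _\<close> have [simp]: "y \<in> Obj A" by simp
      show ?thesis
        by (simp add: 3 xs lax R.arr_ide Q.arr_ide comp_value)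
    qed
  qed
qed

end

text \<open>An object e that acts as the identity functor turns evaluation into the identity once
  the first variable is fixed at e. The premise \<open>B = A\<close> is there because the locale
  carries two separate parameters.\<close>

lemma (in lax_to_perm_hom) perm_eval_ide:
  assumes [simp]: "B = A" "e \<in> Obj H" "LO \<Phi> e = lax_id A"
  shows "mcomp [[], [A]] [H, A] A (perm_eval H A A \<Phi>) [point H e, unary A (lax_id A)] = unary A (lax_id A)"
proof -
  have [simp]: "components (LA \<Phi> (Ide H e)) x = Ide A x" if "x \<in> Obj A" for x
    using arr_ide[of e x] that by simp
  show ?thesis
    unfolding mcomp_def Let_def unary_def[of A "lax_id A"] concat.simps append.simps list.map
    by (rule mk_mfun_cong) (auto simp: obj_tuples_iff arr_tuples_iff simp flip: unary_def)
qed

text \<open>Transformations are composed by composing lax functors in Perm; this rewrites that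
  composite as one in the multicategory, where K preserves it.\<close>

lemma unary_lax_comp:
  assumes "lax_functor A B f"
  shows "unary A (lax_comp A C g f) = mcomp [[A]] [B] C (unary B g) [unary A f]"
proof -
  have fo: "LO f x \<in> Obj B" if "x \<in> Obj A" for x
    using assms that by (simp add: lax_functor_def is_functor_def)
  have fa: "LA f u \<in> Arr B" if "u \<in> Arr A" for u
    using assms that by (simp add: lax_functor_def is_functor_def homset_def)
  have fs: "LS f x y \<in> Arr B" if "x \<in> Obj A" "y \<in> Obj A" for x y
    using assms that by (simp add: lax_functor_def homset_def)
  show ?thesis
    unfolding mcomp_def Let_def unary_def[of A "lax_comp A C g f"] concat.simps append.simps list.map
    by (rule mk_mfun_cong) (auto simp: obj_tuples_iff arr_tuples_iff fo fa fs)
qed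

section \<open>The naturality axiom as an equation of bilinear functors\<close>

locale perm_naturality =
  P: lax_to_perm_hom H A B \<Phi> + Q: lax_to_perm_hom H A' B' \<Psi> +
  a: lax_symmetric_monoidal A A' a + b: lax_symmetric_monoidal B B' b
  for H A B A' B' :: "('o, 'a) permcat" and \<Phi> \<Psi> and a b :: "('o, 'a) lax" +
  assumes eq: "mcomp [[H], []] [perm_hom A' B', perm_hom A A'] (perm_hom A B') (perm_comp A A' B')
        [unary H \<Psi>, point (perm_hom A A') a]
      = mcomp [[], [H]] [perm_hom B B', perm_hom A B] (perm_hom A B') (perm_comp A B B')
        [point (perm_hom B B') b, unary H \<Phi>]"
begin

lemma ide_arr: "Ide (perm_hom A A') a \<in> Arr (perm_hom A A')" "Ide (perm_hom B B') b \<in> Arr (perm_hom B B')"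
  by (auto simp: perm_hom_def monoidal_nat_def a.lax_functor b.lax_functor intro!: Q.A.homI Q.B.homI)

text \<open>The object part of \<open>eq\<close> is an equation of lax functors, so it carries three
  statements at once: on objects, on arrows and on structure morphisms.\<close>

lemma nat_value:
  assumes "s \<in> Obj H"
  shows "lax_comp A B' (LO \<Psi> s) a = lax_comp A B' b (LO \<Phi> s)"
proof -
  have "lax_comp A B' (LO \<Psi> s) a = MO (mcomp [[H], []] [perm_hom A' B', perm_hom A A'] (perm_hom A B') (perm_comp A A' B')
        [unary H \<Psi>, point (perm_hom A A') a]) [s]"
    using assms by (simp add: mcomp_def perm_comp_MO Q.lax_functor_value a.lax_functor)
  also have "\<dots> = lax_comp A B' b (LO \<Phi> s)" unfolding eq
    using assms by (simp add: mcomp_def perm_comp_MO P.lax_functor_value b.lax_functor)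
  finally show ?thesis .
qed

lemma nat_value_obj: "s \<in> Obj H \<Longrightarrow> x \<in> Obj A \<Longrightarrow> LO (LO \<Psi> s) (LO a x) = LO b (LO (LO \<Phi> s) x)"
  using arg_cong[OF nat_value, of s "\<lambda>f. LO f x"] by simp

lemma nat_value_arr: "s \<in> Obj H \<Longrightarrow> w \<in> Arr A \<Longrightarrow> LA (LO \<Psi> s) (LA a w) = LA b (LA (LO \<Phi> s) w)"
  using arg_cong[OF nat_value, of s "\<lambda>f. LA f w"] by simp

lemma nat_value_str:
  "s \<in> Obj H \<Longrightarrow> x \<in> Obj A \<Longrightarrow> y \<in> Obj A \<Longrightarrow>
    LA (LO \<Psi> s) (LS a x y) \<cdot>\<^bsub>B'\<^esub> LS (LO \<Psi> s) (LO a x) (LO a y)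
    = LA b (LS (LO \<Phi> s) x y) \<cdot>\<^bsub>B'\<^esub> LS b (LO (LO \<Phi> s) x) (LO (LO \<Phi> s) y)"
  using arg_cong[OF nat_value, of s "\<lambda>f. LS f x y"] by simp

lemma nat_arr:
  assumes [simp]: "u \<in> Arr H" "x \<in> Obj A"
  shows "components (LA \<Psi> u) (LO a x) = LA b (components (LA \<Phi> u) x)"
proof -
  have "MA (perm_comp A A' B') [LA \<Psi> u, Ide (perm_hom A A') a]
      = MA (mcomp [[H], []] [perm_hom A' B', perm_hom A A'] (perm_hom A B') (perm_comp A A' B')
        [unary H \<Psi>, point (perm_hom A A') a]) [u]"
    by (simp add: mcomp_def)
  also have "\<dots> = MA (perm_comp A B B') [Ide (perm_hom B B') b, LA \<Phi> u]" unfolding eq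
    by (simp add: mcomp_def)
  finally have "components (MA (perm_comp A A' B') [LA \<Psi> u, Ide (perm_hom A A') a]) x
    = components (MA (perm_comp A B B') [Ide (perm_hom B B') b, LA \<Phi> u]) x" by simp
  then show ?thesis
    by (simp add: perm_comp_MA_component ide_arr P.arr_in_perm_hom Q.arr_in_perm_hom
        lax_symmetric_monoidal.LA_ide[OF Q.lax_value])
qed

text \<open>In the first composite of \<open>eq\<close> the hom variable is the first variable of
  composition, whose constraint is an identity; in the second composite it is the second variable,
  whose constraint is the structure morphism of b. This explains the extra factor on one side
  only.\<close>

lemma nat_str:
  assumes [simp]: "s \<in> Obj H" "t \<in> Obj H" "x \<in> Obj A"
  shows "components (LS \<Psi> s t) (LO a x)
    = LA b (components (LS \<Phi> s t) x) \<cdot>\<^bsub>B'\<^esub> LS b (LO (LO \<Phi> s) x) (LO (LO \<Phi> t) x)"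
proof -
  let ?P = "perm_hom A B'"
  have "MA (perm_comp A A' B') [LS \<Psi> s t, Ide (perm_hom A A') a] \<cdot>\<^bsub>?P\<^esub> MD (perm_comp A A' B') 0 [LO \<Psi> s, a] (LO \<Psi> t)
      = MD (mcomp [[H], []] [perm_hom A' B', perm_hom A A'] (perm_hom A B') (perm_comp A A' B')
        [unary H \<Psi>, point (perm_hom A A') a]) 0 [s] t"
    by (simp add: mcomp_def Let_def)
  also have "\<dots> = MA (perm_comp A B B') [Ide (perm_hom B B') b, LS \<Phi> s t] \<cdot>\<^bsub>?P\<^esub> MD (perm_comp A B B') (Suc 0) [b, LO \<Phi> s] (LO \<Phi> t)"
    unfolding eq by (simp add: mcomp_def Let_def)
  finally have "components (MA (perm_comp A A' B') [LS \<Psi> s t, Ide (perm_hom A A') a]) x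
        \<cdot>\<^bsub>B'\<^esub> components (MD (perm_comp A A' B') 0 [LO \<Psi> s, a] (LO \<Psi> t)) x
      = components (MA (perm_comp A B B') [Ide (perm_hom B B') b, LS \<Phi> s t]) x
        \<cdot>\<^bsub>B'\<^esub> components (MD (perm_comp A B B') (Suc 0) [b, LO \<Phi> s] (LO \<Phi> t)) x"
    by (simp only: perm_hom_comp_component[OF assms(3), symmetric])
  then show ?thesis
    by (simp add: perm_comp_MA_component perm_comp_MD_component ide_arr P.str_in_perm_hom Q.str_in_perm_hom
        P.str_ends Q.str_ends lax_add_def P.lax_functor_value Q.lax_functor_value a.lax_functor b.lax_functor
        lax_symmetric_monoidal.LA_ide[OF Q.lax_value])
qed

lemma perm_eval_natural:
  "mcomp [[H], [A]] [H, A'] B' (perm_eval H A' B' \<Psi>) [unary H (lax_id H), unary A a]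
    = mcomp [[H, A]] [B] B' (unary B b) [perm_eval H A B \<Phi>]"
  unfolding mcomp_def Let_def concat.simps append.simps list.map
proof (rule mk_mfun_cong, goal_cases)
  case (1 xs)
  then show ?case by (auto simp: obj_tuples_iff nat_value_obj)
next
  case (2 us)
  then obtain u w where us: "us = [u, w]" and [simp]: "u \<in> Arr H" "w \<in> Arr A"
    by (auto simp: arr_tuples_iff)
  show ?case
    by (simp add: us b.LA_comp nat_arr nat_value_arr)
next
  case (3 i xs y)
  then obtain s x where xs: "xs = [s, x]" and [simp]: "s \<in> Obj H" "x \<in> Obj A"
    by (auto simp: obj_tuples_iff)
  from 3(1) consider "i = 0" | "i = Suc 0" by force
  then show ?case
  proof cases
    case 1
    with 3 have [simp]: "y \<in> Obj H" by simp
    show ?thesis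
      by (simp add: 1 xs nat_str Q.arr_ide lax_symmetric_monoidal.LA_ide[OF Q.lax_value] nat_value_obj)
  next
    case 2
    with 3 have [simp]: "y \<in> Obj A" by simp
    show ?thesis
      using nat_value_str[of s x y] by (simp add: 2 xs Q.arr_ide)
  qed
qed

end

section \<open>The spectral functor of a \<open>PC\<close>-functor\<close>

lemma lax_functor_lax_id:
  assumes "permutative_category A"
  shows "lax_functor A A (lax_id A)"
proof -
  interpret permutative A by (rule permutativeI) fact
  have "continuous_map (HTop A x y) (HTop A x y) (LA (lax_id A))" if "x \<in> Obj A" "y \<in> Obj A" for x y
    by (rule continuous_map_eq[OF continuous_map_id]) (use that in \<open>auto simp: topspace_hom homset_def\<close>)
  moreover have "lax_id A = mk_lax A (LO (lax_id A)) (LA (lax_id A)) (LS (lax_id A))"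
    by (auto simp: lax_id_def mk_lax_def intro!: ext)
  ultimately show ?thesis
    unfolding lax_functor_def is_functor_def by (auto simp: add_assoc intro!: homI)
qed

section \<open>The multifunctor K on functors of at most three variables\<close>

locale k_theory = closed_smc V
  for V :: "('s, 't) smc" (structure) +
  fixes Ko :: "('o, 'a) permcat \<Rightarrow> 's"
    and Km :: "('o, 'a) permcat list \<Rightarrow> ('o, 'a) permcat \<Rightarrow> ('o, 'a, 'o, 'a) mfun \<Rightarrow> 't"
  assumes multifunctor: "multifunctor perm_multicat (smc_multicat V) Ko Km"
begin

lemma Ko_obj [simp]: "permutative_category A \<Longrightarrow> Ko A \<in> Obj V"
  using multifunctor by (simp add: multifunctor_def perm_multicat_def smc_multicat_def)

lemma Km_hom:
  assumes "\<forall>A\<in>set As. permutative_category A" "permutative_category B" "multilinear As B f"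
  shows "Km As B f \<in> homset V (tens V (map Ko As)) (Ko B)"
proof -
  have "\<forall>As B f. set As \<subseteq> {A. permutative_category A} \<and> permutative_category B \<and> multilinear As B f \<longrightarrow>
      Km As B f \<in> homset V (tens V (map Ko As)) (Ko B)"
    using multifunctor unfolding multifunctor_def perm_multicat_def smc_multicat_def by simp
  then show ?thesis using assms by blast
qed

lemma Km_ide: "permutative_category A \<Longrightarrow> Km [A] A (unary A (lax_id A)) = Ide V (Ko A)"
  using multifunctor by (simp add: multifunctor_def perm_multicat_def smc_multicat_def)

lemma Km_comp:
  assumes "length Ass = length Bs" "length fs = length Bs" "\<forall>A\<in>set (concat Ass). permutative_category A"
    "\<forall>B\<in>set Bs. permutative_category B" "permutative_category C" "multilinear Bs C g"
    "\<forall>j<length Bs. multilinear (Ass ! j) (Bs ! j) (fs ! j)"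
  shows "Km (concat Ass) C (mcomp Ass Bs C g fs)
    = Km Bs C g \<cdot> tensA V (map (\<lambda>j. Km (Ass ! j) (Bs ! j) (fs ! j)) [0..<length Bs]) \<cdot> tens_concat V (map (map Ko) Ass)"
proof -
  have "\<forall>Ass Bs C g fs.
        length Ass = length Bs \<and> length fs = length Bs \<and>
        set (concat Ass) \<subseteq> {A. permutative_category A} \<and> set Bs \<subseteq> {A. permutative_category A} \<and> permutative_category C \<and>
        multilinear Bs C g \<and> (\<forall>j<length Bs. multilinear (Ass ! j) (Bs ! j) (fs ! j)) \<longrightarrow>
        Km (concat Ass) C (mcomp Ass Bs C g fs)
          = Km Bs C g \<cdot> tensA V (map (\<lambda>j. Km (Ass ! j) (Bs ! j) (fs ! j)) [0..<length Bs]) \<cdot> tens_concat V (map (map Ko) Ass)"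
    using multifunctor[unfolded multifunctor_def, THEN conjunct2, THEN conjunct2, THEN conjunct2, THEN conjunct1]
    unfolding perm_multicat_def smc_multicat_def multicat.simps mem_Collect_eq .
  then show ?thesis using assms by blast
qed

lemma Km_swap:
  assumes "permutative_category A" "permutative_category B" "permutative_category C" "multilinear [A, B] C f"
  shows "Km [B, A] C (mswap [A, B] 0 f) = Km [A, B] C f \<cdot> Brd V (Ko B) (Ko A)"
proof -
  have "\<forall>As B i f. set As \<subseteq> {A. permutative_category A} \<and> permutative_category B \<and> multilinear As B f \<and> Suc i < length As \<longrightarrow>
        Km (swap_list i As) B (mswap As i f) = Km As B f \<cdot> tens_swap V i (swap_list i (map Ko As))"
    using multifunctor[unfolded multifunctor_def, THEN conjunct2, THEN conjunct2, THEN conjunct2, THEN conjunct2]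
    unfolding perm_multicat_def smc_multicat_def multicat.simps mem_Collect_eq .
  from this[rule_format, of "[A, B]" C f 0] show ?thesis
    using assms by (simp add: swap_list_def)
qed

lemma Km_pair_hom:
  assumes "permutative_category A" "permutative_category B" "permutative_category C" "multilinear [A, B] C f"
  shows "Km [A, B] C f \<in> homset V (Ko A \<and>o Ko B) (Ko C)"
  using Km_hom[of "[A, B]" C f] assms by simp

lemma Km_unary_hom:
  assumes "permutative_category A" "permutative_category B" "multilinear [A] B f"
  shows "Km [A] B f \<in> homset V (Ko A) (Ko B)"
  using Km_hom[of "[A]" B f] assms by simp

lemma Km_point_hom:
  assumes "permutative_category B" "multilinear [] B f"
  shows "Km [] B f \<in> homset V (Unt V) (Ko B)"
  using Km_hom[of "[]" B f] assms by simp

lemma multilinear_unary_id: "permutative_category A \<Longrightarrow> multilinear [A] A (unary A (lax_id A))"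
  by (intro lax_symmetric_monoidal.multilinear_unary lax_symmetric_monoidalI lax_functor_lax_id)

text \<open>Since \<open>tens\<close> is bracketed to the right, grouping the first two of three
  factors costs an inverse associator.\<close>

lemma Km_comp_left:
  assumes [simp]: "permutative_category A" "permutative_category B" "permutative_category C" "permutative_category L" "permutative_category M"
    and g: "multilinear [L, C] M g" and f: "multilinear [A, B] L f"
  shows "Km [A, B, C] M (mcomp [[A, B], [C]] [L, C] M g [f, unary C (lax_id C)])
    = Km [L, C] M g \<cdot> (Km [A, B] L f \<and>a Ide V (Ko C)) \<cdot> inv_arrow V (Asc V (Ko A) (Ko B) (Ko C))"
proof -
  note [simp] = homD[OF Km_pair_hom[OF _ _ _ f]] homD[OF Km_pair_hom[OF _ _ _ g]]
    inv_arrow_simps[of "Asc V (Ko A) (Ko B) (Ko C)"]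
  show ?thesis
    using Km_comp[of "[[A, B], [C]]" "[L, C]" "[f, unary C (lax_id C)]" M g] g f
    by (simp add: multilinear_unary_id All_less_Suc2 Km_ide comp_assoc)
qed

text \<open>Grouping the last two factors agrees with the bracketing of \<open>tens\<close>, so the
  coherence isomorphism is an identity.\<close>

lemma Km_comp_right:
  assumes [simp]: "permutative_category A" "permutative_category B" "permutative_category C" "permutative_category L" "permutative_category M"
    and g: "multilinear [A, L] M g" and f: "multilinear [B, C] L f"
  shows "Km [A, B, C] M (mcomp [[A], [B, C]] [A, L] M g [unary A (lax_id A), f])
    = Km [A, L] M g \<cdot> (Ide V (Ko A) \<and>a Km [B, C] L f)"
proof -
  note [simp] = homD[OF Km_pair_hom[OF _ _ _ f]] homD[OF Km_pair_hom[OF _ _ _ g]]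
  show ?thesis
    using Km_comp[of "[[A], [B, C]]" "[A, L]" "[unary A (lax_id A), f]" M g] g f
    by (simp add: multilinear_unary_id All_less_Suc2 Km_ide)
qed

text \<open>A 0-morphism corresponds to an empty block of factors, whose tensor is the unit; it is
  created by the inverse left unitor.\<close>

lemma Km_comp_point:
  assumes [simp]: "permutative_category A" "permutative_category L" "permutative_category M"
    and g: "multilinear [L, A] M g" and f: "multilinear [] L f"
  shows "Km [A] M (mcomp [[], [A]] [L, A] M g [f, unary A (lax_id A)])
    = Km [L, A] M g \<cdot> (Km [] L f \<and>a Ide V (Ko A)) \<cdot> inv_arrow V (LUn V (Ko A))"
proof -
  note [simp] = homD[OF Km_point_hom[OF _ f]] homD[OF Km_pair_hom[OF _ _ _ g]]
    inv_arrow_simps[of "LUn V (Ko A)"]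
  show ?thesis
    using Km_comp[of "[[], [A]]" "[L, A]" "[f, unary A (lax_id A)]" M g] g f
    by (simp add: multilinear_unary_id All_less_Suc2 Km_ide)
qed

lemma Km_comp_unary_right:
  assumes [simp]: "permutative_category A" "permutative_category B" "permutative_category C" "permutative_category M"
    and g: "multilinear [A, C] M g" and f: "multilinear [B] C f"
  shows "Km [A, B] M (mcomp [[A], [B]] [A, C] M g [unary A (lax_id A), f])
    = Km [A, C] M g \<cdot> (Ide V (Ko A) \<and>a Km [B] C f)"
proof -
  note [simp] = homD[OF Km_unary_hom[OF _ _ f]] homD[OF Km_pair_hom[OF _ _ _ g]]
  show ?thesis
    using Km_comp[of "[[A], [B]]" "[A, C]" "[unary A (lax_id A), f]" M g] g f
    by (simp add: multilinear_unary_id All_less_Suc2 Km_ide)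
qed

lemma Km_comp_unary_pair:
  assumes [simp]: "permutative_category A" "permutative_category B" "permutative_category C" "permutative_category M"
    and g: "multilinear [C] M g" and f: "multilinear [A, B] C f"
  shows "Km [A, B] M (mcomp [[A, B]] [C] M g [f]) = Km [C] M g \<cdot> Km [A, B] C f"
proof -
  note [simp] = homD[OF Km_pair_hom[OF _ _ _ f]] homD[OF Km_unary_hom[OF _ _ g]]
  show ?thesis
    using Km_comp[of "[[A, B]]" "[C]" "[f]" M g] g f by simp
qed

lemma Km_comp_unary:
  assumes [simp]: "permutative_category A" "permutative_category B" "permutative_category C"
    and g: "multilinear [B] C g" and f: "multilinear [A] B f"
  shows "Km [A] C (mcomp [[A]] [B] C g [f]) = Km [B] C g \<cdot> Km [A] B f"
proof -
  note [simp] = homD[OF Km_unary_hom[OF _ _ f]] homD[OF Km_unary_hom[OF _ _ g]]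
  show ?thesis
    using Km_comp[of "[[A]]" "[B]" "[f]" C g] g f by simp
qed

end

section \<open>PC-functors from the opposite of C to Perm\<close>

type_synonym ('x, 'o, 'a) perm_valued = "('x, 'o, 'a, ('o, 'a) permcat, ('o, 'a) lax, ('o, 'a) laxnt) pcfun"

locale k_theory_pc = k_theory V Ko Km
  for V :: "('s, 't) smc" (structure)
    and Ko :: "('o, 'a) permcat \<Rightarrow> 's"
    and Km :: "('o, 'a) permcat list \<Rightarrow> ('o, 'a) permcat \<Rightarrow> ('o, 'a, 'o, 'a) mfun \<Rightarrow> 't" +
  fixes C :: "('x, 'o, 'a) pccat"
  assumes pc: "pc_category C"
begin

lemma hom_perm [simp]: "X \<in> PcObj C \<Longrightarrow> Y \<in> PcObj C \<Longrightarrow> permutative_category (PcHom C X Y)"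
  using pc by (simp add: pc_category_def)

lemma op_comp:
  assumes "X \<in> PcObj C" "Y \<in> PcObj C" "Z \<in> PcObj C"
  shows "multilinear [PcHom C Z Y, PcHom C Y X] (PcHom C Z X) (PcComp (pc_op C) X Y Z)"
proof -
  have "multilinear [PcHom C Y X, PcHom C Z Y] (PcHom C Z X) (PcComp C Z Y X)"
    using pc assms by (simp add: pc_category_def)
  from multilinear_mswap_pair[OF _ _ _ this] show ?thesis
    using assms by (simp add: pc_op_def)
qed

abbreviation source :: "('x, 's, 't) vcat" where
  "source \<equiv> v_op V (K_bullet Ko Km C)"

lemma source_simps [simp]:
  "VObj source = PcObj C" "VHom source X Y = Ko (PcHom C Y X)"
  "VIde source X = Km [] (PcHom C X X) (point (PcHom C X X) (PcIde C X))"
  by (simp_all add: v_op_def K_bullet_def)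

text \<open>Compatibility of \<open>K\<close> with the symmetry identifies \<open>op\<close> before and after \<open>K\<close>.\<close>

lemma source_comp:
  assumes "X \<in> PcObj C" "Y \<in> PcObj C" "Z \<in> PcObj C"
  shows "VComp source X Y Z
    = Km [PcHom C Z Y, PcHom C Y X] (PcHom C Z X) (PcComp (pc_op C) X Y Z)"
proof -
  have "multilinear [PcHom C Y X, PcHom C Z Y] (PcHom C Z X) (PcComp C Z Y X)"
    using pc assms by (simp add: pc_category_def)
  then show ?thesis
    using assms by (simp add: Km_swap v_op_def K_bullet_def pc_op_def)
qed

text \<open>The hom is \<open>PcHom C Y X\<close>, not \<open>PcHom C X Y\<close>: it is the hom
  from X to Y in \<open>pc_op C\<close>, on which \<open>PM F X Y\<close> is defined.\<close>

definition evaluation :: "('x, 'o, 'a) perm_valued \<Rightarrow> 'x \<Rightarrow> 'x \<Rightarrow> 't" where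
  "evaluation F X Y = Km [PcHom C Y X, PO F X] (PO F Y) (perm_eval (PcHom C Y X) (PO F X) (PO F Y) (PM F X Y))"

definition K_fun :: "('x, 'o, 'a) perm_valued \<Rightarrow> ('x, 's, 't) vfun" where
  "K_fun F = \<lparr>VO = (\<lambda>X\<in>PcObj C. Ko (PO F X)),
     VM = (\<lambda>X Y. if X \<in> PcObj C \<and> Y \<in> PcObj C
       then curry_arrow V (Ko (PcHom C Y X)) (Ko (PO F X)) (Ko (PO F Y)) (evaluation F X Y) else undefined)\<rparr>"

definition K_nat :: "('x, 'o, 'a) perm_valued \<times> ('x \<Rightarrow> ('o, 'a) lax) \<times> ('x, 'o, 'a) perm_valued
    \<Rightarrow> ('x, 's, 't) vfun \<times> ('x \<Rightarrow> 't) \<times> ('x, 's, 't) vfun" where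
  "K_nat = (\<lambda>(F, \<alpha>, F').
     (K_fun F, (\<lambda>X\<in>PcObj C. global_elt (Ko (PO F X)) (Ko (PO F' X)) (Km [PO F X] (PO F' X) (unary (PO F X) (\<alpha> X)))), K_fun F'))"

context
  fixes F :: "('x, 'o, 'a) perm_valued"
  assumes F: "pc_functor (pc_op C) Perm F"
begin

lemma value_perm [simp]: "X \<in> PcObj C \<Longrightarrow> permutative_category (PO F X)"
  using F by (auto simp: pc_functor_def pc_op_def Perm_def)

lemma value_lax:
  assumes "X \<in> PcObj C" "Y \<in> PcObj C"
  shows "lax_to_perm_hom (PcHom C Y X) (PO F X) (PO F Y) (PM F X Y)"
proof -
  have "lax_functor (PcHom C Y X) (perm_hom (PO F X) (PO F Y)) (PM F X Y)"
    using F assms by (simp add: pc_functor_def pc_op_def Perm_def)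
  then show ?thesis using assms
    by (simp add: lax_to_perm_hom_def lax_to_perm_hom_axioms_def permutativeI)
qed

lemma value_eval:
  assumes "X \<in> PcObj C" "Y \<in> PcObj C"
  shows "multilinear [PcHom C Y X, PO F X] (PO F Y) (perm_eval (PcHom C Y X) (PO F X) (PO F Y) (PM F X Y))"
  by (rule lax_to_perm_hom.multilinear_perm_eval[OF value_lax[OF assms]])

lemma evaluation_hom:
  assumes "X \<in> PcObj C" "Y \<in> PcObj C"
  shows "evaluation F X Y \<in> homset V (Ko (PcHom C Y X) \<and>o Ko (PO F X)) (Ko (PO F Y))"
  unfolding evaluation_def using assms by (intro Km_pair_hom value_eval) simp_all

text \<open>The image of \<open>perm_eval_comp\<close> under K, in the shape of the premise
  \<open>eq\<close> of \<open>curry_comp\<close>.\<close>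

lemma evaluation_comp:
  assumes [simp]: "X \<in> PcObj C" "Y \<in> PcObj C" "Z \<in> PcObj C"
  shows "evaluation F X Z \<cdot> (VComp source X Y Z \<and>a Ide V (Ko (PO F X)))
    = evaluation F Y Z \<cdot> ((Ide V (Ko (PcHom C Z Y)) \<and>a evaluation F X Y)
      \<cdot> Asc V (Ko (PcHom C Z Y)) (Ko (PcHom C Y X)) (Ko (PO F X)))"
proof -
  let ?H = "PcHom C Y X" and ?K = "PcHom C Z Y" and ?L = "PcHom C Z X"
  let ?c = "PcComp (pc_op C) X Y Z"
  interpret perm_composition ?H ?K ?L "PO F X" "PO F Y" "PO F Z" "PM F X Y" "PM F Y Z" "PM F X Z" ?c
    unfolding perm_composition_def perm_composition_axioms_def
    using F op_comp[of X Y Z] by (simp add: value_lax pc_functor_def pc_op_def Perm_def)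
  note c = op_comp[of X Y Z, simplified]
  note [simp] = homD[OF evaluation_hom] homD[OF Km_pair_hom[OF _ _ _ c]]
    inv_arrow_simps[of "Asc V (Ko ?K) (Ko ?H) (Ko (PO F X))"]
  have "evaluation F X Z \<cdot> (Km [?K, ?H] ?L ?c \<and>a Ide V (Ko (PO F X))) \<cdot> inv_arrow V (Asc V (Ko ?K) (Ko ?H) (Ko (PO F X)))
      = evaluation F Y Z \<cdot> (Ide V (Ko ?K) \<and>a evaluation F X Y)"
    using arg_cong[OF perm_eval_comp, of "Km [?K, ?H, PO F X] (PO F Z)"]
    by (simp add: Km_comp_left Km_comp_right value_eval c evaluation_def)
  \<comment> \<open>Composing with the associator on the right cancels the inverse that comes from
    \<open>Km_comp_left\<close>.\<close>
  then have "evaluation F X Z \<cdot> (Km [?K, ?H] ?L ?c \<and>a Ide V (Ko (PO F X))) \<cdot> inv_arrow V (Asc V (Ko ?K) (Ko ?H) (Ko (PO F X)))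
        \<cdot> Asc V (Ko ?K) (Ko ?H) (Ko (PO F X))
      = evaluation F Y Z \<cdot> (Ide V (Ko ?K) \<and>a evaluation F X Y) \<cdot> Asc V (Ko ?K) (Ko ?H) (Ko (PO F X))"
    by simp
  then show ?thesis
    by (simp add: source_comp comp_assoc)
qed

lemma ide_obj: "X \<in> PcObj C \<Longrightarrow> PcIde C X \<in> Obj (PcHom C X X)"
  using pc by (simp add: pc_category_def)

lemma source_ide_hom:
  "X \<in> PcObj C \<Longrightarrow> VIde source X \<in> homset V (Unt V) (Ko (PcHom C X X))"
  unfolding source_simps by (intro Km_point_hom multilinear_point ide_obj) simp_all

text \<open>The image of \<open>perm_eval_ide\<close> under K: restricted along the unit of C(X,X),
  the action is the left unitor. The inverse unitor from \<open>Km_comp_point\<close> is moved to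
  the other side.\<close>

lemma evaluation_ide:
  assumes [simp]: "X \<in> PcObj C"
  shows "evaluation F X X \<cdot> (VIde source X \<and>a Ide V (Ko (PO F X))) = LUn V (Ko (PO F X))"
proof -
  let ?H = "PcHom C X X"
  interpret lax_to_perm_hom ?H "PO F X" "PO F X" "PM F X X" by (rule value_lax) simp_all
  have pt: "multilinear [] ?H (point ?H (PcIde C X))"
    by (intro multilinear_point ide_obj) simp_all
  have "LO (PM F X X) (PcIde C X) = lax_id (PO F X)"
    using F by (simp add: pc_functor_def pc_op_def Perm_def)
  note eq = perm_eval_ide[OF refl ide_obj[OF assms] this]
  note [simp] = homD[OF evaluation_hom] homD[OF Km_point_hom[OF _ pt]] inv_arrow_simps[of "LUn V (Ko (PO F X))"]
  have "evaluation F X X \<cdot> (Km [] ?H (point ?H (PcIde C X)) \<and>a Ide V (Ko (PO F X))) \<cdot> inv_arrow V (LUn V (Ko (PO F X)))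
      = Ide V (Ko (PO F X))"
    using arg_cong[OF eq, of "Km [PO F X] (PO F X)"]
    by (simp add: Km_comp_point value_eval pt Km_ide evaluation_def)
  then have "evaluation F X X \<cdot> (Km [] ?H (point ?H (PcIde C X)) \<and>a Ide V (Ko (PO F X))) \<cdot> inv_arrow V (LUn V (Ko (PO F X)))
      \<cdot> LUn V (Ko (PO F X)) = Ide V (Ko (PO F X)) \<cdot> LUn V (Ko (PO F X))" by simp
  then show ?thesis by (simp add: comp_assoc)
qed

lemma v_functor_K_fun: "v_functor V source (v_self V) (K_fun F)"
  unfolding v_functor_def source_simps
proof (intro conjI ballI allI impI)
  show "VO (K_fun F) \<in> PcObj C \<rightarrow>\<^sub>E VObj (v_self V)"
    by (simp add: K_fun_def v_self_def)
  show "VM (K_fun F) X Y = undefined" if "X \<notin> PcObj C \<or> Y \<notin> PcObj C" for X Y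
    using that by (auto simp: K_fun_def)
next
  fix X Y assume [simp]: "X \<in> PcObj C" "Y \<in> PcObj C"
  note [simp] = homD[OF evaluation_hom]
  show "VM (K_fun F) X Y \<in> homset V (Ko (PcHom C Y X)) (VHom (v_self V) (VO (K_fun F) X) (VO (K_fun F) Y))"
    by (rule homI) (simp_all add: K_fun_def v_self_def)
next
  fix X Y Z assume [simp]: "X \<in> PcObj C" "Y \<in> PcObj C" "Z \<in> PcObj C"
  have c: "VComp source X Y Z \<in> homset V (Ko (PcHom C Z Y) \<and>o Ko (PcHom C Y X)) (Ko (PcHom C Z X))"
    unfolding source_comp[OF \<open>X \<in> _\<close> \<open>Y \<in> _\<close> \<open>Z \<in> _\<close>] by (intro Km_pair_hom op_comp) simp_all
  show "VM (K_fun F) X Z \<cdot> VComp source X Y Z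
      = VComp (v_self V) (VO (K_fun F) X) (VO (K_fun F) Y) (VO (K_fun F) Z) \<cdot> (VM (K_fun F) Y Z \<and>a VM (K_fun F) X Y)"
    using curry_comp[OF _ _ _ _ _ _ evaluation_hom evaluation_hom evaluation_hom c evaluation_comp]
    by (simp add: K_fun_def)
next
  fix X assume [simp]: "X \<in> PcObj C"
  \<comment> \<open>Precomposing with the unit and currying commute; by
    \<open>evaluation_ide\<close> the curried arrow is then the left unitor, whose transpose is by
    definition the identity in \<open>v_self\<close>.\<close>
  have "VM (K_fun F) X X \<cdot> VIde source X
      = curry_arrow V (Unt V) (Ko (PO F X)) (Ko (PO F X)) (evaluation F X X \<cdot> (VIde source X \<and>a Ide V (Ko (PO F X))))"
    by (simp add: K_fun_def del: source_simps) (intro curry_precomp evaluation_hom source_ide_hom; simp)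
  also have "\<dots> = VIde (v_self V) (VO (K_fun F) X)"
    by (simp only: evaluation_ide \<open>X \<in> _\<close>) (simp add: K_fun_def v_self_def)
  finally show "VM (K_fun F) X X \<cdot> Km [] (PcHom C X X) (point (PcHom C X X) (PcIde C X)) = VIde (v_self V) (VO (K_fun F) X)"
    by simp
qed

end

section \<open>Spectral transformations and functoriality\<close>

lemma nat_lax:
  fixes F F' :: "('x, 'o, 'a) perm_valued"
  assumes "pc_functor (pc_op C) Perm F" "pc_functor (pc_op C) Perm F'" "pc_nat (pc_op C) Perm F F' \<alpha>" "X \<in> PcObj C"
  shows "lax_symmetric_monoidal (PO F X) (PO F' X) (\<alpha> X)"
proof -
  have "\<alpha> X \<in> Obj (perm_hom (PO F X) (PO F' X))"
    using assms(3,4) by (simp add: pc_nat_def pc_op_def Perm_def)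
  then show ?thesis
    using assms by (intro lax_symmetric_monoidalI value_perm) (simp_all add: perm_hom_obj)
qed

lemma K_unary_hom:
  assumes "pc_functor (pc_op C) Perm F" "pc_functor (pc_op C) Perm F'" "pc_nat (pc_op C) Perm F F' \<alpha>" "X \<in> PcObj C"
  shows "Km [PO F X] (PO F' X) (unary (PO F X) (\<alpha> X)) \<in> homset V (Ko (PO F X)) (Ko (PO F' X))"
  by (intro Km_unary_hom value_perm[OF assms(1)] value_perm[OF assms(2)]
      lax_symmetric_monoidal.multilinear_unary nat_lax assms)

lemma v_nat_K_nat:
  assumes F: "pc_functor (pc_op C) Perm F" and F': "pc_functor (pc_op C) Perm F'"
    and \<alpha>: "pc_nat (pc_op C) Perm F F' \<alpha>"
  shows "v_nat V source (v_self V) (K_fun F) (K_fun F')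
    (\<lambda>X\<in>PcObj C. global_elt (Ko (PO F X)) (Ko (PO F' X)) (Km [PO F X] (PO F' X) (unary (PO F X) (\<alpha> X))))"
  unfolding v_nat_def source_simps
proof (intro conjI ballI)
  note [simp] = value_perm[OF F] value_perm[OF F']
  fix X Y assume [simp]: "X \<in> PcObj C" "Y \<in> PcObj C"
  let ?H = "PcHom C Y X"
  let ?a = "\<lambda>X. Km [PO F X] (PO F' X) (unary (PO F X) (\<alpha> X))"
  interpret perm_naturality ?H "PO F X" "PO F Y" "PO F' X" "PO F' Y" "PM F X Y" "PM F' X Y" "\<alpha> X" "\<alpha> Y"
    unfolding perm_naturality_def perm_naturality_axioms_def
    using \<alpha> by (simp add: value_lax[OF F] value_lax[OF F'] nat_lax[OF F F' \<alpha>] pc_nat_def pc_op_def Perm_def)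
  \<comment> \<open>The image of \<open>perm_eval_natural\<close> under K, which is the premise
    \<open>eq\<close> of \<open>curry_natural\<close>.\<close>
  have "evaluation F' X Y \<cdot> (Ide V (Ko ?H) \<and>a ?a X) = ?a Y \<cdot> evaluation F X Y"
    using arg_cong[OF perm_eval_natural, of "Km [?H, PO F X] (PO F' Y)"]
    by (simp add: Km_comp_unary_right Km_comp_unary_pair evaluation_def value_eval[OF F] value_eval[OF F']
        a.multilinear_unary b.multilinear_unary)
  from curry_natural[OF _ _ _ _ _ evaluation_hom[OF F] evaluation_hom[OF F']
      K_unary_hom[OF F F' \<alpha>] K_unary_hom[OF F F' \<alpha>] this]
  show "VComp (v_self V) (VO (K_fun F) X) (VO (K_fun F') X) (VO (K_fun F') Y) \<cdot>
      (VM (K_fun F') X Y \<and>a (\<lambda>X\<in>PcObj C. global_elt (Ko (PO F X)) (Ko (PO F' X)) (?a X)) X) \<cdot>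
      inv_arrow V (RUn V (Ko ?H))
    = VComp (v_self V) (VO (K_fun F) X) (VO (K_fun F) Y) (VO (K_fun F') Y) \<cdot>
      ((\<lambda>X\<in>PcObj C. global_elt (Ko (PO F X)) (Ko (PO F' X)) (?a X)) Y \<and>a VM (K_fun F) X Y) \<cdot>
      inv_arrow V (LUn V (Ko ?H))"
    by (simp add: K_fun_def)
next
  note [simp] = value_perm[OF F] value_perm[OF F']
  fix X assume [simp]: "X \<in> PcObj C"
  show "(\<lambda>X\<in>PcObj C. global_elt (Ko (PO F X)) (Ko (PO F' X)) (Km [PO F X] (PO F' X) (unary (PO F X) (\<alpha> X)))) X
      \<in> homset V (Unt V) (VHom (v_self V) (VO (K_fun F) X) (VO (K_fun F') X))"
    using global_elt_hom[OF _ _ K_unary_hom[OF F F' \<alpha>]] by (simp add: K_fun_def v_self_def)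
qed simp

abbreviation (input) perm_functors where
  "perm_functors \<equiv> Fun_PC (pc_op C) (Perm :: (('o, 'a) permcat, ('o, 'a) lax, ('o, 'a) laxnt) pccat)"

text \<open>Identities and composites of transformations are formed pointwise, so functoriality
  comes down to K preserving identities and unary composites, and to \<open>global_elt\<close>
  carrying these to the identities and composites of \<open>v_self\<close>.\<close>

theorem K_functor:
  "is_functor perm_functors (Fun_V V source (v_self V)) K_fun K_nat"
  unfolding is_functor_def
proof (intro conjI ballI impI)
  fix F :: "('x, 'o, 'a) perm_valued"
  assume "F \<in> Obj perm_functors"
  then have F: "pc_functor (pc_op C) Perm F" by (simp add: Fun_PC_def)
  then show "K_fun F \<in> Obj (Fun_V V source (v_self V))"
    by (simp add: Fun_V_def v_functor_K_fun)
  show "K_nat (Ide perm_functors F) = Ide (Fun_V V source (v_self V)) (K_fun F)"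
    using value_perm[OF F]
    by (auto simp: Fun_PC_def Fun_V_def K_nat_def pc_op_def Perm_def Km_ide global_elt_ide K_fun_def intro!: restrict_ext)
next
  fix t assume "t \<in> Arr perm_functors"
  then obtain F \<alpha> F' where t: "t = (F, \<alpha>, F')" and F: "pc_functor (pc_op C) Perm F"
    and F': "pc_functor (pc_op C) Perm F'" and \<alpha>: "pc_nat (pc_op C) Perm F F' \<alpha>"
    by (auto simp: Fun_PC_def)
  show "K_nat t \<in> homset (Fun_V V source (v_self V))
      (K_fun (Dom perm_functors t)) (K_fun (Cod perm_functors t))"
    using F F' v_nat_K_nat[OF F F' \<alpha>]
    by (simp add: homset_def Fun_V_def Fun_PC_def t K_nat_def v_functor_K_fun)
next
  fix t t' assume "t \<in> Arr perm_functors" "t' \<in> Arr perm_functors"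
    "Cod perm_functors t = Dom perm_functors t'"
  then obtain F \<alpha> F' \<beta> F'' where t: "t = (F, \<alpha>, F')" "t' = (F', \<beta>, F'')" and F: "pc_functor (pc_op C) Perm F"
    and F': "pc_functor (pc_op C) Perm F'" and F'': "pc_functor (pc_op C) Perm F''"
    and \<alpha>: "pc_nat (pc_op C) Perm F F' \<alpha>" and \<beta>: "pc_nat (pc_op C) Perm F' F'' \<beta>"
    by (auto simp: Fun_PC_def)
  note [simp] = value_perm[OF F] value_perm[OF F'] value_perm[OF F'']
  have "global_elt (Ko (PO F X)) (Ko (PO F'' X)) (Km [PO F X] (PO F'' X)
        (unary (PO F X) (MO (perm_comp (PO F X) (PO F' X) (PO F'' X)) [\<beta> X, \<alpha> X])))
      = VComp (v_self V) (Ko (PO F X)) (Ko (PO F' X)) (Ko (PO F'' X)) \<cdot>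
        (global_elt (Ko (PO F' X)) (Ko (PO F'' X)) (Km [PO F' X] (PO F'' X) (unary (PO F' X) (\<beta> X))) \<and>a
         global_elt (Ko (PO F X)) (Ko (PO F' X)) (Km [PO F X] (PO F' X) (unary (PO F X) (\<alpha> X)))) \<cdot>
        inv_arrow V (LUn V (Unt V))" if [simp]: "X \<in> PcObj C" for X
  proof -
    note a = nat_lax[OF F F' \<alpha> that] and b = nat_lax[OF F' F'' \<beta> that]
    note la = lax_symmetric_monoidal.lax_functor[OF a] and lb = lax_symmetric_monoidal.lax_functor[OF b]
    show ?thesis
      using lax_symmetric_monoidal.multilinear_unary[OF a] lax_symmetric_monoidal.multilinear_unary[OF b]
      by (simp add: perm_comp_MO[OF lb la] unary_lax_comp[OF la] Km_comp_unary
          global_elt_comp[OF _ _ _ K_unary_hom[OF F F' \<alpha>] K_unary_hom[OF F' F'' \<beta>]])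
  qed
  then show "K_nat (t' \<cdot>\<^bsub>perm_functors\<^esub> t) = K_nat t' \<cdot>\<^bsub>Fun_V V source (v_self V)\<^esub> K_nat t"
    by (auto simp: Fun_PC_def Fun_V_def K_nat_def t K_fun_def pc_op_def Perm_def intro!: restrict_ext)
qed

end

theorem theorem1p1:
  fixes G :: "('g, 'z) monoid_scheme"
    and Spec :: "('s, 't) smc"
    and Ko :: "('o, 'a) permcat \<Rightarrow> 's"
    and Km :: "('o, 'a) permcat list \<Rightarrow> ('o, 'a) permcat \<Rightarrow> ('o, 'a, 'o, 'a) mfun \<Rightarrow> 't"
    and pb :: "'g pullbacks"
    and eo :: "'g span \<Rightarrow> 'o"
    and ea :: "'g span_arr \<Rightarrow> 'a"
  assumes "group G" and "finite (carrier G)"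
    and "closed_symmetric_monoidal Spec"
    and "multifunctor perm_multicat (smc_multicat Spec) Ko Km"
    and "encodes_spans G eo ea"
    and "chosen_pullbacks G pb"
    and "pc_category (GE G pb eo ea)"
  shows "\<exists>KGo KGa.
    is_functor (Fun_PC (pc_op (GE G pb eo ea)) Perm)
      (Fun_V Spec (v_op Spec (GB Ko Km G pb eo ea)) (v_self Spec)) KGo KGa \<and>
    (\<forall>X. pc_functor (pc_op (GE G pb eo ea)) Perm X \<longrightarrow>
       (\<forall>A\<in>finite_gsets G. VO (KGo X) A = Ko (PO X A)))"
proof -
  \<comment> \<open>The hom categories of \<open>GE\<close> live on the universe types, so
    \<open>GE\<close> is admissible as C.\<close>
  interpret k_theory_pc Spec Ko Km "GE G pb eo ea"
    by unfold_locales fact+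
  \<comment> \<open>\<open>K_fun\<close> is restricted to the objects of C; identifying these with
    the finite G-sets yields the formula for its values.\<close>
  have "PcObj (GE G pb eo ea) = finite_gsets G"
    by (simp add: GE_def pc_image_def span_pccat_def)
  then show ?thesis
    using K_functor by (intro exI[of _ K_fun] exI[of _ K_nat]) (simp add: K_fun_def GB_def)
qed

end
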